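(* Let $0<\delta<1$ and let $T$ be a time horizon. Let $\mathcal{X}\subset\mathbb{R}^d$ and $\mathcal{Y}\subset\mathbb{R}^m$ be convex and compact, let $\nu>0$, $s:=\nu+d/2$, and let $k$ be a Matérn kernel on $\mathbb{R}^d$ with smoothness $\nu$. Let $g:\mathcal{X}\times\mathcal{Y}\to\mathbb{R}$ satisfy: (A1) there exists $\mu>0$ such that $\nabla^2_{yy}g(x,y)\succeq\mu I_m$ for all $(x,y)\in\mathcal{X}\times\mathcal{Y}$; (A2) $g\in H^{s+1}(\mathcal{X}\times\mathcal{Y})$. Assume that $f:\mathcal{X}\times\mathcal{Y}\to\mathbb{R}$ is $L_f$-Lipschitz with respect to $\|\cdot\|_1$. Then, with probability at least $1-\delta$, the algorithm GP-UCBL (described in the context, with the parameters $\beta_t$ given there) achieves $$R_T=\mathcal{O}\left(m\sqrt{T\gamma_T\left(\gamma_T+\log\frac1\delta\right)}\right).$$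
   Context: **Problem.** The time-invariant bilevel problem is to maximize $f(x,\tilde g(x))$ over $x\in\mathcal{X}$, where $\tilde g(x)=\arg\min_{y\in\mathcal{Y}}g(x,y)$, $f$ is known and $g$ is unknown. At each round $t=1,\dots,T$ the learner selects $x_t\in\mathcal{X}$ and observes $y_t\in\mathbb{R}^m$ with coordinates $y_t^i=\tilde g_i(x_t)+\varepsilon_t^i$, where the $\varepsilon_t^i$ are independent zero-mean sub-Gaussian noises with variance proxy $\sigma^2$ (that is, $\mathbb{E}[e^{\lambda\varepsilon}]\le e^{\lambda^2\sigma^2/2}$ for all $\lambda\in\mathbb{R}$). The regret is $$R_T=\sum_{t=1}^T\Big(\max_{x\in\mathcal{X}}f(x,\tilde g(x))-f(x_t,\tilde g(x_t))\Big).$$ **Kernel and RKHS.** With $l>0$, $$k(x,x')=\frac{2^{1-\nu}}{\Gamma(\nu)}\left(\frac{\|x-x'\|_2}{l}\right)^\nu K_\nu\left(\frac{\|x-x'\|_2}{l}\right),$$ where $K_\nu$ is the modified Bessel function of the second kind. $\mathcal{H}_{k,\mathcal{X}}$ is the RKHS of $k$ restricted to $\mathcal{X}$ (with the quotient norm), and $\|h\|^2_{\mathcal{H}_{k,\mathcal{X}}^m}=\sum_{i=1}^m\|h_i\|^2_{\mathcal{H}_{k,\mathcal{X}}}$. Under (A1) and (A2), $\tilde g\in\mathcal{H}^m_{k,\mathcal{X}}$; $B$ denotes a constant with $\|\tilde g\|_{\mathcal{H}^m_{k,\mathcal{X}}}\le B$. $H^r$ denotes the $L^2$-based Sobolev space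 of regularity $r$. **Information gain.** $\gamma_T=\max_{A\subset\mathcal{X},\,|A|=T}\frac12\log\det(I+\sigma^{-2}K_A)$, where $K_A=[k(a,a')]_{a,a'\in A}$. **Algorithm GP-UCBL.** After step $t$, put $K_t=[k(x_i,x_j)]_{i,j\le t}$, $\Sigma_t=\sigma^2I_t$ and $k_t(x)=(k(x_1,x),\dots,k(x_t,x))^\top$. For each coordinate $i\le m$, set $\mu_t^i(x)=k_t(x)^\top(K_t+\Sigma_t)^{-1}(y_1^i,\dots,y_t^i)^\top$ and $(\sigma_t^i(x))^2=k(x,x)-k_t(x)^\top(K_t+\Sigma_t)^{-1}k_t(x)$. For $t\ge1$ let $$\beta_t=\sqrt{2\log\left(\frac m\delta\,\frac{|\Sigma_{t-1}+K_{t-1}|^{1/2}}{|\Sigma_{t-1}|^{1/2}}\right)}+B$$ (with determinants of empty matrices equal to $1$), and let $\tilde{\mathcal U}_t(x)=\prod_{i=1}^m[\mu^i_{t-1}(x)-\beta_t\sigma^i_{t-1}(x),\ \mu^i_{t-1}(x)+\beta_t\sigma^i_{t-1}(x)]$. The algorithm selects $x_t\in\arg\max_{x\in\mathcal{X}}\max_{y\in\tilde{\mathcal U}_t(x)}f(x,y)$. The $\mathcal{O}$ hides a constant independent of $T$, $\delta$ and $m$. *)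

theory Defs
  imports
    "HOL-Probability.Probability"
    "Jordan_Normal_Form.Determinant"
    "Jordan_Normal_Form.Gauss_Jordan_Elimination"
begin

(* R^m is the set of extensional functions on {..<m}, so that m can be quantified inside a
   statement.  Topological notions (compact, at _ within _) refer to the product topology on
   functions, which restricts to the Euclidean topology on this set. *)

definition coord_space :: "nat \<Rightarrow> (nat \<Rightarrow> real) set" where
  "coord_space m = (\<Pi>\<^sub>E i\<in>{..<m}. UNIV)"

definition coord_dist :: "nat \<Rightarrow> (nat \<Rightarrow> real) \<Rightarrow> (nat \<Rightarrow> real) \<Rightarrow> real" where
  "coord_dist m y z = sqrt (\<Sum>i<m. (y i - z i)\<^sup>2)"

definition coord_convex :: "nat \<Rightarrow> (nat \<Rightarrow> real) set \<Rightarrow> bool" where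
  "coord_convex m Y \<longleftrightarrow>
     (\<forall>y\<in>Y. \<forall>z\<in>Y. \<forall>u\<in>{0..1}. (\<lambda>i\<in>{..<m}. (1 - u) * y i + u * z i) \<in> Y)"

definition lipschitz_l1_on ::
  "nat \<Rightarrow> real \<Rightarrow> 'a::euclidean_space set \<Rightarrow> (nat \<Rightarrow> real) set \<Rightarrow> ('a \<Rightarrow> (nat \<Rightarrow> real) \<Rightarrow> real) \<Rightarrow> bool"
where
  "lipschitz_l1_on m L X Y f \<longleftrightarrow>
     (\<forall>x\<in>X. \<forall>x'\<in>X. \<forall>y\<in>Y. \<forall>y'\<in>Y.
        \<bar>f x y - f x' y'\<bar> \<le> L * ((\<Sum>b\<in>Basis. \<bar>(x - x') \<bullet> b\<bar>) + (\<Sum>i<m. \<bar>y i - y' i\<bar>)))"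

(* Frechet differentiability at y relative to the set Y, with gradient G; at boundary points of Y
   the derivative is taken within Y.  The quotient is only evaluated at z \<noteq> y. *)

definition has_gradient_within ::
  "nat \<Rightarrow> ((nat \<Rightarrow> real) \<Rightarrow> real) \<Rightarrow> (nat \<Rightarrow> real) \<Rightarrow> (nat \<Rightarrow> real) \<Rightarrow> (nat \<Rightarrow> real) set \<Rightarrow> bool"
where
  "has_gradient_within m h G y Y \<longleftrightarrow>
     ((\<lambda>z. (h z - h y - (\<Sum>i<m. G i * (z i - y i))) / coord_dist m z y) \<longlongrightarrow> 0) (at y within Y)"

definition has_hessian_on ::
  "nat \<Rightarrow> ((nat \<Rightarrow> real) \<Rightarrow> real) \<Rightarrow> ((nat \<Rightarrow> real) \<Rightarrow> nat \<Rightarrow> nat \<Rightarrow> real) \<Rightarrow> (nat \<Rightarrow> real) set \<Rightarrow> bool"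
where
  "has_hessian_on m h D Y \<longleftrightarrow>
     (\<exists>G. \<forall>y\<in>Y. has_gradient_within m h (G y) y Y \<and>
        (\<forall>i<m. has_gradient_within m (\<lambda>z. G z i) (D y i) y Y))"

definition uniform_hessian_bound ::
  "nat \<Rightarrow> real \<Rightarrow> 'a set \<Rightarrow> (nat \<Rightarrow> real) set \<Rightarrow> ('a \<Rightarrow> (nat \<Rightarrow> real) \<Rightarrow> real) \<Rightarrow> bool"
where
  "uniform_hessian_bound m \<mu> X Y g \<longleftrightarrow>
     (\<forall>x\<in>X. \<exists>D. has_hessian_on m (g x) D Y \<and>
        (\<forall>y\<in>Y. \<forall>v. (\<Sum>i<m. \<Sum>j<m. v i * D y i j * v j) \<ge> \<mu> * (\<Sum>i<m. (v i)\<^sup>2)))"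

definition lower_sol ::
  "('a \<Rightarrow> (nat \<Rightarrow> real) \<Rightarrow> real) \<Rightarrow> (nat \<Rightarrow> real) set \<Rightarrow> 'a \<Rightarrow> nat \<Rightarrow> real"
where
  "lower_sol g Y x = arg_min_on (g x) Y"

definition joint_lborel :: "nat \<Rightarrow> ('a::euclidean_space \<times> (nat \<Rightarrow> real)) measure" where
  "joint_lborel m = lborel \<Otimes>\<^sub>M (\<Pi>\<^sub>M i\<in>{..<m}. lborel)"

definition joint_inner ::
  "nat \<Rightarrow> 'a::euclidean_space \<times> (nat \<Rightarrow> real) \<Rightarrow> 'a \<times> (nat \<Rightarrow> real) \<Rightarrow> real"
where
  "joint_inner m p q = fst p \<bullet> fst q + (\<Sum>i<m. snd p i * snd q i)"

definition truncated_fourier ::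
  "nat \<Rightarrow> real \<Rightarrow> ('a::euclidean_space \<times> (nat \<Rightarrow> real) \<Rightarrow> real) \<Rightarrow> 'a \<times> (nat \<Rightarrow> real) \<Rightarrow> complex"
where
  "truncated_fourier m R u \<xi> =
     (LINT p|joint_lborel m. indicator {p. joint_inner m p p \<le> R\<^sup>2} p *\<^sub>R
        (complex_of_real (u p) * cis (- joint_inner m \<xi> p)))"

(* The Fourier transform of an L^2 function is the L^2 limit of the transforms of its truncations. *)

definition is_fourier_transform ::
  "nat \<Rightarrow> ('a::euclidean_space \<times> (nat \<Rightarrow> real) \<Rightarrow> real) \<Rightarrow>
   ('a \<times> (nat \<Rightarrow> real) \<Rightarrow> complex) \<Rightarrow> bool"
where
  "is_fourier_transform m u F \<longleftrightarrow>
     F \<in> borel_measurable (joint_lborel m) \<and>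
     integrable (joint_lborel m) (\<lambda>\<xi>. (cmod (F \<xi>))\<^sup>2) \<and>
     ((\<lambda>R. \<integral>\<^sup>+ \<xi>. ennreal ((cmod (F \<xi> - truncated_fourier m R u \<xi>))\<^sup>2) \<partial>joint_lborel m)
        \<longlongrightarrow> 0) at_top"

definition sobolev :: "nat \<Rightarrow> real \<Rightarrow> ('a::euclidean_space \<times> (nat \<Rightarrow> real) \<Rightarrow> real) set" where
  "sobolev m r = {u.
     u \<in> borel_measurable (joint_lborel m) \<and>
     integrable (joint_lborel m) (\<lambda>p. (u p)\<^sup>2) \<and>
     (\<exists>F. is_fourier_transform m u F \<and>
        (\<integral>\<^sup>+ \<xi>. ennreal ((1 + joint_inner m \<xi> \<xi>) powr r * (cmod (F \<xi>))\<^sup>2) \<partial>joint_lborel m) < \<infinity>)}"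

(* Restrictions of H^r functions on the whole space; as usual up to Lebesgue null sets. *)

definition sobolev_on ::
  "nat \<Rightarrow> real \<Rightarrow> ('a::euclidean_space \<times> (nat \<Rightarrow> real)) set \<Rightarrow>
   ('a \<times> (nat \<Rightarrow> real) \<Rightarrow> real) set"
where
  "sobolev_on m r S = {h. \<exists>u\<in>sobolev m r. AE p in joint_lborel m. p \<in> S \<longrightarrow> u p = h p}"

(* Integral representation valid for z > 0. *)

definition bessel_K :: "real \<Rightarrow> real \<Rightarrow> real" where
  "bessel_K \<nu> z = (LINT t:{0..}|lborel. exp (- z * cosh t) * cosh (\<nu> * t))"

(* On the diagonal the formula is 0 times infinity; the value there is its continuous extension 1. *)

definition matern :: "real \<Rightarrow> real \<Rightarrow> 'a::euclidean_space \<Rightarrow> 'a \<Rightarrow> real" where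
  "matern \<nu> l x x' =
     (if x = x' then 1
      else 2 powr (1 - \<nu>) / Gamma \<nu> * (norm (x - x') / l) powr \<nu> * bessel_K \<nu> (norm (x - x') / l))"

(* H with inner product ip (relevant on H only) is the reproducing kernel Hilbert space of k.
   By Moore-Aronszajn it exists and is unique for every positive semidefinite k. *)

definition is_rkhs ::
  "('a \<Rightarrow> 'a \<Rightarrow> real) \<Rightarrow> ('a \<Rightarrow> real) set \<Rightarrow> (('a \<Rightarrow> real) \<Rightarrow> ('a \<Rightarrow> real) \<Rightarrow> real) \<Rightarrow> bool"
where
  "is_rkhs k H ip \<longleftrightarrow>
     (\<lambda>x. 0) \<in> H \<and>
     (\<forall>u\<in>H. \<forall>v\<in>H. (\<lambda>x. u x + v x) \<in> H) \<and>
     (\<forall>u\<in>H. \<forall>c. (\<lambda>x. c * u x) \<in> H) \<and>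
     (\<forall>u\<in>H. \<forall>v\<in>H. ip u v = ip v u) \<and>
     (\<forall>u\<in>H. \<forall>v\<in>H. \<forall>w\<in>H. ip (\<lambda>x. u x + v x) w = ip u w + ip v w) \<and>
     (\<forall>u\<in>H. \<forall>v\<in>H. \<forall>c. ip (\<lambda>x. c * u x) v = c * ip u v) \<and>
     (\<forall>u\<in>H. 0 \<le> ip u u \<and> (ip u u = 0 \<longrightarrow> u = (\<lambda>x. 0))) \<and>
     (\<forall>U::nat \<Rightarrow> 'a \<Rightarrow> real.
        (\<forall>n. U n \<in> H) \<and>
        (\<forall>e>0. \<exists>N. \<forall>p\<ge>N. \<forall>q\<ge>N. ip (\<lambda>x. U p x - U q x) (\<lambda>x. U p x - U q x) < e) \<longrightarrow>
        (\<exists>u\<in>H. (\<lambda>n. ip (\<lambda>x. U n x - u x) (\<lambda>x. U n x - u x)) \<longlonglongrightarrow> 0)) \<and>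
     (\<forall>x. k x \<in> H \<and> (\<forall>u\<in>H. ip u (k x) = u x))"

(* Restriction of the RKHS (H, ip) to X, with the quotient norm. *)

definition rkhs_restr :: "('a \<Rightarrow> real) set \<Rightarrow> 'a set \<Rightarrow> ('a \<Rightarrow> real) set" where
  "rkhs_restr H X = {h. \<exists>u\<in>H. \<forall>x\<in>X. u x = h x}"

definition rkhs_restr_norm ::
  "('a \<Rightarrow> real) set \<Rightarrow> (('a \<Rightarrow> real) \<Rightarrow> ('a \<Rightarrow> real) \<Rightarrow> real) \<Rightarrow> 'a set \<Rightarrow> ('a \<Rightarrow> real) \<Rightarrow> real"
where
  "rkhs_restr_norm H ip X h = (INF u\<in>{u\<in>H. \<forall>x\<in>X. u x = h x}. sqrt (ip u u))"

definition rkhs_restr_norm_le ::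
  "('a \<Rightarrow> real) set \<Rightarrow> (('a \<Rightarrow> real) \<Rightarrow> ('a \<Rightarrow> real) \<Rightarrow> real) \<Rightarrow> 'a set \<Rightarrow> nat \<Rightarrow>
   ('a \<Rightarrow> nat \<Rightarrow> real) \<Rightarrow> real \<Rightarrow> bool"
where
  "rkhs_restr_norm_le H ip X m h B \<longleftrightarrow>
     (\<forall>i<m. (\<lambda>x. h x i) \<in> rkhs_restr H X) \<and>
     sqrt (\<Sum>i<m. (rkhs_restr_norm H ip X (\<lambda>x. h x i))\<^sup>2) \<le> B"

definition gram :: "('a \<Rightarrow> 'a \<Rightarrow> real) \<Rightarrow> 'a list \<Rightarrow> real mat" where
  "gram k xs = Matrix.mat (length xs) (length xs) (\<lambda>(i, j). k (xs ! i) (xs ! j))"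

(* A runs over the T-element subsets of X, each enumerated by a distinct list.  All values are
   nonnegative, so inserting 0 matters only when X has no T-element subset. *)

definition info_gain :: "('a \<Rightarrow> 'a \<Rightarrow> real) \<Rightarrow> 'a set \<Rightarrow> real \<Rightarrow> nat \<Rightarrow> real" where
  "info_gain k X \<sigma> T = Sup (insert 0
     {1 / 2 * ln (Determinant.det (1\<^sub>m T + (1 / \<sigma>\<^sup>2) \<cdot>\<^sub>m gram k xs)) | xs.
        distinct xs \<and> length xs = T \<and> set xs \<subseteq> X})"

definition noise_cov :: "real \<Rightarrow> nat \<Rightarrow> real mat" where
  "noise_cov \<sigma> t = \<sigma>\<^sup>2 \<cdot>\<^sub>m 1\<^sub>m t"

definition kernel_vec :: "('a \<Rightarrow> 'a \<Rightarrow> real) \<Rightarrow> 'a list \<Rightarrow> 'a \<Rightarrow> real Matrix.vec" where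
  "kernel_vec k xs x = Matrix.vec (length xs) (\<lambda>i. k (xs ! i) x)"

definition reg_gram_inv :: "('a \<Rightarrow> 'a \<Rightarrow> real) \<Rightarrow> real \<Rightarrow> 'a list \<Rightarrow> real mat" where
  "reg_gram_inv k \<sigma> xs = the (mat_inverse (gram k xs + noise_cov \<sigma> (length xs)))"

definition post_mean :: "('a \<Rightarrow> 'a \<Rightarrow> real) \<Rightarrow> real \<Rightarrow> 'a list \<Rightarrow> real list \<Rightarrow> 'a \<Rightarrow> real" where
  "post_mean k \<sigma> xs ys x =
     scalar_prod (kernel_vec k xs x) (reg_gram_inv k \<sigma> xs *\<^sub>v vec_of_list ys)"

definition post_sd :: "('a \<Rightarrow> 'a \<Rightarrow> real) \<Rightarrow> real \<Rightarrow> 'a list \<Rightarrow> 'a \<Rightarrow> real" where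
  "post_sd k \<sigma> xs x =
     sqrt (k x x - scalar_prod (kernel_vec k xs x) (reg_gram_inv k \<sigma> xs *\<^sub>v kernel_vec k xs x))"

definition ucb_beta ::
  "('a \<Rightarrow> 'a \<Rightarrow> real) \<Rightarrow> real \<Rightarrow> nat \<Rightarrow> real \<Rightarrow> real \<Rightarrow> 'a list \<Rightarrow> real"
where
  "ucb_beta k \<sigma> m \<delta> B xs =
     sqrt (2 * ln (real m / \<delta> *
       (sqrt (Determinant.det (noise_cov \<sigma> (length xs) + gram k xs)) /
        sqrt (Determinant.det (noise_cov \<sigma> (length xs)))))) + B"

(* In the next two definitions the lists hold the past rounds 1, ..., t - 1, and ys i is the list
   of past observations of coordinate i. *)

definition conf_box ::
  "('a \<Rightarrow> 'a \<Rightarrow> real) \<Rightarrow> real \<Rightarrow> nat \<Rightarrow> real \<Rightarrow> real \<Rightarrow> 'a list \<Rightarrow> (nat \<Rightarrow> real list) \<Rightarrow> 'a \<Rightarrow>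
   (nat \<Rightarrow> real) set"
where
  "conf_box k \<sigma> m \<delta> B xs ys x =
     (\<Pi>\<^sub>E i\<in>{..<m}.
        {post_mean k \<sigma> xs (ys i) x - ucb_beta k \<sigma> m \<delta> B xs * post_sd k \<sigma> xs x ..
         post_mean k \<sigma> xs (ys i) x + ucb_beta k \<sigma> m \<delta> B xs * post_sd k \<sigma> xs x})"

(* f x is only meaningful on the set Z, so the inner maximum is over the points of the box in Z
   (minus infinity if there are none).  Z = Y is an f given on X \<times> Y only; Z = coord_space m is an f
   extended to all of R^m, for which the intersection has no effect. *)

definition acquisition ::
  "('a \<Rightarrow> 'a \<Rightarrow> real) \<Rightarrow> real \<Rightarrow> nat \<Rightarrow> real \<Rightarrow> real \<Rightarrow> (nat \<Rightarrow> real) set \<Rightarrow>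
   ('a \<Rightarrow> (nat \<Rightarrow> real) \<Rightarrow> real) \<Rightarrow> 'a list \<Rightarrow> (nat \<Rightarrow> real list) \<Rightarrow> 'a \<Rightarrow> ereal"
where
  "acquisition k \<sigma> m \<delta> B Z f xs ys x = (SUP y\<in>conf_box k \<sigma> m \<delta> B xs ys x \<inter> Z. ereal (f x y))"

definition observation ::
  "('a \<Rightarrow> nat \<Rightarrow> real) \<Rightarrow> (nat \<Rightarrow> nat \<Rightarrow> 'w \<Rightarrow> real) \<Rightarrow> (nat \<Rightarrow> 'w \<Rightarrow> 'a) \<Rightarrow> nat \<Rightarrow> nat \<Rightarrow> 'w \<Rightarrow> real"
where
  "observation h \<epsilon> x t i \<omega> = h (x t \<omega>) i + \<epsilon> t i \<omega>"

definition subgaussian_noise ::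
  "'w measure \<Rightarrow> real \<Rightarrow> nat \<Rightarrow> nat \<Rightarrow> (nat \<Rightarrow> nat \<Rightarrow> 'w \<Rightarrow> real) \<Rightarrow> bool"
where
  "subgaussian_noise M \<sigma> m T \<epsilon> \<longleftrightarrow>
     prob_space.indep_vars M (\<lambda>_. borel) (\<lambda>(t, i). \<epsilon> t i) ({1..T} \<times> {..<m}) \<and>
     (\<forall>t\<in>{1..T}. \<forall>i<m.
        integrable M (\<epsilon> t i) \<and> integral\<^sup>L M (\<epsilon> t i) = 0 \<and>
        (\<forall>c. integrable M (\<lambda>\<omega>. exp (c * \<epsilon> t i \<omega>)) \<and>
             integral\<^sup>L M (\<lambda>\<omega>. exp (c * \<epsilon> t i \<omega>)) \<le> exp (c\<^sup>2 * \<sigma>\<^sup>2 / 2)))"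

(* A run of GP-UCBL on rounds 1, ..., T with queries x and observations y.  The first conjunct says
   that the choice in round t, ties included, is a measurable function of earlier observations. *)

definition gp_ucbl_run ::
  "'w measure \<Rightarrow> ('a::euclidean_space \<Rightarrow> 'a \<Rightarrow> real) \<Rightarrow> real \<Rightarrow> nat \<Rightarrow> real \<Rightarrow> real \<Rightarrow> 'a set \<Rightarrow>
   (nat \<Rightarrow> real) set \<Rightarrow> ('a \<Rightarrow> (nat \<Rightarrow> real) \<Rightarrow> real) \<Rightarrow> nat \<Rightarrow>
   (nat \<Rightarrow> 'w \<Rightarrow> 'a) \<Rightarrow> (nat \<Rightarrow> nat \<Rightarrow> 'w \<Rightarrow> real) \<Rightarrow> bool"
where
  "gp_ucbl_run M k \<sigma> m \<delta> B X Z f T x y \<longleftrightarrow>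
     (\<forall>t\<in>{1..T}.
        (\<exists>\<phi>\<in>borel_measurable (\<Pi>\<^sub>M p\<in>{1..<t} \<times> {..<m}. (borel :: real measure)).
           \<forall>\<omega>\<in>space M. x t \<omega> = \<phi> (\<lambda>(s, i)\<in>{1..<t} \<times> {..<m}. y s i \<omega>)) \<and>
        (\<forall>\<omega>\<in>space M.
           is_arg_max
             (acquisition k \<sigma> m \<delta> B Z f
                (map (\<lambda>s. x s \<omega>) [1..<t]) (\<lambda>i. map (\<lambda>s. y s i \<omega>) [1..<t]))
             (\<lambda>z. z \<in> X) (x t \<omega>)))"

definition regret ::
  "'a set \<Rightarrow> ('a \<Rightarrow> (nat \<Rightarrow> real) \<Rightarrow> real) \<Rightarrow> ('a \<Rightarrow> nat \<Rightarrow> real) \<Rightarrow> nat \<Rightarrow> (nat \<Rightarrow> 'a) \<Rightarrow> real"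
where
  "regret X f h T x = (\<Sum>t=1..T. (SUP z\<in>X. f z (h z)) - f (x t) (h (x t)))"

end

theory Submission
  imports Defs
begin

text \<open>
  The proof is the analysis of optimism in the face of uncertainty. Suppose that in every round \<open>t\<close>
  all posterior intervals cover the lower-level solution \<open>h\<close> on \<open>X\<close>. Then the acquisition function
  dominates \<open>f z (h z)\<close>, and because \<open>x t\<close> maximises it and \<open>f\<close> is Lipschitz in the \<open>l\<^sub>1\<close> norm, the regret
  of the round is at most \<open>2 L m\<close> times \<open>\<beta>\<^sub>t\<close> times the posterior standard deviation at \<open>x t\<close>
  (\<open>ucb_round_regret\<close>). By the Cauchy--Schwarz inequality and the chain rule
  \<open>det (I + K / \<sigma>\<^sup>2) = \<Prod> (1 + v\<^sub>j / \<sigma>\<^sup>2)\<close>, where \<open>v\<^sub>j\<close> is the posterior variance at the \<open>j\<close>-th query before it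
  is made, the widths sum to order \<open>sqrt (T \<gamma>\<^sub>T)\<close> times the largest \<open>\<beta>\<^sub>t\<close> (\<open>sum_ucb_widths_le\<close>).

  Coverage is a self-normalised tail bound. The ratio between the marginal likelihood of the noise
  under \<open>N(0, K + \<sigma>\<^sup>2 I)\<close> and its likelihood under \<open>N(0, \<sigma>\<^sup>2 I)\<close> is a nonnegative supermartingale for every
  sub-Gaussian noise, as it averages the exponential supermartingales
  \<open>exp (\<Sum> \<epsilon>\<^sub>s h(x\<^sub>s) / \<sigma>\<^sup>2 - h(x\<^sub>s)\<^sup>2 / (2 \<sigma>\<^sup>2))\<close> over a Gaussian process \<open>h\<close>. A maximal inequality of Ville's type
  keeps it below \<open>m / \<delta>\<close> in all rounds with probability at least \<open>1 - \<delta> / m\<close> (\<open>likelihood_ratio_ville\<close>), and a union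
  bound over the coordinates costs the factor \<open>m\<close>. Deterministically, the logarithm of this ratio controls the
  error that the noise causes in the posterior mean, and the RKHS norm controls the rest
  (\<open>gp_confidence\<close>).

  Posterior means and variances are handled through the one-point update formulas instead of matrix
  inverses: every claim about the posterior becomes an induction over the observations whose step
  conditions on a single point, and measurability in the past is immediate. The formulas are
  identified with the Gram matrix expressions once and for all by exhibiting the solution of the linear system
  (\<open>gp_weight_solves\<close>).

  Two further points need an argument. The information gain is a supremum over sets of
  \<open>T\<close> distinct points, whereas the algorithm may query a point repeatedly. In a convex set with two
  points every query sequence is a limit of sequences of distinct points, and the kernel is continuous,
  so the gain along every sequence is still at most \<open>\<gamma>\<^sub>T\<close> (\<open>gain_le_info_gain\<close>); continuity on the diagonal
  comes from writing the Matern kernel as a mixture of Gaussian kernels. Secondly, \<open>\<beta>\<^sub>t\<close> contains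
  \<open>ln m\<close>, but the constant must not depend on \<open>m\<close>. If \<open>ln m \<le> 2 \<gamma>\<^sub>T\<close>, the term is absorbed. Otherwise,
  querying one point \<open>T\<close> times shows \<open>\<gamma>\<^sub>T \<ge> ln (1 + T / \<sigma>\<^sup>2) / 2\<close>, hence \<open>T \<le> \<sigma>\<^sup>2 m\<close>; and since the
  norm bound \<open>B\<close> is shared by all coordinates, the objective varies by at most
  order \<open>sqrt m\<close> on \<open>X\<close>, so that the trivial bound of order \<open>T sqrt m \<le> \<sigma> m sqrt T\<close> suffices.
\<close>

section \<open>The Matern kernel as a Gaussian scale mixture\<close>

text \<open>
  The density, up to the factor \<open>1 / Gamma \<nu>\<close>, of a Gamma distribution of
  scales times a Gaussian kernel of that scale.
\<close>

definition matern_mix :: "real \<Rightarrow> real \<Rightarrow> real \<Rightarrow> real" where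
  "matern_mix \<nu> z s = indicator {0<..} s * (s powr (\<nu> - 1) * exp (- s - z\<^sup>2 / (4 * s)))"

definition matern_profile :: "real \<Rightarrow> real \<Rightarrow> real" where
  "matern_profile \<nu> z = (LINT s|lborel. matern_mix \<nu> z s) / Gamma \<nu>"

lemma matern_mix_measurable [measurable]: "matern_mix \<nu> z \<in> borel_measurable lborel"
  unfolding matern_mix_def by measurable

lemma has_bochner_integral_matern_mix_0:
  assumes "\<nu> > 0"
  shows "has_bochner_integral lborel (matern_mix \<nu> 0) (Gamma \<nu>)"
proof (rule has_bochner_integral_nn_integral)
  show "(\<integral>\<^sup>+ s. ennreal (matern_mix \<nu> 0 s) \<partial>lborel) = ennreal (Gamma \<nu>)"
    unfolding Gamma_conv_nn_integral_real[OF assms]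
    by (intro nn_integral_cong arg_cong[where f = ennreal])
      (auto simp: matern_mix_def indicator_def exp_minus field_simps)
  show "matern_mix \<nu> 0 \<in> borel_measurable lborel" by (rule matern_mix_measurable)
qed (use assms in \<open>auto simp: matern_mix_def\<close>)

lemma norm_matern_mix_le: "norm (matern_mix \<nu> z s) \<le> matern_mix \<nu> 0 s"
  by (auto simp: matern_mix_def indicator_def)

lemma integrable_matern_mix:
  assumes "\<nu> > 0"
  shows "integrable lborel (matern_mix \<nu> z)"
proof (rule Bochner_Integration.integrable_bound)
  show "integrable lborel (matern_mix \<nu> 0)"
    using has_bochner_integral_matern_mix_0[OF assms] by (simp add: has_bochner_integral_iff)
qed (use norm_matern_mix_le[of \<nu> z] in \<open>auto intro: order_trans[OF _ abs_ge_self]\<close>)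

lemma matern_profile_0: "\<nu> > 0 \<Longrightarrow> matern_profile \<nu> 0 = 1"
  using has_bochner_integral_matern_mix_0[of \<nu>] Gamma_real_pos[of \<nu>]
  by (simp add: matern_profile_def has_bochner_integral_iff less_imp_neq[symmetric])

lemma isCont_matern_profile:
  assumes "\<nu> > 0"
  shows "isCont (matern_profile \<nu>) z"
  unfolding continuous_at_sequentially
proof safe
  fix w :: "nat \<Rightarrow> real" assume w: "w \<longlonglongrightarrow> z"
  have "(\<lambda>n. LINT s|lborel. matern_mix \<nu> (w n) s) \<longlonglongrightarrow> (LINT s|lborel. matern_mix \<nu> z s)"
  proof (rule integral_dominated_convergence)
    show "integrable lborel (matern_mix \<nu> 0)" using assms by (rule integrable_matern_mix)
    show "AE s in lborel. (\<lambda>n. matern_mix \<nu> (w n) s) \<longlonglongrightarrow> matern_mix \<nu> z s"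
    proof (rule AE_I2)
      fix s :: real
      show "(\<lambda>n. matern_mix \<nu> (w n) s) \<longlonglongrightarrow> matern_mix \<nu> z s"
        by (cases "s > 0") (auto simp: matern_mix_def intro!: tendsto_intros w)
    qed
  qed (auto simp: norm_matern_mix_le[unfolded real_norm_def])
  then show "(matern_profile \<nu> \<circ> w) \<longlonglongrightarrow> matern_profile \<nu> z"
    unfolding matern_profile_def o_def using Gamma_real_pos[OF assms] by (intro tendsto_intros) auto
qed

text \<open>
  The substitution \<open>s = (z / 2) e\<^sup>t\<close> turns \<open>z cosh t\<close> into
  \<open>s + z\<^sup>2 / (4 s)\<close>.
\<close>

lemma exp_cosh_substitution:
  assumes "\<nu> > 0" "z > 0"
  defines "f \<equiv> \<lambda>t. exp (- z * cosh t) * exp (\<nu> * t)"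
  shows "integrable lborel f"
    and "(LINT t|lborel. f t) = (2 / z) powr \<nu> * (LINT s|lborel. matern_mix \<nu> z s)"
proof -
  define g where "g = (\<lambda>s. ln (2 * s / z))"
  have eq: "f (g s) * (1 / s) = (2 / z) powr \<nu> * matern_mix \<nu> z s" if "s > 0" for s
  proof -
    have "z * cosh (g s) = s + z\<^sup>2 / (4 * s)"
      using that assms(2) unfolding g_def by (subst cosh_ln_real) (auto simp: field_simps power2_eq_square)
    moreover have "exp (\<nu> * g s) = (2 / z) powr \<nu> * s powr \<nu>"
      using that assms(2) unfolding g_def
      by (simp add: powr_def ln_mult ln_div exp_add[symmetric] algebra_simps)
    moreover have "s powr (\<nu> - 1) = s powr \<nu> / s" using that by (simp add: powr_diff)
    ultimately show ?thesis using that by (simp add: f_def matern_mix_def)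
  qed
  have pointwise: "indicator (einterval 0 \<infinity>) s *\<^sub>R (f (g s) * (1 / s)) = (2 / z) powr \<nu> * matern_mix \<nu> z s" for s
    using eq[of s] by (cases "s > 0") (auto simp: einterval_def matern_mix_def zero_ereal_def)
  have int: "set_integrable lborel (einterval 0 \<infinity>) (\<lambda>s. f (g s) * (1 / s))"
    unfolding set_integrable_def pointwise using integrable_matern_mix[OF assms(1)] by simp
  have lim0: "((ereal \<circ> g \<circ> real_of_ereal) \<longlongrightarrow> - \<infinity>) (at_right 0)"
    unfolding zero_ereal_def ereal_tendsto_simps
  proof -
    have "filterlim (\<lambda>s. 2 * s / z) (at_right 0) (at_right 0)"
      unfolding filterlim_at
      using assms(2) by (auto intro!: tendsto_eq_intros eventually_at_rightI[of 0 1])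
    then show "LIM x at_right 0. g x :> at_bot"
      unfolding g_def by (rule filterlim_compose[OF ln_at_0])
  qed
  have limI: "((ereal \<circ> g \<circ> real_of_ereal) \<longlongrightarrow> \<infinity>) (at_left \<infinity>)"
    unfolding ereal_tendsto_simps g_def
  proof (rule filterlim_compose[OF ln_at_top])
    show "LIM x at_top. 2 * x / z :> at_top"
      using filterlim_tendsto_pos_mult_at_top[OF tendsto_const[of "2 / z"] _ filterlim_ident] assms(2)
      by (simp add: field_simps)
  qed
  note subst = interval_integral_substitution_nonneg[of 0 \<infinity> g "\<lambda>s. 1 / s" f "-\<infinity>" \<infinity>, OF _ _ _ _ _ _ lim0 limI int]
  have pre: "0 < (\<infinity>::ereal)"
    "\<And>s. 0 < ereal s \<Longrightarrow> ereal s < \<infinity> \<Longrightarrow> DERIV g s :> 1 / s"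
    "\<And>s. 0 < ereal s \<Longrightarrow> ereal s < \<infinity> \<Longrightarrow> isCont f (g s)"
    "\<And>s. 0 < ereal s \<Longrightarrow> ereal s < \<infinity> \<Longrightarrow> isCont (\<lambda>s. 1 / s) s"
    "\<And>s. 0 < ereal s \<Longrightarrow> ereal s < \<infinity> \<Longrightarrow> 0 \<le> f (g s)"
    "\<And>s. 0 \<le> ereal s \<Longrightarrow> ereal s \<le> \<infinity> \<Longrightarrow> 0 \<le> 1 / s"
    using assms(2) by (auto simp: f_def g_def intro!: derivative_eq_intros continuous_intros)
  have "set_integrable lborel (einterval (-\<infinity>) \<infinity>) f"
    by (rule subst(1)) (use pre in auto)
  then show "integrable lborel f" by (simp add: set_integrable_def einterval_def)
  have "(LBINT t=-\<infinity>..\<infinity>. f t) = (LBINT s=0..\<infinity>. f (g s) * (1 / s))"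
    by (rule subst(2)) (use pre in auto)
  also have "\<dots> = (LINT s|lborel. (2 / z) powr \<nu> * matern_mix \<nu> z s)"
    by (simp only: interval_lebesgue_integral_def set_lebesgue_integral_def pointwise) simp
  finally show "(LINT t|lborel. f t) = (2 / z) powr \<nu> * (LINT s|lborel. matern_mix \<nu> z s)"
    by (simp add: interval_lebesgue_integral_def set_lebesgue_integral_def einterval_def)
qed

text \<open>
  Splitting \<open>cosh (\<nu> t)\<close> into exponentials and reflecting one half extends the
  integral to the whole line.
\<close>

lemma bessel_K_eq_mix:
  assumes "\<nu> > 0" "z > 0"
  shows "bessel_K \<nu> z = (2 / z) powr \<nu> * (LINT s|lborel. matern_mix \<nu> z s) / 2"
proof -
  define f where "f = (\<lambda>t. exp (- z * cosh t) * exp (\<nu> * t))"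
  note f = exp_cosh_substitution[OF assms, folded f_def]
  have f': "integrable lborel (\<lambda>t. f (- t))"
    using lborel_integrable_real_affine[OF f(1), of "-1" 0] by simp
  have ind: "integrable lborel (\<lambda>t. indicator S t * h t)" if "integrable lborel h" "S \<in> sets borel" for S and h :: "real \<Rightarrow> real"
    using integrable_mult_indicator[of S lborel h] that by simp
  have "bessel_K \<nu> z = (LINT t|lborel. (indicator {0..} t * f t + indicator {0..} t * f (- t)) / 2)"
    unfolding bessel_K_def set_lebesgue_integral_def f_def
    by (rule Bochner_Integration.integral_cong) (auto simp: cosh_def field_simps indicator_def)
  also have "\<dots> = ((LINT t|lborel. indicator {0..} t * f t) + (LINT t|lborel. indicator {0..} t * f (- t))) / 2"
    using ind[OF f(1)] ind[OF f'] by simp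
  also have "(LINT t|lborel. indicator {0..} t * f (- t)) = (LINT t|lborel. indicator {0..} (- t) * f t)"
    using lborel_integral_real_affine[of "-1" "\<lambda>t. indicator {0..} t * f (- t)" 0] by simp
  also have "\<dots> = (LINT t|lborel. indicator {..<0} t * f t)"
    by (rule integral_cong_AE) (use f AE_lborel_singleton[of 0] in \<open>auto elim!: eventually_mono simp: f_def indicator_def\<close>)
  also have "(LINT t|lborel. indicator {0..} t * f t) + (LINT t|lborel. indicator {..<0} t * f t)
     = (LINT t|lborel. indicator {0..} t * f t + indicator {..<0} t * f t)"
    using ind[OF f(1)] by (intro Bochner_Integration.integral_add[symmetric]) auto
  also have "\<dots> = (LINT t|lborel. f t)"
    by (rule Bochner_Integration.integral_cong) (auto simp: indicator_def)
  finally show ?thesis using f(2) by simp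
qed

text \<open>
  In this form there is no singularity on the diagonal, and continuity is dominated convergence.
\<close>

lemma matern_eq_profile:
  assumes "\<nu> > 0" "l > 0"
  shows "matern \<nu> l x x' = matern_profile \<nu> (norm (x - x') / l)"
proof (cases "x = x'")
  case True
  then show ?thesis using assms by (simp add: matern_def matern_profile_0)
next
  case False
  define z where "z = norm (x - x') / l"
  have z: "z > 0" using False assms by (simp add: z_def)
  have "2 powr (1 - \<nu>) / Gamma \<nu> * z powr \<nu> * ((2 / z) powr \<nu> * I / 2) = I / Gamma \<nu>" for I
    using z by (simp add: powr_divide powr_diff)
  then have "2 powr (1 - \<nu>) / Gamma \<nu> * z powr \<nu> * bessel_K \<nu> z = matern_profile \<nu> z"
    unfolding matern_profile_def bessel_K_eq_mix[OF assms(1) z] by blast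
  then show ?thesis
    using False unfolding matern_def z_def by simp
qed

lemma continuous_on_matern:
  assumes "\<nu> > 0" "l > 0" "continuous_on S u" "continuous_on S v"
  shows "continuous_on S (\<lambda>p. matern \<nu> l (u p) (v p))"
proof -
  have "continuous_on UNIV (matern_profile \<nu>)"
    using isCont_matern_profile[OF assms(1)] continuous_at_imp_continuous_on by blast
  then show ?thesis
    unfolding matern_eq_profile[OF assms(1,2)]
    by (rule continuous_on_compose2) (use assms in \<open>auto intro!: continuous_intros\<close>)
qed

section \<open>Sequential Gaussian process regression\<close>

text \<open>
  Posterior covariance and mean after \<open>n\<close> observations, by the rank-one update for
  the observation at \<open>x n\<close> with noise variance \<open>s2\<close>.
\<close>

primrec gp_cov :: "('a \<Rightarrow> 'a \<Rightarrow> real) \<Rightarrow> real \<Rightarrow> (nat \<Rightarrow> 'a) \<Rightarrow> nat \<Rightarrow> 'a \<Rightarrow> 'a \<Rightarrow> real" where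
  "gp_cov k s2 x 0 u v = k u v"
| "gp_cov k s2 x (Suc n) u v = gp_cov k s2 x n u v -
     gp_cov k s2 x n u (x n) * gp_cov k s2 x n (x n) v / (gp_cov k s2 x n (x n) (x n) + s2)"

primrec gp_mean :: "('a \<Rightarrow> 'a \<Rightarrow> real) \<Rightarrow> real \<Rightarrow> (nat \<Rightarrow> 'a) \<Rightarrow> (nat \<Rightarrow> real) \<Rightarrow> nat \<Rightarrow> 'a \<Rightarrow> real" where
  "gp_mean k s2 x e 0 u = 0"
| "gp_mean k s2 x e (Suc n) u = gp_mean k s2 x e n u +
     gp_cov k s2 x n u (x n) / (gp_cov k s2 x n (x n) (x n) + s2) * (e n - gp_mean k s2 x e n (x n))"

abbreviation gp_var :: "('a \<Rightarrow> 'a \<Rightarrow> real) \<Rightarrow> real \<Rightarrow> (nat \<Rightarrow> 'a) \<Rightarrow> nat \<Rightarrow> real" where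
  "gp_var k s2 x n \<equiv> gp_cov k s2 x n (x n) (x n)"

text \<open>
  Finite signed combinations of point evaluations; adding a point is a list constructor, which
  is the only operation that the update formulas need.
\<close>

definition lin :: "('a \<Rightarrow> real) \<Rightarrow> (real \<times> 'a) list \<Rightarrow> real" where
  "lin g ws = (\<Sum>(w, z)\<leftarrow>ws. w * g z)"

lemma lin_simps [simp]:
  "lin g [] = 0" "lin g ((w, z) # ws) = w * g z + lin g ws"
  by (simp_all add: lin_def)

lemma lin_linear:
  "lin (\<lambda>z. g z + h z) ws = lin g ws + lin h ws"
  "lin (\<lambda>z. g z - h z) ws = lin g ws - lin h ws"
  "lin (\<lambda>z. c * g z) ws = c * lin g ws"
  "lin (\<lambda>z. g z * c) ws = lin g ws * c"
  "lin (\<lambda>z. g z / c) ws = lin g ws / c"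
  by (induction ws) (auto simp: algebra_simps add_divide_distrib)

definition quad :: "('a \<Rightarrow> 'a \<Rightarrow> real) \<Rightarrow> (real \<times> 'a) list \<Rightarrow> real" where
  "quad c ws = lin (\<lambda>u. lin (c u) ws) ws"

definition psd :: "('a \<Rightarrow> 'a \<Rightarrow> real) \<Rightarrow> bool" where
  "psd c \<longleftrightarrow> (\<forall>u v. c u v = c v u) \<and> (\<forall>ws. 0 \<le> quad c ws)"

text \<open>
  Membership of \<open>g\<close> in the RKHS of \<open>c\<close> with squared norm at most
  \<open>N\<close>, expressed without constructing that space.
\<close>

definition dominated :: "('a \<Rightarrow> real) \<Rightarrow> ('a \<Rightarrow> 'a \<Rightarrow> real) \<Rightarrow> real \<Rightarrow> bool" where
  "dominated g c N \<longleftrightarrow> 0 \<le> N \<and> (\<forall>ws. (lin g ws)\<^sup>2 \<le> N * quad c ws)"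

lemma psd_sym: "psd c \<Longrightarrow> c u v = c v u"
  unfolding psd_def by blast

lemma psd_diag_nonneg: "psd c \<Longrightarrow> 0 \<le> c u u"
  unfolding psd_def quad_def by (auto dest: spec[of _ "[(1, u)]"])

lemma quad_Cons:
  assumes "psd c"
  shows "quad c ((w, z) # ws) = w\<^sup>2 * c z z + 2 * w * lin (c z) ws + quad c ws"
proof -
  have "lin (\<lambda>u. c u z) ws = lin (c z) ws" using psd_sym[OF assms] by metis
  then show ?thesis
    by (simp add: quad_def lin_linear algebra_simps power2_eq_square)
qed

lemma quad_update:
  assumes "psd c"
  shows "quad (\<lambda>u v. c u v - c u z * c z v / s) ws = quad c ws - (lin (c z) ws)\<^sup>2 / s"
proof -
  have "lin (\<lambda>u. c u z) ws = lin (c z) ws" using psd_sym[OF assms] by metis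
  moreover have "lin (\<lambda>v. c u z * c z v / s) ws = c u z * (lin (c z) ws / s)" for u
    by (simp only: times_divide_eq_right[symmetric] lin_linear)
  ultimately show ?thesis
    by (simp add: quad_def lin_linear power2_eq_square)
qed

text \<open>
  Here \<open>r\<close> is the regression coefficient of \<open>ws\<close> on the new point
  under noise variance \<open>s2\<close>.
\<close>

lemma quad_Cons_schur:
  fixes z :: 'a and ws :: "(real \<times> 'a) list"
  assumes c: "psd c" and s: "c z z + s2 \<noteq> 0"
  defines "r \<equiv> lin (c z) ws / (c z z + s2)"
  shows "quad c ((- r, z) # ws) = quad c ws - (lin (c z) ws)\<^sup>2 / (c z z + s2) - s2 * r\<^sup>2"
proof -
  define s where "s = c z z + s2"
  have S: "lin (c z) ws = r * s" using s by (simp add: r_def s_def)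
  have "(lin (c z) ws)\<^sup>2 / s = r\<^sup>2 * s" using s unfolding S s_def by (simp add: power2_eq_square)
  then show ?thesis
    unfolding s_def[symmetric] quad_Cons[OF c] S
    by (simp add: s_def power2_eq_square algebra_simps)
qed

lemma psd_update:
  assumes c: "psd c" and "s2 > 0"
  shows "psd (\<lambda>u v. c u v - c u z * c z v / (c z z + s2))"
  unfolding psd_def
proof safe
  fix u v show "c u v - c u z * c z v / (c z z + s2) = c v u - c v z * c z u / (c z z + s2)"
    using psd_sym[OF c] by (metis mult.commute)
next
  fix ws
  define s where "s = c z z + s2"
  have s: "s > 0" using psd_diag_nonneg[OF c, of z] assms(2) by (simp add: s_def)
  define S where "S = lin (c z) ws"
  have "0 \<le> quad c ((- (S / s), z) # ws)" using c unfolding psd_def by blast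
  also have "\<dots> = quad c ws - S\<^sup>2 / s - s2 * (S / s)\<^sup>2"
    using quad_Cons_schur[OF c, of z s2 ws] s by (simp add: s_def S_def)
  finally show "0 \<le> quad (\<lambda>u v. c u v - c u z * c z v / (c z z + s2)) ws"
    unfolding quad_update[OF c] S_def[symmetric] s_def[symmetric]
    using assms(2) zero_le_power2[of "S / s"] by (smt (verit) mult_nonneg_nonneg)
qed

lemma gp_cov_Suc_eq:
  "gp_cov k s2 x (Suc n) = (\<lambda>u v. gp_cov k s2 x n u v -
     gp_cov k s2 x n u (x n) * gp_cov k s2 x n (x n) v / (gp_var k s2 x n + s2))"
  by (intro ext) simp

lemma psd_gp_cov:
  assumes "psd k" "s2 > 0"
  shows "psd (gp_cov k s2 x n)"
proof (induction n)
  case 0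
  then show ?case using assms(1) by (simp add: psd_def quad_def)
next
  case (Suc n)
  show ?case unfolding gp_cov_Suc_eq by (rule psd_update[OF Suc assms(2)])
qed

text \<open>
  Testing the domination of \<open>g\<close> on \<open>ws\<close> extended by \<open>z\<close>
  with the regression weight gives the updated quadratic form up to a term of favourable sign.
\<close>

lemma dominated_residual_update:
  assumes c: "psd c" and "s2 > 0" and g: "dominated g c N"
  shows "dominated (\<lambda>u. g u - c u z / (c z z + s2) * g z) (\<lambda>u v. c u v - c u z * c z v / (c z z + s2)) N"
  unfolding dominated_def
proof safe
  show N: "0 \<le> N" using g by (simp add: dominated_def)
  fix ws
  define s where "s = c z z + s2"
  have s: "s > 0" using psd_diag_nonneg[OF c, of z] assms(2) by (simp add: s_def)
  define S where "S = lin (c z) ws"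
  have S: "lin (\<lambda>u. c u z) ws = S" using psd_sym[OF c] unfolding S_def by metis
  have "lin (\<lambda>u. g u - c u z / s * g z) ws = lin g ((- (S / s), z) # ws)"
    by (simp add: lin_linear S)
  moreover have "(lin g ((- (S / s), z) # ws))\<^sup>2 \<le> N * quad c ((- (S / s), z) # ws)"
    using g unfolding dominated_def by blast
  moreover have "quad c ((- (S / s), z) # ws) = quad c ws - S\<^sup>2 / s - s2 * (S / s)\<^sup>2"
    using quad_Cons_schur[OF c, of z s2 ws] s by (simp add: s_def S_def)
  moreover have "quad c ws - S\<^sup>2 / s - s2 * (S / s)\<^sup>2 \<le> quad c ws - S\<^sup>2 / s"
    using assms(2) by simp
  ultimately show "(lin (\<lambda>u. g u - c u z / (c z z + s2) * g z) ws)\<^sup>2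
      \<le> N * quad (\<lambda>u v. c u v - c u z * c z v / (c z z + s2)) ws"
    unfolding quad_update[OF c] S_def[symmetric] s_def[symmetric]
    using N by (smt (verit) mult_left_mono)
qed

lemma dominated_diag: "dominated g c N \<Longrightarrow> (g u)\<^sup>2 \<le> N * c u u"
  unfolding dominated_def quad_def by (auto dest: spec[of _ "[(1, u)]"])

text \<open>
  If the form \<open>Q * quad - lin\<^sup>2\<close> is nonnegative on the span of two
  functionals, so is its Schur complement with respect to the second one.
\<close>

lemma schur_complement_le:
  fixes Q W S c A \<mu> :: real
  assumes all: "\<And>\<tau>. (A + \<tau> * \<mu>)\<^sup>2 \<le> Q * (W + 2 * \<tau> * S + \<tau>\<^sup>2 * c)"
    and mu: "\<mu>\<^sup>2 \<le> Q * c" and "c > 0" "Q \<ge> 0" "W - S\<^sup>2 / c \<ge> 0"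
  shows "(A - S * \<mu> / c)\<^sup>2 \<le> (Q - \<mu>\<^sup>2 / c) * (W - S\<^sup>2 / c)"
proof -
  define D where "D = W - S\<^sup>2 / c"
  define E where "E = A - S * \<mu> / c"
  have ineq: "(E + \<tau> * \<mu>)\<^sup>2 \<le> Q * (D + \<tau>\<^sup>2 * c)" for \<tau>
  proof -
    define r where "r = S / c"
    have S: "S = r * c" "S\<^sup>2 / c = r\<^sup>2 * c" "S * \<mu> / c = r * \<mu>"
      using \<open>c > 0\<close> by (simp_all add: r_def power2_eq_square)
    have "A + (\<tau> - r) * \<mu> = E + \<tau> * \<mu>" by (simp add: E_def S(3) algebra_simps)
    moreover have "W + 2 * (\<tau> - r) * S + (\<tau> - r)\<^sup>2 * c = D + \<tau>\<^sup>2 * c"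
      unfolding D_def S(2) unfolding S(1) by (simp add: power2_eq_square algebra_simps)
    ultimately show ?thesis using all[of "\<tau> - r"] by simp
  qed
  have D: "D \<ge> 0" using assms(5) by (simp add: D_def)
  have "E\<^sup>2 \<le> (Q - \<mu>\<^sup>2 / c) * D"
  proof (cases "Q * c - \<mu>\<^sup>2 > 0")
    case True
    define P where "P = Q * c - \<mu>\<^sup>2"
    \<comment> \<open>This \<open>\<tau>\<close> maximises the difference of the two sides.\<close>
    define \<tau> where "\<tau> = E * \<mu> / P"
    have P: "P > 0" using True unfolding P_def .
    have Qc: "Q * c = P + \<mu>\<^sup>2" by (simp add: P_def)
    have \<tau>: "E * \<mu> = \<tau> * P" using P by (simp add: \<tau>_def)
    have "0 \<le> P * (Q * (D + \<tau>\<^sup>2 * c) - (E + \<tau> * \<mu>)\<^sup>2)"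
      by (intro mult_nonneg_nonneg) (use P ineq[of \<tau>] in linarith)+
    also have "\<dots> = P * Q * D + \<tau>\<^sup>2 * P * (Q * c) - P * E\<^sup>2 - 2 * P * \<tau> * (E * \<mu>) - P * \<tau>\<^sup>2 * \<mu>\<^sup>2"
      by (simp add: power2_eq_square algebra_simps)
    also have "\<dots> = P * Q * D - P * E\<^sup>2 - (\<tau> * P)\<^sup>2"
      unfolding \<tau> Qc by (simp add: power2_eq_square algebra_simps)
    also have "\<dots> = P * Q * D - E\<^sup>2 * (Q * c)"
      unfolding \<tau>[symmetric] Qc by (simp add: power2_eq_square algebra_simps)
    also have "\<dots> = Q * (P * D - E\<^sup>2 * c)"
      by (simp add: algebra_simps)
    finally have "0 \<le> Q * (P * D - E\<^sup>2 * c)" .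
    moreover have "Q > 0" using True \<open>c > 0\<close> \<open>Q \<ge> 0\<close> zero_le_power2[of \<mu>] by (cases "Q = 0") auto
    ultimately have "E\<^sup>2 * c \<le> P * D" by (simp add: zero_le_mult_iff)
    then show ?thesis using \<open>c > 0\<close> by (simp add: P_def field_simps)
  next
    case False
    then have eq: "Q * c = \<mu>\<^sup>2" using mu by simp
    have lin: "2 * \<tau> * (E * \<mu>) \<le> Q * D - E\<^sup>2" for \<tau>
    proof -
      have "(E + \<tau> * \<mu>)\<^sup>2 \<le> Q * D + \<tau>\<^sup>2 * (Q * c)" using ineq[of \<tau>] by (simp add: algebra_simps)
      then show ?thesis unfolding eq by (simp add: power2_eq_square algebra_simps)
    qed
    have "E * \<mu> = 0"
    proof (rule ccontr)
      assume "E * \<mu> \<noteq> 0"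
      then have "2 * ((Q * D - E\<^sup>2 + 1) / (2 * (E * \<mu>))) * (E * \<mu>) = Q * D - E\<^sup>2 + 1" by simp
      with lin[of "(Q * D - E\<^sup>2 + 1) / (2 * (E * \<mu>))"] show False by linarith
    qed
    moreover have "E = 0" if "\<mu> = 0"
    proof -
      have "Q = 0" using eq that \<open>c > 0\<close> by simp
      then show ?thesis using ineq[of 0] by simp
    qed
    ultimately have "E = 0" by auto
    then show ?thesis using eq \<open>c > 0\<close> D by (simp add: field_simps)
  qed
  then show ?thesis by (simp add: D_def E_def)
qed

lemma cauchy_schwarz_plane: 
  fixes a b p q r t :: real
  assumes "a\<^sup>2 \<le> p * q" "b\<^sup>2 \<le> r * t" "p \<ge> 0" "q \<ge> 0" "r \<ge> 0" "t \<ge> 0"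
  shows "(a + b)\<^sup>2 \<le> (p + r) * (q + t)"
proof -
  have "2 * a * b \<le> p * t + r * q"
  proof (rule ccontr)
    assume "\<not> ?thesis"
    then have lt: "p * t + r * q < 2 * a * b" by simp
    have "(p * t + r * q)\<^sup>2 < (2 * a * b)\<^sup>2"
      by (rule power_strict_mono[OF lt]) (use assms in auto)
    also have "(2 * a * b)\<^sup>2 = 4 * (a\<^sup>2 * b\<^sup>2)" by (simp add: power_mult_distrib)
    also have "\<dots> \<le> 4 * ((p * q) * (r * t))"
      using assms by (intro mult_left_mono mult_mono) auto
    finally have "(p * t - r * q)\<^sup>2 < 0" by (simp add: power2_eq_square algebra_simps)
    then show False by simp
  qed
  then show ?thesis using assms by (simp add: power2_eq_square algebra_simps)
qed

text \<open>
  The new bound is a quadratic polynomial in the new datum \<open>e\<close>. Completing the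
  square in \<open>e\<close> splits both sides into the part orthogonal to the point
  \<open>z\<close>, covered by the Schur complement, and the part along it; the two are joined
  by the Cauchy--Schwarz inequality in the plane.
\<close>

lemma dominated_mean_update:
  fixes z :: 'a
  assumes c: "psd c" and "s2 > 0" and m: "dominated m c Q"
  defines "s \<equiv> c z z + s2"
  shows "dominated (\<lambda>u. m u + c u z / s * (e - m z)) (\<lambda>u v. c u v - c u z * c z v / s)
           (Q + e\<^sup>2 / s2 - (e - m z)\<^sup>2 / s)"
proof -
  define v where "v = c z z"
  have v: "v \<ge> 0" using psd_diag_nonneg[OF c] by (simp add: v_def)
  have s: "s = v + s2" "s > 0" using v assms(2) by (auto simp: s_def v_def)
  have Q: "Q \<ge> 0" using m by (simp add: dominated_def)
  have mz: "(m z)\<^sup>2 \<le> Q * v" using dominated_diag[OF m] by (simp add: v_def)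
  have key: "(A + S / s * (e - m z))\<^sup>2 \<le> (Q + e\<^sup>2 / s2 - (e - m z)\<^sup>2 / s) * (W - S\<^sup>2 / s) \<and> 0 \<le> Q + e\<^sup>2 / s2 - (e - m z)\<^sup>2 / s"
    if ws: "S = lin (c z) ws" "A = lin m ws" "W = quad c ws" for ws S A W
  proof (cases "v = 0")
    case True
    have "0 \<le> W + 2 * \<tau> * S" for \<tau>
      using c unfolding psd_def by (auto simp: quad_Cons[OF c] ws True[unfolded v_def] dest: spec[of _ "(\<tau>, z) # ws"])
    have "S = 0"
    proof (rule ccontr)
      assume "S \<noteq> 0"
      then have "2 * (- (W + 1) / (2 * S)) * S = - (W + 1)" by simp
      with \<open>\<And>\<tau>. 0 \<le> W + 2 * \<tau> * S\<close>[of "- (W + 1) / (2 * S)"] show False by linarith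
    qed
    moreover have "m z = 0" using mz True by simp
    moreover have "A\<^sup>2 \<le> Q * W" using m by (simp add: ws dominated_def)
    ultimately show ?thesis using True s Q by (simp)
  next
    case False
    then have v: "v > 0" using v by simp
    define q where "q = (e + s2 * m z / v)\<^sup>2 * (v / (s2 * s))"
    have N: "Q + e\<^sup>2 / s2 - (e - m z)\<^sup>2 / s = (Q - (m z)\<^sup>2 / v) + q"
    proof -
      define r where "r = m z / v"
      have r: "m z = v * r" "s2 * m z / v = s2 * r" "(m z)\<^sup>2 / v = v * r\<^sup>2"
        using v by (simp_all add: r_def power2_eq_square)
      have "e\<^sup>2 * s - s2 * (e - v * r)\<^sup>2 = (e + s2 * r)\<^sup>2 * v - v * r\<^sup>2 * (s2 * s)"
        unfolding s(1) by (simp add: power2_eq_square algebra_simps)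
      moreover have "e\<^sup>2 / s2 - (e - v * r)\<^sup>2 / s = (e\<^sup>2 * s - s2 * (e - v * r)\<^sup>2) / (s2 * s)"
        using s(2) \<open>s2 > 0\<close> by (simp add: diff_divide_distrib)
      moreover have "((e + s2 * r)\<^sup>2 * v - v * r\<^sup>2 * (s2 * s)) / (s2 * s) = (e + s2 * r)\<^sup>2 * (v / (s2 * s)) - v * r\<^sup>2"
        using s(2) \<open>s2 > 0\<close> by (simp add: diff_divide_distrib)
      ultimately have "e\<^sup>2 / s2 - (e - v * r)\<^sup>2 / s = (e + s2 * r)\<^sup>2 * (v / (s2 * s)) - v * r\<^sup>2"
        by (simp only:)
      then show ?thesis
        unfolding q_def r(2,3) unfolding r(1) by (simp only: add_diff_eq[symmetric])
    qed
    have A: "A + S / s * (e - m z) = (A - S * m z / v) + S / s * (e + s2 * m z / v)"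
    proof -
      have "e - m z = (e + s2 * m z / v) - s * (m z / v)"
        using v unfolding s(1) by (simp add: field_simps)
      then have "S / s * (e - m z) = S / s * (e + s2 * m z / v) - S / s * (s * (m z / v))"
        by (simp only: right_diff_distrib)
      then show ?thesis using s(2) by simp
    qed
    have W: "W - S\<^sup>2 / s = (W - S\<^sup>2 / v) + S\<^sup>2 * s2 / (v * s)"
    proof -
      have "S\<^sup>2 * s2 / (v * s) = (S\<^sup>2 * s - S\<^sup>2 * v) / (v * s)"
        unfolding s(1) by (simp add: algebra_simps)
      then show ?thesis using v s(2) by (simp add: diff_divide_distrib)
    qed
    have all: "(A + \<tau> * m z)\<^sup>2 \<le> Q * (W + 2 * \<tau> * S + \<tau>\<^sup>2 * v)" for \<tau>
    proof -
      have "(lin m ((\<tau>, z) # ws))\<^sup>2 \<le> Q * quad c ((\<tau>, z) # ws)"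
        using m unfolding dominated_def by blast
      then show ?thesis by (simp add: quad_Cons[OF c] ws v_def algebra_simps)
    qed
    have "0 \<le> quad c ((- S / v, z) # ws)" using c by (simp add: psd_def)
    then have D: "0 \<le> W - S\<^sup>2 / v"
      using v by (simp add: quad_Cons[OF c] ws v_def field_simps power2_eq_square)
    have "(m z)\<^sup>2 / v \<le> Q" using mz v by (simp add: field_simps)
    moreover have "(S / s * (e + s2 * m z / v))\<^sup>2 = q * (S\<^sup>2 * s2 / (v * s))"
      using v s(2) \<open>s2 > 0\<close> unfolding q_def by (simp add: power_mult_distrib power_divide power2_eq_square)
    moreover have "q \<ge> 0" "S\<^sup>2 * s2 / (v * s) \<ge> 0"
      using v s \<open>s2 > 0\<close> by (auto simp: q_def)
    ultimately show ?thesis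
      unfolding N A W using schur_complement_le[OF all mz v Q D] D
      by (intro conjI cauchy_schwarz_plane) auto
  qed
  show ?thesis
    unfolding dominated_def
  proof safe
    show "0 \<le> Q + e\<^sup>2 / s2 - (e - m z)\<^sup>2 / s" using key[OF refl refl refl] by blast
    fix ws
    have "lin (\<lambda>u. c u z) ws = lin (c z) ws" using psd_sym[OF c] by metis
    then have "lin (\<lambda>u. m u + c u z / s * (e - m z)) ws = lin m ws + lin (c z) ws / s * (e - m z)"
      by (simp only: lin_linear)
    then show "(lin (\<lambda>u. m u + c u z / s * (e - m z)) ws)\<^sup>2
      \<le> (Q + e\<^sup>2 / s2 - (e - m z)\<^sup>2 / s) * quad (\<lambda>u v. c u v - c u z * c z v / s) ws"
      unfolding quad_update[OF c] using key[OF refl refl refl, of ws] by simp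
  qed
qed

text \<open>
  Telescoped form of \<open>e\<^sup>T (s2\<^sup>-\<^sup>1 I - (K + s2 I)\<^sup>-\<^sup>1)
  e\<close>, twice the logarithm of the exponential factor of the likelihood ratio.
\<close>

definition gp_energy :: "('a \<Rightarrow> 'a \<Rightarrow> real) \<Rightarrow> real \<Rightarrow> (nat \<Rightarrow> 'a) \<Rightarrow> (nat \<Rightarrow> real) \<Rightarrow> nat \<Rightarrow> real" where
  "gp_energy k s2 x e n =
     (\<Sum>j<n. (e j)\<^sup>2 / s2 - (e j - gp_mean k s2 x e j (x j))\<^sup>2 / (gp_var k s2 x j + s2))"

lemma dominated_gp_mean:
  assumes "psd k" "s2 > 0"
  shows "dominated (gp_mean k s2 x e n) (gp_cov k s2 x n) (gp_energy k s2 x e n)"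
proof (induction n)
  case 0
  have "lin (\<lambda>_. 0) ws = (0::real)" for ws :: "(real \<times> 'a) list" by (induction ws) auto
  then show ?case by (simp add: dominated_def gp_energy_def fun_eq_iff[of "gp_mean k s2 x e 0" "\<lambda>_. 0", THEN iffD2])
next
  case (Suc n)
  have "gp_mean k s2 x e (Suc n) = (\<lambda>u. gp_mean k s2 x e n u +
     gp_cov k s2 x n u (x n) / (gp_cov k s2 x n (x n) (x n) + s2) * (e n - gp_mean k s2 x e n (x n)))"
    by (intro ext) simp
  then show ?case
    unfolding gp_cov_Suc_eq
    using dominated_mean_update[OF psd_gp_cov[OF assms] assms(2) Suc] by (simp add: gp_energy_def add_diff_eq)
qed

lemma dominated_gp_residual:
  assumes "psd k" "s2 > 0" "dominated h k N"
  shows "dominated (\<lambda>u. h u - gp_mean k s2 x (\<lambda>j. h (x j)) n u) (gp_cov k s2 x n) N"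
proof (induction n)
  case 0
  then show ?case using assms(3) by (simp add: dominated_def quad_def)
next
  case (Suc n)
  show ?case
    unfolding gp_cov_Suc_eq
    using dominated_residual_update[OF psd_gp_cov[OF assms(1,2)] assms(2) Suc, of "x n"]
    by (simp add: algebra_simps)
qed

lemma gp_mean_add:
  "gp_mean k s2 x (\<lambda>j. e j + e' j) n u = gp_mean k s2 x e n u + gp_mean k s2 x e' n u"
proof (induction n arbitrary: u)
  case (Suc n)
  have "a + b * (p + q - (m + m')) = a' + b * (p - m) + (a'' + b * (q - m'))" if "a = a' + a''" for a a' a'' b p q m m' :: real
    using that by (simp add: algebra_simps)
  then show ?case by (simp only: gp_mean.simps Suc)
qed simp

text \<open>
  By linearity the error splits into the posterior mean of the noise and the noiseless
  interpolation error of \<open>h\<close>; both are dominated by the posterior covariance.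
\<close>

lemma gp_confidence:
  assumes "psd k" "s2 > 0" "dominated h k (N\<^sup>2)" "N \<ge> 0"
  shows "\<bar>gp_mean k s2 x (\<lambda>j. h (x j) + e j) n u - h u\<bar>
     \<le> (sqrt (gp_energy k s2 x e n) + N) * sqrt (gp_cov k s2 x n u u)"
proof -
  have "\<bar>gp_mean k s2 x e n u\<bar> \<le> sqrt (gp_energy k s2 x e n * gp_cov k s2 x n u u)"
    using dominated_diag[OF dominated_gp_mean[OF assms(1,2)]] by (intro real_le_rsqrt) auto
  moreover have "\<bar>h u - gp_mean k s2 x (\<lambda>j. h (x j)) n u\<bar> \<le> sqrt (N\<^sup>2 * gp_cov k s2 x n u u)"
    using dominated_diag[OF dominated_gp_residual[OF assms(1-3)]] by (intro real_le_rsqrt) auto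
  ultimately show ?thesis
    using assms(4) by (simp add: gp_mean_add real_sqrt_mult algebra_simps)
qed

section \<open>The sequential and the matrix form of the posterior\<close>

lemma gp_cov_sym: "psd k \<Longrightarrow> s2 > 0 \<Longrightarrow> gp_cov k s2 x n u v = gp_cov k s2 x n v u"
  using psd_sym[OF psd_gp_cov] .

lemma gp_var_nonneg: "psd k \<Longrightarrow> s2 > 0 \<Longrightarrow> 0 \<le> gp_cov k s2 x n u u"
  using psd_diag_nonneg[OF psd_gp_cov] .

lemma gp_cov_diag_le:
  assumes "psd k" "s2 > 0"
  shows "gp_cov k s2 x n u u \<le> k u u"
proof (induction n)
  case (Suc n)
  have "0 \<le> gp_cov k s2 x n u (x n) * gp_cov k s2 x n (x n) u / (gp_var k s2 x n + s2)"
    using gp_var_nonneg[OF assms, of x n "x n"] assms(2)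
    unfolding gp_cov_sym[OF assms, of x n u "x n"] by simp
  then show ?case using Suc by simp
qed simp

text \<open>
  The coefficients of the posterior mean in the data, that is, the solution of \<open>(K + s2 I)
  w = k(u)\<close>, obtained by the same update.
\<close>

primrec gp_weight :: "('a \<Rightarrow> 'a \<Rightarrow> real) \<Rightarrow> real \<Rightarrow> (nat \<Rightarrow> 'a) \<Rightarrow> nat \<Rightarrow> 'a \<Rightarrow> nat \<Rightarrow> real" where
  "gp_weight k s2 x 0 u j = 0"
| "gp_weight k s2 x (Suc n) u j =
     (let r = gp_cov k s2 x n u (x n) / (gp_var k s2 x n + s2)
      in if j = n then r else gp_weight k s2 x n u j - r * gp_weight k s2 x n (x n) j)"

lemma sum_gp_weight_Suc:
  "(\<Sum>j<Suc n. gp_weight k s2 x (Suc n) u j * g j) =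
     (\<Sum>j<n. gp_weight k s2 x n u j * g j) +
     gp_cov k s2 x n u (x n) / (gp_var k s2 x n + s2) * (g n - (\<Sum>j<n. gp_weight k s2 x n (x n) j * g j))"
  by (simp add: Let_def left_diff_distrib right_diff_distrib sum_subtractf sum_distrib_left mult.assoc)

lemma gp_mean_eq_sum: "gp_mean k s2 x e n u = (\<Sum>j<n. gp_weight k s2 x n u j * e j)"
  by (induction n arbitrary: u) (simp_all only: sum_gp_weight_Suc gp_mean.simps, simp_all)

lemma gp_cov_eq_sum: "gp_cov k s2 x n u v = k u v - (\<Sum>j<n. gp_weight k s2 x n u j * k (x j) v)"
proof (induction n arbitrary: u v)
  case (Suc n)
  show ?case
    unfolding sum_gp_weight_Suc gp_cov.simps(2) Suc[of u v] Suc[of "x n" v] by simp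
qed simp

lemma gp_weight_solves:
  assumes "psd k" "s2 > 0" "i < n"
  shows "(\<Sum>j<n. gp_weight k s2 x n u j * k (x j) (x i)) + s2 * gp_weight k s2 x n u i = k u (x i)"
  using assms(3)
proof (induction n arbitrary: u)
  case (Suc n)
  define r where "r = gp_cov k s2 x n u (x n) / (gp_var k s2 x n + s2)"
  have pos: "gp_var k s2 x n + s2 > 0"
    using gp_var_nonneg[OF assms(1,2)] assms(2) by (simp add: add_nonneg_pos)
  show ?case
  proof (cases "i = n")
    case True
    have "k u (x n) = gp_cov k s2 x n u (x n) + (\<Sum>j<n. gp_weight k s2 x n u j * k (x j) (x n))"
      "gp_var k s2 x n = k (x n) (x n) - (\<Sum>j<n. gp_weight k s2 x n (x n) j * k (x j) (x n))"
      using gp_cov_eq_sum[of k s2 x n u "x n"] gp_cov_eq_sum[of k s2 x n "x n" "x n"] by simp_all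
    moreover have "r * (gp_var k s2 x n + s2) = gp_cov k s2 x n u (x n)"
      using pos by (simp add: r_def)
    moreover have "gp_weight k s2 x (Suc n) u n = r" by (simp add: r_def)
    ultimately show ?thesis
      unfolding sum_gp_weight_Suc r_def[symmetric] True by (simp add: distrib_left mult.commute[of s2])
  next
    case False
    then have i: "i < n" using Suc.prems by simp
    have w: "gp_weight k s2 x (Suc n) u i = gp_weight k s2 x n u i - r * gp_weight k s2 x n (x n) i"
      using False by (simp add: r_def)
    show ?thesis
      unfolding sum_gp_weight_Suc r_def[symmetric] w Suc.IH[OF i, of u, symmetric] Suc.IH[OF i, of "x n", symmetric]
      by (simp add: algebra_simps del: gp_weight.simps)
  qed
qed simp

definition reg_gram :: "('a \<Rightarrow> 'a \<Rightarrow> real) \<Rightarrow> real \<Rightarrow> (nat \<Rightarrow> 'a) \<Rightarrow> nat \<Rightarrow> real mat" where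
  "reg_gram k s2 x n = Matrix.mat n n (\<lambda>(i, j). k (x i) (x j) + (if i = j then s2 else 0))"

lemma reg_gram_carrier [simp]: "reg_gram k s2 x n \<in> carrier_mat n n"
  by (simp add: reg_gram_def)

lemma gram_plus_noise_cov:
  "gram k (map x [0..<n]) + noise_cov \<sigma> n = reg_gram k (\<sigma>\<^sup>2) x n"
  "noise_cov \<sigma> n + gram k (map x [0..<n]) = reg_gram k (\<sigma>\<^sup>2) x n"
  by (rule eq_matI; simp add: gram_def noise_cov_def reg_gram_def)+

text \<open>
  Multiplying by the unipotent block matrix with last column \<open>- w\<close>, where
  \<open>w\<close> are the weights of the last point, eliminates the last column of the matrix
  up to the Schur complement, which is the posterior variance plus \<open>s2\<close>.
\<close>

lemma det_reg_gram:
  assumes "psd k" "s2 > 0"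
  shows "Determinant.det (reg_gram k s2 x n) = (\<Prod>j<n. gp_var k s2 x j + s2)"
proof (induction n)
  case 0
  then show ?case by (simp add: reg_gram_def)
next
  case (Suc n)
  define w where "w = gp_weight k s2 x n (x n)"
  define U where "U = four_block_mat (1\<^sub>m n) (Matrix.mat n 1 (\<lambda>(i, _). - w i)) (0\<^sub>m 1 n) (1\<^sub>m 1)"
  define row where "row = Matrix.mat 1 n (\<lambda>(_, j). k (x n) (x j))"
  define L where "L = four_block_mat (reg_gram k s2 x n) (0\<^sub>m n 1) row (Matrix.mat 1 1 (\<lambda>_. gp_var k s2 x n + s2))"
  have blocks: "reg_gram k s2 x (Suc n) = four_block_mat (reg_gram k s2 x n)
      (Matrix.mat n 1 (\<lambda>(i, _). k (x i) (x n))) row (Matrix.mat 1 1 (\<lambda>_. k (x n) (x n) + s2))"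
    by (rule eq_matI) (auto simp: reg_gram_def row_def less_Suc_eq)
  have c1: "reg_gram k s2 x n * Matrix.mat n 1 (\<lambda>(i, _). - w i) + Matrix.mat n 1 (\<lambda>(i, _). k (x i) (x n)) * 1\<^sub>m 1 = 0\<^sub>m n 1"
  proof (rule eq_matI)
    fix i j assume "i < dim_row (0\<^sub>m n 1 :: real mat)" "j < dim_col (0\<^sub>m n 1 :: real mat)"
    then have ij: "i < n" "j = 0" by auto
    have "k (x i) (x n) = k (x n) (x i)" using psd_sym[OF assms(1)] .
    also have "\<dots> = (\<Sum>j<n. w j * k (x j) (x i)) + s2 * w i"
      using gp_weight_solves[OF assms ij(1), of x "x n"] by (simp add: w_def)
    also have "\<dots> = (\<Sum>j<n. (k (x i) (x j) + (if i = j then s2 else 0)) * w j)"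
    proof -
      have "(k (x i) (x j) + (if i = j then s2 else 0)) * w j = w j * k (x j) (x i) + (if i = j then s2 * w j else 0)" for j
        unfolding psd_sym[OF assms(1), of "x i" "x j"] by (simp add: algebra_simps)
      then show ?thesis using ij(1) by (simp add: sum.distrib)
    qed
    finally show "(reg_gram k s2 x n * Matrix.mat n 1 (\<lambda>(i, _). - w i) + Matrix.mat n 1 (\<lambda>(i, _). k (x i) (x n)) * 1\<^sub>m 1) $$ (i, j) = 0\<^sub>m n 1 $$ (i, j)"
      using ij by (simp add: reg_gram_def scalar_prod_def sum_negf lessThan_atLeast0)
  qed (auto simp: reg_gram_def)
  have c2: "row * Matrix.mat n 1 (\<lambda>(i, _). - w i) + Matrix.mat 1 1 (\<lambda>_. k (x n) (x n) + s2) * 1\<^sub>m 1 = Matrix.mat 1 1 (\<lambda>_. gp_var k s2 x n + s2)"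
  proof (rule eq_matI)
    fix i j assume "i < dim_row (Matrix.mat 1 1 (\<lambda>_. gp_var k s2 x n + s2))" "j < dim_col (Matrix.mat 1 1 (\<lambda>_. gp_var k s2 x n + s2))"
    then have ij: "i = 0" "j = 0" by auto
    have "gp_var k s2 x n = k (x n) (x n) - (\<Sum>j<n. k (x n) (x j) * w j)"
      unfolding gp_cov_eq_sum w_def by (subst psd_sym[OF assms(1), of "x n" "x _"]) (simp add: mult.commute)
    then show "(row * Matrix.mat n 1 (\<lambda>(i, _). - w i) + Matrix.mat 1 1 (\<lambda>_. k (x n) (x n) + s2) * 1\<^sub>m 1) $$ (i, j) = Matrix.mat 1 1 (\<lambda>_. gp_var k s2 x n + s2) $$ (i, j)"
      unfolding ij by (simp add: row_def scalar_prod_def sum_negf lessThan_atLeast0)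
  qed (auto simp: row_def)
  have "reg_gram k s2 x (Suc n) * U = L"
  proof -
    have c3: "reg_gram k s2 x n * 1\<^sub>m n + Matrix.mat n 1 (\<lambda>(i, _). k (x i) (x n)) * 0\<^sub>m 1 n = reg_gram k s2 x n"
      by (simp add: right_mult_one_mat[OF reg_gram_carrier] right_mult_zero_mat[of _ n 1] right_add_zero_mat[OF reg_gram_carrier])
    have c4: "row * 1\<^sub>m n + Matrix.mat 1 1 (\<lambda>_. k (x n) (x n) + s2) * 0\<^sub>m 1 n = row"
      by (simp add: row_def)
    show ?thesis
      unfolding blocks U_def L_def
      by (subst mult_four_block_mat[of _ n n _ 1 _ 1 _ _ n _ 1])
        (use c1 c2 c3 c4 in \<open>simp_all add: row_def del: One_nat_def\<close>)
  qed
  moreover have "U \<in> carrier_mat (Suc n) (Suc n)"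
    unfolding U_def using four_block_carrier_mat[of "1\<^sub>m n" n n "1\<^sub>m 1" 1 1] by simp
  ultimately have "Determinant.det (reg_gram k s2 x (Suc n)) * Determinant.det U = Determinant.det L"
    using det_mult[of "reg_gram k s2 x (Suc n)" "Suc n" U] by simp
  moreover have "Determinant.det U = 1"
    unfolding U_def by (subst det_four_block_mat_lower_left_zero[of _ n _ 1]) (auto simp: det_single)
  moreover have "Determinant.det L = Determinant.det (reg_gram k s2 x n) * (gp_var k s2 x n + s2)"
    unfolding L_def by (subst det_four_block_mat_upper_right_zero[of _ n _ 1]) (auto simp: row_def det_single)
  ultimately show ?case using Suc by simp
qed

lemma det_noise_cov: "Determinant.det (noise_cov \<sigma> n) = (\<sigma>\<^sup>2) ^ n"
  by (simp add: noise_cov_def)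

lemma reg_gram_inv:
  assumes "psd k" "\<sigma> > 0"
  shows "reg_gram_inv k \<sigma> (map x [0..<n]) \<in> carrier_mat n n"
    and "reg_gram k (\<sigma>\<^sup>2) x n * reg_gram_inv k \<sigma> (map x [0..<n]) = 1\<^sub>m n"
proof -
  let ?G = "reg_gram k (\<sigma>\<^sup>2) x n"
  have "\<sigma>\<^sup>2 > 0" using assms(2) by simp
  then have "Determinant.det ?G > 0"
    unfolding det_reg_gram[OF assms(1) \<open>\<sigma>\<^sup>2 > 0\<close>]
    using gp_var_nonneg[OF assms(1) \<open>\<sigma>\<^sup>2 > 0\<close>] by (intro prod_pos) (auto intro: add_nonneg_pos)
  then have "?G \<in> Units (ring_mat TYPE(real) n ())"
    by (intro det_non_zero_imp_unit) auto
  then obtain R where R: "mat_inverse ?G = Some R"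
    using mat_inverse(1)[of ?G n "()"] by (cases "mat_inverse ?G") auto
  moreover have "reg_gram_inv k \<sigma> (map x [0..<n]) = the (mat_inverse ?G)"
    unfolding reg_gram_inv_def by (simp add: gram_plus_noise_cov)
  ultimately show "reg_gram_inv k \<sigma> (map x [0..<n]) \<in> carrier_mat n n"
    "?G * reg_gram_inv k \<sigma> (map x [0..<n]) = 1\<^sub>m n"
    using mat_inverse(2)[OF _ R] by auto
qed

text \<open>
  By symmetry of the matrix, \<open>k(u)\<^sup>T G\<^sup>-\<^sup>1 v = (G w)\<^sup>T
  G\<^sup>-\<^sup>1 v = w\<^sup>T v\<close>.
\<close>

lemma scalar_prod_reg_gram_inv:
  assumes "psd k" "\<sigma> > 0" and v: "v \<in> carrier_vec n"
  shows "scalar_prod (kernel_vec k (map x [0..<n]) u) (reg_gram_inv k \<sigma> (map x [0..<n]) *\<^sub>v v)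
       = (\<Sum>j<n. gp_weight k (\<sigma>\<^sup>2) x n u j * v $ j)"
proof -
  let ?G = "reg_gram k (\<sigma>\<^sup>2) x n" and ?R = "reg_gram_inv k \<sigma> (map x [0..<n])"
  define y where "y = ?R *\<^sub>v v"
  define w where "w = gp_weight k (\<sigma>\<^sup>2) x n u"
  note R = reg_gram_inv[OF assms(1,2), of x n]
  have "\<sigma>\<^sup>2 > 0" using assms(2) by simp
  note solves = gp_weight_solves[OF assms(1) this, of _ n x u, folded w_def]
  have y: "y \<in> carrier_vec n" using R(1) v by (simp add: y_def)
  have "?G *\<^sub>v y = (?G * ?R) *\<^sub>v v" unfolding y_def by (rule assoc_mult_mat_vec[symmetric, OF reg_gram_carrier R(1) v])
  then have Gy: "?G *\<^sub>v y = v" using R(2) v by simp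
  have v_eq: "v $ j = (\<Sum>i<n. k (x j) (x i) * y $ i) + \<sigma>\<^sup>2 * y $ j" if "j < n" for j
  proof -
    have "v $ j = (?G *\<^sub>v y) $ j" by (simp add: Gy)
    also have "\<dots> = (\<Sum>i<n. (k (x j) (x i) + (if j = i then \<sigma>\<^sup>2 else 0)) * y $ i)"
      using that y by (simp add: reg_gram_def scalar_prod_def lessThan_atLeast0)
    also have "\<dots> = (\<Sum>i<n. k (x j) (x i) * y $ i) + (\<Sum>i<n. (if j = i then \<sigma>\<^sup>2 * y $ i else 0))"
      unfolding sum.distrib[symmetric] by (rule sum.cong) (auto simp: algebra_simps)
    finally show ?thesis using that by simp
  qed
  have "(\<Sum>j<n. w j * v $ j) = (\<Sum>j<n. \<Sum>i<n. w j * k (x j) (x i) * y $ i) + (\<Sum>i<n. \<sigma>\<^sup>2 * w i * y $ i)"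
    unfolding sum.distrib[symmetric]
    by (rule sum.cong) (simp_all add: v_eq distrib_left sum_distrib_left mult_ac)
  also have "(\<Sum>j<n. \<Sum>i<n. w j * k (x j) (x i) * y $ i) = (\<Sum>i<n. (\<Sum>j<n. w j * k (x j) (x i)) * y $ i)"
    by (subst sum.swap) (simp add: sum_distrib_right)
  also have "\<dots> + (\<Sum>i<n. \<sigma>\<^sup>2 * w i * y $ i) = (\<Sum>i<n. k u (x i) * y $ i)"
    unfolding sum.distrib[symmetric] distrib_right[symmetric] by (rule sum.cong) (simp_all add: solves)
  also have "\<dots> = scalar_prod (kernel_vec k (map x [0..<n]) u) y"
    using y unfolding psd_sym[OF assms(1), of u "x _"] by (simp add: scalar_prod_def kernel_vec_def lessThan_atLeast0)
  finally show ?thesis by (simp add: w_def y_def)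
qed

lemma post_mean_eq_gp_mean:
  assumes "psd k" "\<sigma> > 0"
  shows "post_mean k \<sigma> (map x [0..<n]) (map y [0..<n]) u = gp_mean k (\<sigma>\<^sup>2) x y n u"
proof -
  have v: "vec_of_list (map y [0..<n]) \<in> carrier_vec n" by (simp add: carrier_vecI)
  show ?thesis
    unfolding post_mean_def scalar_prod_reg_gram_inv[OF assms v] gp_mean_eq_sum
    by (rule sum.cong) (auto simp: vec_of_list_index)
qed

lemma post_sd_eq_gp_cov:
  assumes "psd k" "\<sigma> > 0"
  shows "post_sd k \<sigma> (map x [0..<n]) u = sqrt (gp_cov k (\<sigma>\<^sup>2) x n u u)"
proof -
  have v: "kernel_vec k (map x [0..<n]) u \<in> carrier_vec n" by (simp add: kernel_vec_def carrier_vecI)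
  have "(\<Sum>j<n. gp_weight k (\<sigma>\<^sup>2) x n u j * kernel_vec k (map x [0..<n]) u $ j) = (\<Sum>j<n. gp_weight k (\<sigma>\<^sup>2) x n u j * k (x j) u)"
    by (rule sum.cong) (auto simp: kernel_vec_def)
  then show ?thesis
    unfolding post_sd_def scalar_prod_reg_gram_inv[OF assms v] by (simp add: gp_cov_eq_sum)
qed

text \<open>
  This is \<open>det (I + K / s2)\<close>, whose logarithm is twice the information gain along
  \<open>x\<close>.
\<close>

definition gain_ratio :: "('a \<Rightarrow> 'a \<Rightarrow> real) \<Rightarrow> real \<Rightarrow> (nat \<Rightarrow> 'a) \<Rightarrow> nat \<Rightarrow> real" where
  "gain_ratio k s2 x n = (\<Prod>j<n. 1 + gp_var k s2 x j / s2)"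

lemma prod_var_eq_gain_ratio:
  assumes "s2 > 0"
  shows "(\<Prod>j<n. gp_var k s2 x j + s2) = s2 ^ n * gain_ratio k s2 x n"
proof -
  have "(\<Prod>j<n. gp_var k s2 x j + s2) = (\<Prod>j<n. s2 * (1 + gp_var k s2 x j / s2))"
    using assms by (intro prod.cong) (auto simp: distrib_left)
  then show ?thesis by (simp add: prod.distrib gain_ratio_def)
qed

lemma gain_ratio_ge_1:
  assumes "psd k" "s2 > 0"
  shows "1 \<le> gain_ratio k s2 x n"
  unfolding gain_ratio_def using gp_var_nonneg[OF assms] assms(2) by (intro prod_ge_1) auto

lemma gain_ratio_mono:
  assumes "psd k" "s2 > 0" "n \<le> N"
  shows "gain_ratio k s2 x n \<le> gain_ratio k s2 x N"
  using assms(3)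
proof (induction rule: dec_induct)
  case (step n)
  have "gain_ratio k s2 x n * 1 \<le> gain_ratio k s2 x n * (1 + gp_var k s2 x n / s2)"
    using gain_ratio_ge_1[OF assms(1,2), of x n] gp_var_nonneg[OF assms(1,2), of x n] assms(2)
    by (intro mult_left_mono) auto
  then show ?case using step by (simp add: gain_ratio_def)
qed simp

lemma det_info_eq_gain_ratio:
  assumes "psd k" "\<sigma> > 0"
  shows "Determinant.det (1\<^sub>m n + (1 / \<sigma>\<^sup>2) \<cdot>\<^sub>m gram k (map x [0..<n])) = gain_ratio k (\<sigma>\<^sup>2) x n"
proof -
  have s2: "\<sigma>\<^sup>2 > 0" using assms(2) by simp
  have "1\<^sub>m n + (1 / \<sigma>\<^sup>2) \<cdot>\<^sub>m gram k (map x [0..<n]) = (1 / \<sigma>\<^sup>2) \<cdot>\<^sub>m reg_gram k (\<sigma>\<^sup>2) x n"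
    using s2 by (intro eq_matI) (auto simp: gram_def reg_gram_def field_simps)
  moreover have "dim_col (reg_gram k (\<sigma>\<^sup>2) x n) = n" by (simp add: reg_gram_def)
  ultimately show ?thesis
    using s2 by (simp add: det_reg_gram[OF assms(1) s2] prod_var_eq_gain_ratio[OF s2] power_one_over)
qed

lemma ucb_beta_eq:
  assumes "psd k" "\<sigma> > 0"
  shows "ucb_beta k \<sigma> m \<delta> B (map x [0..<n]) =
    sqrt (2 * ln (real m / \<delta> * sqrt (gain_ratio k (\<sigma>\<^sup>2) x n))) + B"
proof -
  have s2: "\<sigma>\<^sup>2 > 0" using assms(2) by simp
  have "sqrt ((\<sigma>\<^sup>2) ^ n * gain_ratio k (\<sigma>\<^sup>2) x n) / sqrt ((\<sigma>\<^sup>2) ^ n) = sqrt (gain_ratio k (\<sigma>\<^sup>2) x n)"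
    using s2 by (simp add: real_sqrt_mult)
  then show ?thesis
    by (simp add: ucb_beta_def gram_plus_noise_cov det_reg_gram[OF assms(1) s2] det_noise_cov
        prod_var_eq_gain_ratio[OF s2])
qed

section \<open>Gaussian mixtures and a maximal inequality\<close>

text \<open>
  Bayes' rule for one observation: prior times likelihood ratio is evidence times posterior.
\<close>

lemma gaussian_mixture_identity:
  fixes e b v s2 h :: real
  assumes "v > 0" "s2 > 0"
  shows "normal_density b (sqrt v) h * exp (e * h / s2 - h\<^sup>2 / (2 * s2))
    = sqrt (s2 / (s2 + v)) * exp ((e\<^sup>2 / s2 - (e - b)\<^sup>2 / (v + s2)) / 2)
      * normal_density ((b * s2 + e * v) / (v + s2)) (sqrt (v * s2 / (v + s2))) h"
proof -
  define w where "w = v + s2"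
  have w: "w > 0" "s2 = w - v" "v < w" using assms by (auto simp: w_def)
  have pos: "v * s2 / w > 0" using assms w by simp
  have "- (h - b)\<^sup>2 / (2 * v) + (e * h / s2 - h\<^sup>2 / (2 * s2))
     = (e\<^sup>2 / s2 - (e - b)\<^sup>2 / w) / 2 - (h - (b * s2 + e * v) / w)\<^sup>2 / (2 * (v * s2 / w))"
  proof -
    have h: "(h - (b * s2 + e * v) / w)\<^sup>2 / (2 * (v * s2 / w)) = (h * w - (b * s2 + e * v))\<^sup>2 / (2 * v * s2 * w)"
    proof -
      have "h - (b * s2 + e * v) / w = (h * w - (b * s2 + e * v)) / w" using w(1) by (simp add: diff_divide_distrib)
      then show ?thesis using w(1) assms by (simp add: power_divide power2_eq_square)
    qed
    define D where "D = 2 * v * s2 * w"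
    have D: "D \<noteq> 0" using assms w(1) by (simp add: D_def)
    have terms: "(h - b)\<^sup>2 / (2 * v) = (h - b)\<^sup>2 * s2 * w / D" "e * h / s2 = 2 * v * w * e * h / D"
      "h\<^sup>2 / (2 * s2) = v * w * h\<^sup>2 / D" "e\<^sup>2 / s2 / 2 = v * w * e\<^sup>2 / D"
      "(e - b)\<^sup>2 / w / 2 = v * s2 * (e - b)\<^sup>2 / D"
      using assms w(1) unfolding D_def by (simp_all add: divide_simps)
    have "- ((h - b)\<^sup>2 * s2 * w) + (2 * v * w * e * h - v * w * h\<^sup>2)
       = (v * w * e\<^sup>2 - v * s2 * (e - b)\<^sup>2) - (h * w - (b * s2 + e * v))\<^sup>2"
      unfolding w_def by (simp add: power2_eq_square algebra_simps)
    then have "(- ((h - b)\<^sup>2 * s2 * w) + (2 * v * w * e * h - v * w * h\<^sup>2)) / D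
       = ((v * w * e\<^sup>2 - v * s2 * (e - b)\<^sup>2) - (h * w - (b * s2 + e * v))\<^sup>2) / D"
      by (simp only:)
    then show ?thesis
      unfolding h D_def[symmetric] diff_divide_distrib[of _ _ 2] terms minus_divide_left[symmetric] 
      by (simp only: terms add_divide_distrib diff_divide_distrib minus_divide_left)
  qed
  then have "exp (- (h - b)\<^sup>2 / (2 * v)) * exp (e * h / s2 - h\<^sup>2 / (2 * s2))
     = exp ((e\<^sup>2 / s2 - (e - b)\<^sup>2 / w) / 2) * exp (- (h - (b * s2 + e * v) / w)\<^sup>2 / (2 * (v * s2 / w)))"
    by (simp add: exp_add[symmetric])
  moreover have "1 / sqrt (2 * pi * v) = sqrt (s2 / w) / sqrt (2 * pi * (v * s2 / w))"
    using assms w(1) by (simp add: real_sqrt_mult real_sqrt_divide)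
  ultimately show ?thesis
    unfolding normal_density_def w_def[symmetric] add.commute[of s2 v]
    using assms pos by simp
qed

text \<open>
  For a fixed drift \<open>h\<close> the exponential has expectation at most \<open>1\<close> by
  the sub-Gaussian bound; averaging over a normal \<open>h\<close> and exchanging the integrals
  preserves this.
\<close>

lemma (in prob_space) gaussian_mixture_le_1:
  assumes "s2 > 0" "v \<ge> 0" and [measurable]: "e \<in> borel_measurable M"
    and mgf: "\<And>c. (\<integral>\<^sup>+\<omega>. exp (c * e \<omega>) \<partial>M) \<le> ennreal (exp (c\<^sup>2 * s2 / 2))"
  shows "(\<integral>\<^sup>+\<omega>. sqrt (s2 / (s2 + v)) * exp (((e \<omega>)\<^sup>2 / s2 - (e \<omega> - b)\<^sup>2 / (v + s2)) / 2) \<partial>M) \<le> 1"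
proof -
  have mgf1: "(\<integral>\<^sup>+\<omega>. exp (e \<omega> * h / s2 - h\<^sup>2 / (2 * s2)) \<partial>M) \<le> 1" for h
  proof -
    have "(\<integral>\<^sup>+\<omega>. exp (e \<omega> * h / s2 - h\<^sup>2 / (2 * s2)) \<partial>M) = (\<integral>\<^sup>+\<omega>. ennreal (exp (h / s2 * e \<omega>)) * ennreal (exp (- h\<^sup>2 / (2 * s2))) \<partial>M)"
      by (intro nn_integral_cong) (simp add: ennreal_mult'[symmetric] exp_add[symmetric] mult.commute)
    also have "\<dots> = (\<integral>\<^sup>+\<omega>. exp (h / s2 * e \<omega>) \<partial>M) * ennreal (exp (- h\<^sup>2 / (2 * s2)))"
      by (rule nn_integral_multc) measurable
    also have "\<dots> \<le> ennreal (exp ((h / s2)\<^sup>2 * s2 / 2)) * ennreal (exp (- h\<^sup>2 / (2 * s2)))"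
      by (intro mult_right_mono mgf) simp
    also have "\<dots> = 1"
      using assms(1) by (simp add: ennreal_mult'[symmetric] exp_add[symmetric] power_divide power2_eq_square)
    finally show ?thesis .
  qed
  show ?thesis
  proof (cases "v = 0")
    case True
    have eq: "(e\<^sup>2 / s2 - (e - b)\<^sup>2 / (0 + s2)) / 2 = e * b / s2 - b\<^sup>2 / (2 * s2)" for e
      using assms(1) by (simp add: field_simps power2_eq_square)
    show ?thesis unfolding True eq using mgf1[of b] assms(1) by simp
  next
    case False
    then have v: "v > 0" using assms(2) by simp
    define C where "C = (\<lambda>x. sqrt (s2 / (s2 + v)) * exp ((x\<^sup>2 / s2 - (x - b)\<^sup>2 / (v + s2)) / 2))"
    have C: "ennreal (C x) = (\<integral>\<^sup>+h. normal_density b (sqrt v) h * exp (x * h / s2 - h\<^sup>2 / (2 * s2)) \<partial>lborel)" for x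
    proof -
      have "(\<integral>\<^sup>+h. normal_density b (sqrt v) h * exp (x * h / s2 - h\<^sup>2 / (2 * s2)) \<partial>lborel)
         = (\<integral>\<^sup>+h. ennreal (C x) * ennreal (normal_density ((b * s2 + x * v) / (v + s2)) (sqrt (v * s2 / (v + s2))) h) \<partial>lborel)"
        unfolding gaussian_mixture_identity[OF v assms(1)] C_def[symmetric]
        by (intro nn_integral_cong) (simp add: C_def ennreal_mult'[symmetric] mult_ac)
      also have "\<dots> = ennreal (C x) * (\<integral>\<^sup>+h. normal_density ((b * s2 + x * v) / (v + s2)) (sqrt (v * s2 / (v + s2))) h \<partial>lborel)"
        by (rule nn_integral_cmult) simp
      also have "(\<integral>\<^sup>+h. normal_density ((b * s2 + x * v) / (v + s2)) (sqrt (v * s2 / (v + s2))) h \<partial>lborel) = 1"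
        using v assms(1) by (subst nn_integral_eq_integral) auto
      finally show ?thesis by simp
    qed
    interpret L: pair_sigma_finite M lborel by unfold_locales
    have "(\<integral>\<^sup>+\<omega>. C (e \<omega>) \<partial>M) = (\<integral>\<^sup>+\<omega>. \<integral>\<^sup>+h. normal_density b (sqrt v) h * exp (e \<omega> * h / s2 - h\<^sup>2 / (2 * s2)) \<partial>lborel \<partial>M)"
      by (simp only: C)
    also have "\<dots> = (\<integral>\<^sup>+h. \<integral>\<^sup>+\<omega>. normal_density b (sqrt v) h * exp (e \<omega> * h / s2 - h\<^sup>2 / (2 * s2)) \<partial>M \<partial>lborel)"
      by (rule L.Fubini[symmetric, where f = "\<lambda>(\<omega>, h). ennreal (normal_density b (sqrt v) h * exp (e \<omega> * h / s2 - h\<^sup>2 / (2 * s2)))", simplified]) measurable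
    also have "\<dots> = (\<integral>\<^sup>+h. normal_density b (sqrt v) h * (\<integral>\<^sup>+\<omega>. exp (e \<omega> * h / s2 - h\<^sup>2 / (2 * s2)) \<partial>M) \<partial>lborel)"
      by (intro nn_integral_cong) (simp add: ennreal_mult' nn_integral_cmult)
    also have "\<dots> \<le> (\<integral>\<^sup>+h. ennreal (normal_density b (sqrt v) h) * 1 \<partial>lborel)"
      by (rule nn_integral_mono, rule mult_left_mono[OF mgf1]) simp
    also have "\<dots> = 1"
      using v by (simp add: nn_integral_eq_integral)
    finally show ?thesis by (simp add: C_def)
  qed
qed

text \<open>
  On the event \<open>A n\<close> that the level \<open>c\<close> has not been reached up to
  time \<open>n\<close> the process may continue; whatever leaves \<open>A n\<close> in the next
  step carries mass at least \<open>c\<close>. Hence \<open>c\<close> times the probability of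
  having left plus the mass still inside never exceeds the initial mass.
\<close>

lemma (in prob_space) ville_finite:
  fixes W :: "nat \<Rightarrow> 'a \<Rightarrow> ennreal"
  assumes F: "\<And>n. n \<le> N \<Longrightarrow> subalgebra M (F n)" "\<And>n. n < N \<Longrightarrow> sets (F n) \<subseteq> sets (F (Suc n))"
    and W: "\<And>n. n \<le> N \<Longrightarrow> W n \<in> borel_measurable (F n)"
    and super: "\<And>n A. n < N \<Longrightarrow> A \<in> sets (F n) \<Longrightarrow>
       (\<integral>\<^sup>+\<omega>. W (Suc n) \<omega> * indicator A \<omega> \<partial>M) \<le> (\<integral>\<^sup>+\<omega>. W n \<omega> * indicator A \<omega> \<partial>M)"
    and W0: "(\<integral>\<^sup>+\<omega>. W 0 \<omega> \<partial>M) \<le> 1"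
  shows "c * emeasure M {\<omega>\<in>space M. \<exists>n\<le>N. c \<le> W n \<omega>} \<le> 1"
proof -
  define A where "A n = {\<omega>\<in>space M. \<forall>j\<le>n. \<not> c \<le> W j \<omega>}" for n
  have WM [measurable]: "W n \<in> borel_measurable M" if "n \<le> N" for n
    using measurable_from_subalg[OF F(1)[OF that] W[OF that]] .
  have A: "A n \<in> sets (F n)" if "n \<le> N" for n
    using that
  proof (induction n)
    case 0
    have sp: "space (F 0) = space M" using F(1)[of 0] by (simp add: subalgebra_def)
    have [measurable]: "W 0 \<in> borel_measurable (F 0)" using W by blast
    have "A 0 = {\<omega>\<in>space (F 0). \<not> c \<le> W 0 \<omega>}" by (simp add: A_def sp)
    then show ?case by simp
  next
    case (Suc n)
    have sp: "space (F (Suc n)) = space M" using F(1)[OF Suc.prems] by (simp add: subalgebra_def)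
    have "A (Suc n) = A n \<inter> {\<omega>\<in>space (F (Suc n)). \<not> c \<le> W (Suc n) \<omega>}"
      unfolding A_def sp by (auto simp: le_Suc_eq)
    moreover have "A n \<in> sets (F (Suc n))" using Suc F(2)[of n] by auto
    moreover have [measurable]: "W (Suc n) \<in> borel_measurable (F (Suc n))" using W Suc.prems by blast
    ultimately show ?case by simp
  qed
  have AM: "A n \<in> sets M" if "n \<le> N" for n
    using A[OF that] F(1)[OF that] by (auto simp: subalgebra_def)
  have "c * emeasure M (space M - A n) + (\<integral>\<^sup>+\<omega>. W n \<omega> * indicator (A n) \<omega> \<partial>M) \<le> 1" if "n \<le> N" for n
    using that
  proof (induction n)
    case 0
    have m [measurable]: "W 0 \<in> borel_measurable M" "A 0 \<in> sets M" using WM AM by auto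
    have "c * emeasure M (space M - A 0) + (\<integral>\<^sup>+\<omega>. W 0 \<omega> * indicator (A 0) \<omega> \<partial>M)
      = (\<integral>\<^sup>+\<omega>. c * indicator (space M - A 0) \<omega> + W 0 \<omega> * indicator (A 0) \<omega> \<partial>M)"
      by (simp add: nn_integral_add nn_integral_cmult)
    also have "\<dots> \<le> (\<integral>\<^sup>+\<omega>. W 0 \<omega> \<partial>M)"
      by (intro nn_integral_mono) (auto simp: A_def indicator_def)
    finally show ?case using W0 by (rule order_trans)
  next
    case (Suc n)
    have m [measurable]: "W (Suc n) \<in> borel_measurable M" "A n \<in> sets M" "A (Suc n) \<in> sets M"
      using WM AM Suc.prems by auto
    have sub: "A (Suc n) \<subseteq> A n" by (auto simp: A_def)
    have "space M - A (Suc n) = (space M - A n) \<union> (A n - A (Suc n))"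
      using sub by (auto simp: A_def)
    then have "emeasure M (space M - A (Suc n)) = emeasure M (space M - A n) + emeasure M (A n - A (Suc n))"
      using plus_emeasure[of "space M - A n" M "A n - A (Suc n)"] by (simp add: Int_Diff Diff_Int_distrib2)
    then have "c * emeasure M (space M - A (Suc n)) = c * emeasure M (space M - A n) + c * emeasure M (A n - A (Suc n))"
      by (simp add: distrib_left)
    moreover have "c * emeasure M (A n - A (Suc n)) + (\<integral>\<^sup>+\<omega>. W (Suc n) \<omega> * indicator (A (Suc n)) \<omega> \<partial>M)
      = (\<integral>\<^sup>+\<omega>. c * indicator (A n - A (Suc n)) \<omega> + W (Suc n) \<omega> * indicator (A (Suc n)) \<omega> \<partial>M)"
      by (simp add: nn_integral_add nn_integral_cmult)
    moreover have "\<dots> \<le> (\<integral>\<^sup>+\<omega>. W (Suc n) \<omega> * indicator (A n) \<omega> \<partial>M)"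
      using sub by (intro nn_integral_mono) (auto simp: A_def indicator_def le_Suc_eq)
    moreover have "\<dots> \<le> (\<integral>\<^sup>+\<omega>. W n \<omega> * indicator (A n) \<omega> \<partial>M)"
      using super[OF _ A] Suc.prems by simp
    ultimately have "c * emeasure M (space M - A (Suc n)) + (\<integral>\<^sup>+\<omega>. W (Suc n) \<omega> * indicator (A (Suc n)) \<omega> \<partial>M)
      \<le> c * emeasure M (space M - A n) + (\<integral>\<^sup>+\<omega>. W n \<omega> * indicator (A n) \<omega> \<partial>M)"
      by (simp add: add.assoc add_left_mono)
    also have "\<dots> \<le> 1" using Suc by simp
    finally show ?case .
  qed
  from this[of N] have "c * emeasure M (space M - A N) \<le> 1"
    by (auto intro: order_trans[rotated])
  moreover have "space M - A N = {\<omega>\<in>space M. \<exists>n\<le>N. c \<le> W n \<omega>}" by (auto simp: A_def)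
  ultimately show ?thesis by simp
qed

section \<open>Reproducing kernel Hilbert spaces\<close>

lemma is_rkhsD:
  assumes "is_rkhs k H ip"
  shows rkhs_zero: "(\<lambda>x. 0) \<in> H"
    and rkhs_add: "\<And>u v. u \<in> H \<Longrightarrow> v \<in> H \<Longrightarrow> (\<lambda>x. u x + v x) \<in> H"
    and rkhs_scale: "\<And>u c. u \<in> H \<Longrightarrow> (\<lambda>x. c * u x) \<in> H"
    and rkhs_ip_sym: "\<And>u v. u \<in> H \<Longrightarrow> v \<in> H \<Longrightarrow> ip u v = ip v u"
    and rkhs_ip_add: "\<And>u v w. u \<in> H \<Longrightarrow> v \<in> H \<Longrightarrow> w \<in> H \<Longrightarrow> ip (\<lambda>x. u x + v x) w = ip u w + ip v w"
    and rkhs_ip_scale: "\<And>u v c. u \<in> H \<Longrightarrow> v \<in> H \<Longrightarrow> ip (\<lambda>x. c * u x) v = c * ip u v"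
    and rkhs_ip_nonneg: "\<And>u. u \<in> H \<Longrightarrow> 0 \<le> ip u u"
    and rkhs_section: "\<And>x. k x \<in> H"
    and rkhs_reproducing: "\<And>u x. u \<in> H \<Longrightarrow> ip u (k x) = u x"
  using assms unfolding is_rkhs_def by (elim conjE, simp)+

lemma rkhs_cauchy_schwarz:
  assumes H: "is_rkhs k H ip" and u: "u \<in> H" and v: "v \<in> H"
  shows "(ip u v)\<^sup>2 \<le> ip u u * ip v v"
proof -
  note R = is_rkhsD[OF H]
  have pos: "0 \<le> a\<^sup>2 * ip u u + 2 * a * b * ip u v + b\<^sup>2 * ip v v" for a b
  proof -
    define p q where "p = (\<lambda>x. a * u x)" and "q = (\<lambda>x. b * v x)"
    have pq: "p \<in> H" "q \<in> H" using R(3) u v by (auto simp: p_def q_def)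
    define w where "w = (\<lambda>x. p x + q x)"
    have w: "w \<in> H" unfolding w_def by (rule R(2)[OF pq])
    have up: "ip p z = a * ip u z" if "z \<in> H" for z unfolding p_def by (rule R(6)[OF u that])
    have vq: "ip q z = b * ip v z" if "z \<in> H" for z unfolding q_def by (rule R(6)[OF v that])
    have wz: "ip w z = a * ip u z + b * ip v z" if "z \<in> H" for z
      using R(5)[OF pq that] up[OF that] vq[OF that] by (simp add: w_def)
    have "0 \<le> ip w w" by (rule R(7)[OF w])
    also have "ip w w = a * ip w u + b * ip w v"
      using wz[OF w] R(4)[OF u w] R(4)[OF v w] by simp
    also have "\<dots> = a * (a * ip u u + b * ip u v) + b * (a * ip u v + b * ip v v)"
      using wz[OF u] wz[OF v] R(4)[OF v u] by simp
    finally show ?thesis by (simp add: power2_eq_square algebra_simps)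
  qed
  show ?thesis
  proof (cases "ip v v = 0")
    case True
    have "ip u v = 0"
    proof (rule ccontr)
      assume nz: "ip u v \<noteq> 0"
      then have "2 * (- (ip u u + 1) / (2 * ip u v)) * ip u v = - (ip u u + 1)" by simp
      then show False using pos[of 1 "- (ip u u + 1) / (2 * ip u v)"] True by simp
    qed
    then show ?thesis using True by simp
  next
    case False
    then have "ip v v > 0" using R(7)[OF v] by simp
    have "0 \<le> (ip v v)\<^sup>2 * ip u u + 2 * ip v v * (- ip u v) * ip u v + (- ip u v)\<^sup>2 * ip v v"
      by (rule pos)
    also have "\<dots> = ip v v * (ip u u * ip v v - (ip u v)\<^sup>2)"
      by (simp add: power2_eq_square algebra_simps)
    finally show ?thesis using \<open>ip v v > 0\<close> by (simp add: zero_le_mult_iff)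
  qed
qed

lemma rkhs_combination:
  assumes H: "is_rkhs k H ip"
  shows "(\<lambda>x. lin (\<lambda>z. k z x) ws) \<in> H" (is "?comb ws \<in> H")
    and "u \<in> H \<Longrightarrow> ip u (\<lambda>x. lin (\<lambda>z. k z x) ws) = lin u ws"
proof (induction ws)
  case Nil
  have "ip u (\<lambda>x. 0) = 0" if u: "u \<in> H" for u
    using rkhs_ip_sym[OF H u rkhs_zero[OF H]] rkhs_ip_scale[OF H u u, of 0] by simp
  then show "?comb [] \<in> H" "u \<in> H \<Longrightarrow> ip u (?comb []) = lin u []"
    using rkhs_zero[OF H] by simp_all
next
  case (Cons p ws)
  obtain w z where p: "p = (w, z)" by (cases p)
  note kz = rkhs_section[OF H, of z] rkhs_scale[OF H rkhs_section[OF H, of z], of w]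
  have comb: "?comb (p # ws) = (\<lambda>x. w * k z x + ?comb ws x)" by (simp add: p)
  show in_H: "?comb (p # ws) \<in> H"
    unfolding comb by (rule rkhs_add[OF H kz(2) Cons.IH(1)])
  assume u: "u \<in> H"
  have "ip u (?comb (p # ws)) = ip (?comb (p # ws)) u" by (rule rkhs_ip_sym[OF H u in_H])
  also have "\<dots> = ip (\<lambda>x. w * k z x) u + ip (?comb ws) u"
    unfolding comb by (rule rkhs_ip_add[OF H kz(2) Cons.IH(1) u])
  also have "ip (\<lambda>x. w * k z x) u = w * ip (k z) u" by (rule rkhs_ip_scale[OF H kz(1) u])
  also have "ip (k z) u = u z"
    using rkhs_ip_sym[OF H kz(1) u] rkhs_reproducing[OF H u] by simp
  also have "ip (?comb ws) u = lin u ws"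
    using rkhs_ip_sym[OF H Cons.IH(1) u] Cons.IH(2)[OF u] by simp
  finally show "ip u (?comb (p # ws)) = lin u (p # ws)" by (simp add: p)
qed

lemma rkhs_kernel_sym:
  assumes H: "is_rkhs k H ip"
  shows "k x y = k y x"
  using rkhs_ip_sym[OF H rkhs_section[OF H] rkhs_section[OF H], of x y]
    rkhs_reproducing[OF H rkhs_section[OF H]] by simp

lemma rkhs_ip_combination:
  assumes H: "is_rkhs k H ip"
  shows "ip (\<lambda>x. lin (\<lambda>z. k z x) ws) (\<lambda>x. lin (\<lambda>z. k z x) ws) = quad k ws"
proof -
  have "(\<lambda>z. k z x) = k x" for x by (rule ext) (rule rkhs_kernel_sym[OF H])
  then have "lin (\<lambda>x. lin (\<lambda>z. k z x) ws) ws = quad k ws" by (simp add: quad_def)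
  then show ?thesis using rkhs_combination(2)[OF H rkhs_combination(1)[OF H], of ws ws] by (rule trans[rotated])
qed

lemma rkhs_psd:
  assumes H: "is_rkhs k H ip"
  shows "psd k"
  unfolding psd_def
  using rkhs_kernel_sym[OF H] rkhs_ip_nonneg[OF H rkhs_combination(1)[OF H], unfolded rkhs_ip_combination[OF H]]
  by blast

text \<open>
  A combination of point evaluations at \<open>u\<close> is an inner product with the same
  combination of kernel sections, so this is the Cauchy--Schwarz inequality.
\<close>

lemma rkhs_dominated:
  assumes H: "is_rkhs k H ip" and u: "u \<in> H"
  shows "dominated u k (ip u u)"
  unfolding dominated_def
proof safe
  show "0 \<le> ip u u" using rkhs_ip_nonneg[OF H u] .
  fix ws
  show "(lin u ws)\<^sup>2 \<le> ip u u * quad k ws"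
    using rkhs_cauchy_schwarz[OF H u rkhs_combination(1)[OF H]]
    unfolding rkhs_combination(2)[OF H u] rkhs_ip_combination[OF H] .
qed

lemma rkhs_restr_norm_nonneg: 
  assumes "is_rkhs k H ip" "h \<in> rkhs_restr H X"
  shows "0 \<le> rkhs_restr_norm H ip X h"
proof -
  have "{u\<in>H. \<forall>x\<in>X. u x = h x} \<noteq> {}" using assms(2) unfolding rkhs_restr_def by auto
  then show ?thesis
    unfolding rkhs_restr_norm_def using rkhs_ip_nonneg[OF assms(1)] by (intro cINF_greatest) auto
qed

text \<open>
  The quotient norm is an infimum that is approached by extensions of \<open>h\<close>, so
  bounds are proved for every larger number and then passed to the limit.
\<close>

lemma rkhs_restr_approx:
  assumes "is_rkhs k H ip" "h \<in> rkhs_restr H X" "rkhs_restr_norm H ip X h < N"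
  obtains u where "u \<in> H" "\<And>x. x \<in> X \<Longrightarrow> u x = h x" "dominated u k (N\<^sup>2)"
proof -
  have ne: "{u\<in>H. \<forall>x\<in>X. u x = h x} \<noteq> {}" using assms(2) unfolding rkhs_restr_def by auto
  have nn: "0 \<le> ip u u" if "u \<in> H" for u using rkhs_ip_nonneg[OF assms(1) that] .
  then have bdd: "bdd_below ((\<lambda>u. sqrt (ip u u)) ` {u\<in>H. \<forall>x\<in>X. u x = h x})"
    by (intro bdd_belowI2[where m = 0]) auto
  obtain u where u: "u \<in> H" "\<forall>x\<in>X. u x = h x" "sqrt (ip u u) < N"
    using assms(3) unfolding rkhs_restr_norm_def cINF_less_iff[OF ne bdd] by blast
  have "ip u u \<le> N\<^sup>2" using power_mono[OF less_imp_le[OF u(3)], of 2] nn[OF u(1)] by simp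
  moreover have "0 \<le> quad k ws" for ws using rkhs_psd[OF assms(1)] by (simp add: psd_def)
  ultimately have "dominated u k (N\<^sup>2)"
    using rkhs_dominated[OF assms(1) u(1)] unfolding dominated_def
    by (metis mult_right_mono order_trans zero_le_power2)
  then show thesis using that u by blast
qed

lemma rkhs_restr_confidence:
  assumes H: "is_rkhs k H ip" and "s2 > 0" and h: "h \<in> rkhs_restr H X"
    and x: "\<And>j. j < n \<Longrightarrow> x j \<in> X" and u: "u \<in> X"
  shows "\<bar>gp_mean k s2 x (\<lambda>j. h (x j) + e j) n u - h u\<bar>
     \<le> (sqrt (gp_energy k s2 x e n) + rkhs_restr_norm H ip X h) * sqrt (gp_cov k s2 x n u u)"
proof -
  let ?N = "rkhs_restr_norm H ip X h"
  have bound: "\<bar>gp_mean k s2 x (\<lambda>j. h (x j) + e j) n u - h u\<bar>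
     \<le> (sqrt (gp_energy k s2 x e n) + N) * sqrt (gp_cov k s2 x n u u)" if N: "?N < N" for N
  proof -
    obtain v where v: "v \<in> H" "\<And>x. x \<in> X \<Longrightarrow> v x = h x" "dominated v k (N\<^sup>2)"
      using rkhs_restr_approx[OF H h N] by blast
    have "N \<ge> 0" using rkhs_restr_norm_nonneg[OF H h] N by simp
    moreover have "gp_mean k s2 x (\<lambda>j. v (x j) + e j) n u = gp_mean k s2 x (\<lambda>j. h (x j) + e j) n u"
      unfolding gp_mean_eq_sum by (rule sum.cong) (auto simp: v(2) x)
    ultimately show ?thesis
      using gp_confidence[OF rkhs_psd[OF H] assms(2) v(3), of x e n u] v(2)[OF u] by simp
  qed
  have "((\<lambda>N. (sqrt (gp_energy k s2 x e n) + N) * sqrt (gp_cov k s2 x n u u)) \<longlongrightarrow>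
      (sqrt (gp_energy k s2 x e n) + ?N) * sqrt (gp_cov k s2 x n u u)) (at_right ?N)"
    by (intro tendsto_intros)
  then show ?thesis
    by (rule tendsto_lowerbound) (auto simp: bound eventually_at_right_less[of ?N] intro: eventually_mono[OF eventually_at_right_less])
qed

lemma dominated_diff_le:
  assumes "psd k" "dominated u k (N\<^sup>2)" "N \<ge> 0" 
  shows "\<bar>u x - u y\<bar> \<le> N * sqrt (k x x - 2 * k x y + k y y)"
proof -
  have "(u x - u y)\<^sup>2 \<le> N\<^sup>2 * (k x x - 2 * k x y + k y y)"
  proof -
    have "(lin u [(1, x), (-1, y)])\<^sup>2 \<le> N\<^sup>2 * quad k [(1, x), (-1, y)]"
      using assms(2) unfolding dominated_def by blast
    moreover have "quad k [(1, x), (-1, y)] = k x x - 2 * k x y + k y y"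
      using psd_sym[OF assms(1), of x y] by (simp add: quad_def)
    ultimately show ?thesis by simp
  qed
  then have "\<bar>u x - u y\<bar> \<le> sqrt (N\<^sup>2 * (k x x - 2 * k x y + k y y))" by (rule real_le_rsqrt[of "\<bar>u x - u y\<bar>", simplified])
  then show ?thesis using assms(3) by (simp add: real_sqrt_mult)
qed

lemma rkhs_restr_oscillation:
  assumes H: "is_rkhs k H ip" and h: "h \<in> rkhs_restr H X" and "\<And>x. k x x = 1"
    and x: "x \<in> X" and y: "y \<in> X"
  shows "\<bar>h x - h y\<bar> \<le> 2 * rkhs_restr_norm H ip X h"
proof -
  let ?N = "rkhs_restr_norm H ip X h"
  have "- 1 \<le> k x y"
  proof -
    have "0 \<le> quad k [(1, x), (1, y)]" using rkhs_psd[OF H] unfolding psd_def by blast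
    then show ?thesis using psd_sym[OF rkhs_psd[OF H], of x y] assms(3) by (simp add: quad_def)
  qed
  then have "sqrt (k x x - 2 * k x y + k y y) \<le> sqrt 4" unfolding assms(3) by (intro real_sqrt_le_mono) simp
  then have sq: "sqrt (k x x - 2 * k x y + k y y) \<le> 2" by simp
  have bound: "\<bar>h x - h y\<bar> \<le> 2 * N" if N: "?N < N" for N
  proof -
    obtain v where v: "v \<in> H" "\<And>x. x \<in> X \<Longrightarrow> v x = h x" "dominated v k (N\<^sup>2)"
      using rkhs_restr_approx[OF H h N] by blast
    have N0: "N \<ge> 0" using rkhs_restr_norm_nonneg[OF H h] N by simp
    have "\<bar>h x - h y\<bar> \<le> N * sqrt (k x x - 2 * k x y + k y y)"
      using dominated_diff_le[OF rkhs_psd[OF H] v(3) N0, of x y] v(2) x y by simp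
    also have "\<dots> \<le> N * 2" using sq N0 by (rule mult_left_mono)
    finally show ?thesis by simp
  qed
  show ?thesis
  proof (rule field_le_epsilon)
    fix e :: real assume "e > 0"
    then show "\<bar>h x - h y\<bar> \<le> 2 * ?N + e" using bound[of "?N + e / 2"] by simp
  qed
qed

lemma rkhs_continuous_on:
  assumes H: "is_rkhs k H ip" and u: "u \<in> H"
    and k: "continuous_on UNIV (\<lambda>p. k (fst p) (snd p))"
  shows "continuous_on UNIV (u :: 'a::metric_space \<Rightarrow> real)"
  unfolding continuous_on_def
proof
  fix x
  define N where "N = sqrt (ip u u)"
  have "0 \<le> ip u u" using rkhs_ip_nonneg[OF H u] .
  then have N: "N \<ge> 0" "dominated u k (N\<^sup>2)" using rkhs_dominated[OF H u] by (auto simp: N_def)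
  have "((\<lambda>y. N * sqrt (k y y - 2 * k y x + k x x)) \<longlongrightarrow> N * sqrt (k x x - 2 * k x x + k x x)) (at x)"
  proof -
    have "((\<lambda>y. k (f y) (g y)) \<longlongrightarrow> k (f x) (g x)) (at x)" if "continuous_on UNIV f" "continuous_on UNIV g" for f g :: "'a \<Rightarrow> 'a"
      using continuous_on_compose2[OF k, of UNIV "\<lambda>y. (f y, g y)"] that
      by (auto simp: continuous_on_def intro!: tendsto_Pair)
    from this[of "\<lambda>y. y" "\<lambda>y. y"] this[of "\<lambda>y. y" "\<lambda>_. x"] show ?thesis
      by (intro tendsto_intros) auto
  qed
  then have "((\<lambda>y. N * sqrt (k y y - 2 * k y x + k x x)) \<longlongrightarrow> 0) (at x)" by simp
  then have "((\<lambda>y. u y - u x) \<longlongrightarrow> 0) (at x)"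
    by (rule Lim_null_comparison[rotated])
      (use dominated_diff_le[OF rkhs_psd[OF H] N(2,1)] in auto)
  then show "(u \<longlongrightarrow> u x) (at x within UNIV)" by (simp add: LIM_zero_iff)
qed

section \<open>Information gain\<close>

locale gp_kernel =
  fixes k :: "'a::euclidean_space \<Rightarrow> 'a \<Rightarrow> real" and s2 :: real
  assumes psd: "psd k" and unit_diag: "\<And>x. k x x = 1"
    and cont: "continuous_on UNIV (\<lambda>p. k (fst p) (snd p))"
    and s2_pos: "s2 > 0"
begin

lemma var_nonneg: "0 \<le> gp_cov k s2 x n u u"
  using gp_var_nonneg[OF psd s2_pos] .

lemma var_le_1: "gp_cov k s2 x n u u \<le> 1"
  using gp_cov_diag_le[OF psd s2_pos, of x n u] unit_diag by simp

lemma tendsto_kernel: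
  assumes "(u \<longlongrightarrow> a) F" "(v \<longlongrightarrow> b) F"
  shows "((\<lambda>i. k (u i) (v i)) \<longlongrightarrow> k a b) F"
proof -
  have "isCont (\<lambda>p. k (fst p) (snd p)) (a, b)"
    using cont by (simp add: continuous_on_eq_continuous_at)
  then show ?thesis using isCont_tendsto_compose[OF _ tendsto_Pair[OF assms]] by fastforce
qed

lemma tendsto_gp_cov:
  assumes "\<And>j. j < n \<Longrightarrow> ((\<lambda>i. x i j) \<longlongrightarrow> y j) F" "(u \<longlongrightarrow> a) F" "(v \<longlongrightarrow> b) F"
  shows "((\<lambda>i. gp_cov k s2 (x i) n (u i) (v i)) \<longlongrightarrow> gp_cov k s2 y n a b) F"
  using assms
proof (induction n arbitrary: u v a b)
  case (Suc n)
  have "((\<lambda>i. x i n) \<longlongrightarrow> y n) F" using Suc.prems(1) by simp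
  then show ?case
    using Suc.prems var_nonneg[of y n "y n"] s2_pos
    unfolding gp_cov.simps by (intro tendsto_intros Suc.IH) (auto simp: add_nonneg_eq_0_iff)
qed (simp add: tendsto_kernel)

lemma tendsto_gain_ratio:
  assumes "\<And>j. j < n \<Longrightarrow> ((\<lambda>i. x i j) \<longlongrightarrow> y j) F"
  shows "((\<lambda>i. gain_ratio k s2 (x i) n) \<longlongrightarrow> gain_ratio k s2 y n) F"
  unfolding gain_ratio_def using assms s2_pos by (intro tendsto_intros tendsto_gp_cov) auto

lemma measurable_kernel:
  assumes "U \<in> borel_measurable N" "V \<in> borel_measurable N"
  shows "(\<lambda>\<omega>. k (U \<omega>) (V \<omega>)) \<in> borel_measurable N"
  using borel_measurable_continuous_Pair[OF assms, of k] cont by (simp add: case_prod_beta)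

lemma measurable_gp_cov:
  assumes "\<And>j. j < n \<Longrightarrow> X j \<in> borel_measurable N" "U \<in> borel_measurable N" "V \<in> borel_measurable N"
  shows "(\<lambda>\<omega>. gp_cov k s2 (\<lambda>j. X j \<omega>) n (U \<omega>) (V \<omega>)) \<in> borel_measurable N"
  using assms
proof (induction n arbitrary: U V)
  case (Suc n)
  have "X n \<in> borel_measurable N" using Suc.prems(1) by simp
  then show ?case
    using Suc.prems unfolding gp_cov.simps
    by (intro borel_measurable_diff borel_measurable_divide borel_measurable_times borel_measurable_add borel_measurable_const Suc.IH) auto
qed (simp add: measurable_kernel)

lemma measurable_gp_mean:
  assumes "\<And>j. j < n \<Longrightarrow> X j \<in> borel_measurable N" "\<And>j. j < n \<Longrightarrow> E j \<in> borel_measurable N" "U \<in> borel_measurable N"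
  shows "(\<lambda>\<omega>. gp_mean k s2 (\<lambda>j. X j \<omega>) (\<lambda>j. E j \<omega>) n (U \<omega>)) \<in> borel_measurable N"
  using assms
proof (induction n arbitrary: U)
  case (Suc n)
  have "X n \<in> borel_measurable N" "E n \<in> borel_measurable N" using Suc.prems by simp_all
  then show ?case
    using Suc.prems unfolding gp_mean.simps
    by (intro borel_measurable_diff borel_measurable_divide borel_measurable_times borel_measurable_add borel_measurable_const Suc.IH measurable_gp_cov) auto
qed simp

lemma gain_ratio_le: "gain_ratio k s2 x n \<le> (1 + 1 / s2) ^ n"
proof -
  have "(\<Prod>j<n. 1 + gp_var k s2 x j / s2) \<le> (\<Prod>j<n. 1 + 1 / s2)"
    using var_nonneg var_le_1 s2_pos by (intro prod_mono) (auto simp: divide_right_mono)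
  then show ?thesis by (simp add: gain_ratio_def)
qed

text \<open>
  Conditioning only decreases variances, so every factor of the determinant is at most \<open>1
  + 1 / s2\<close>. Without this bound the supremum would carry no information.
\<close>

lemma bdd_above_info_gain:
  assumes sigma: "s2 = \<sigma>\<^sup>2" "\<sigma> > 0"
  shows "bdd_above (insert 0 {1 / 2 * ln (Determinant.det (1\<^sub>m n + (1 / \<sigma>\<^sup>2) \<cdot>\<^sub>m gram k xs)) | xs.
        distinct xs \<and> length xs = n \<and> set xs \<subseteq> X})" (is "bdd_above ?S")
proof (rule bdd_aboveI[where M = "ln ((1 + 1 / s2) ^ n) / 2"])
  have le: "1 \<le> (1 + 1 / s2) ^ n" using s2_pos by (intro one_le_power) simp
  fix r assume "r \<in> ?S"
  then consider "r = 0" | xs where "r = 1 / 2 * ln (Determinant.det (1\<^sub>m n + (1 / s2) \<cdot>\<^sub>m gram k xs))" "length xs = n"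
    unfolding sigma(1) by blast
  then show "r \<le> ln ((1 + 1 / s2) ^ n) / 2"
  proof cases
    case 1
    then show ?thesis using le by simp
  next
    case 2
    then have "xs = map ((!) xs) [0..<n]" using map_nth[of xs] by simp
    then have "r = ln (gain_ratio k s2 ((!) xs) n) / 2"
      using 2 det_info_eq_gain_ratio[OF psd sigma(2), folded sigma(1), of n "(!) xs"] by simp
    then show ?thesis
      using gain_ratio_le[of "(!) xs" n] gain_ratio_ge_1[OF psd s2_pos, of "(!) xs" n] by simp
  qed
qed

lemma info_gain_nonneg:
  assumes "s2 = \<sigma>\<^sup>2" "\<sigma> > 0"
  shows "0 \<le> info_gain k X \<sigma> n"
  unfolding info_gain_def by (rule cSup_upper[OF insertI1 bdd_above_info_gain[OF assms]])

lemma gain_le_info_gain_inj: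
  assumes sigma: "s2 = \<sigma>\<^sup>2" "\<sigma> > 0" and x: "\<And>j. j < n \<Longrightarrow> x j \<in> X" and inj: "inj_on x {..<n}"
  shows "ln (gain_ratio k s2 x n) / 2 \<le> info_gain k X \<sigma> n"
  unfolding info_gain_def
proof (rule cSup_upper[OF _ bdd_above_info_gain[OF sigma]])
  have "ln (gain_ratio k s2 x n) / 2 = 1 / 2 * ln (Determinant.det (1\<^sub>m n + (1 / \<sigma>\<^sup>2) \<cdot>\<^sub>m gram k (map x [0..<n])))"
    using det_info_eq_gain_ratio[OF psd sigma(2), of n x] sigma(1) by simp
  moreover have "distinct (map x [0..<n])" "set (map x [0..<n]) \<subseteq> X"
    using inj x by (auto simp: distinct_map lessThan_atLeast0)
  ultimately show "ln (gain_ratio k s2 x n) / 2 \<in> insert 0 {1 / 2 * ln (Determinant.det (1\<^sub>m n + (1 / \<sigma>\<^sup>2) \<cdot>\<^sub>m gram k xs)) | xs.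
        distinct xs \<and> length xs = n \<and> set xs \<subseteq> X}" by force
qed

text \<open>
  The queries are moved towards distinct points \<open>z j\<close> of a segment. For small
  positive \<open>\<eta>\<close> the perturbed points are distinct: two different queries stay
  apart by continuity, two equal ones are separated by \<open>\<eta> (z i - z j)\<close>.
\<close>

lemma gain_le_info_gain:
  assumes sigma: "s2 = \<sigma>\<^sup>2" "\<sigma> > 0" and X: "convex X" and pq: "p \<in> X" "q \<in> X" "p \<noteq> q" and x: "\<And>j. j < n \<Longrightarrow> x j \<in> X"
  shows "ln (gain_ratio k s2 x n) / 2 \<le> info_gain k X \<sigma> n"
proof -
  define z where "z j = (1 - 1 / (real j + 1)) *\<^sub>R p + (1 / (real j + 1)) *\<^sub>R q" for j :: nat
  define x' where "x' \<eta> j = (1 - \<eta>) *\<^sub>R x j + \<eta> *\<^sub>R z j" for \<eta> :: real and j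
  have z: "z j \<in> X" for j
    unfolding z_def by (rule convexD_alt[OF X pq(1,2)]) auto
  have z_diff: "z i - z j = (1 / (real i + 1) - 1 / (real j + 1)) *\<^sub>R (q - p)" for i j
    by (simp add: z_def algebra_simps)
  have z_inj: "z i \<noteq> z j" if "i \<noteq> j" for i j
  proof -
    have "1 / (real i + 1) - 1 / (real j + 1) \<noteq> 0" using that by (simp add: frac_eq_eq)
    then have "z i - z j \<noteq> 0" unfolding z_diff using pq(3) by simp
    then show ?thesis by simp
  qed
  have lim: "((\<lambda>\<eta>. x' \<eta> j) \<longlongrightarrow> x j) (at_right 0)" for j
    unfolding x'_def by (auto intro!: tendsto_eq_intros)
  have pair: "\<forall>\<^sub>F \<eta> in at_right 0. x' \<eta> i \<noteq> x' \<eta> j" if "i \<noteq> j" for i j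
  proof (cases "x i = x j")
    case True
    have "x' \<eta> i - x' \<eta> j = \<eta> *\<^sub>R (z i - z j)" for \<eta>
      by (simp add: x'_def True algebra_simps)
    then have "x' \<eta> i \<noteq> x' \<eta> j" if "\<eta> > 0" for \<eta>
      using z_inj[OF \<open>i \<noteq> j\<close>] that by (metis diff_self eq_iff_diff_eq_0 less_irrefl scaleR_eq_0_iff)
    then show ?thesis by (auto intro: eventually_mono[OF eventually_at_right_less])
  next
    case False
    have "((\<lambda>\<eta>. x' \<eta> i - x' \<eta> j) \<longlongrightarrow> x i - x j) (at_right 0)" by (intro tendsto_intros lim)
    from tendsto_imp_eventually_ne[OF this, of 0] False show ?thesis by (simp)
  qed
  have "\<forall>\<^sub>F \<eta> in at_right 0. \<forall>i\<in>{..<n}. \<forall>j\<in>{..<n}. i \<noteq> j \<longrightarrow> x' \<eta> i \<noteq> x' \<eta> j"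
    using pair by (intro eventually_ball_finite ballI finite_lessThan) (auto simp: eventually_mono)
  moreover have "\<forall>\<^sub>F \<eta> in at_right 0. \<eta> \<in> {0<..<1::real}"
    by (rule eventually_at_right_real) simp
  ultimately have ev: "\<forall>\<^sub>F \<eta> in at_right 0. ln (gain_ratio k s2 (x' \<eta>) n) / 2 \<le> info_gain k X \<sigma> n"
  proof eventually_elim
    case (elim \<eta>)
    have "x' \<eta> j \<in> X" if "j < n" for j
      unfolding x'_def using elim(2) by (intro convexD_alt[OF X x[OF that] z]) auto
    moreover have "inj_on (x' \<eta>) {..<n}" using elim(1) by (auto simp: inj_on_def)
    ultimately show ?case by (rule gain_le_info_gain_inj[OF sigma])
  qed
  have "((\<lambda>\<eta>. ln (gain_ratio k s2 (x' \<eta>) n) / 2) \<longlongrightarrow> ln (gain_ratio k s2 x n) / 2) (at_right 0)"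
    using gain_ratio_ge_1[OF psd s2_pos, of x n] by (intro tendsto_intros tendsto_gain_ratio lim) auto
  then show ?thesis by (rule tendsto_upperbound[OF _ ev]) simp
qed

text \<open>
  Repeated observation of one point adds precisions, so the variance after \<open>n\<close>
  rounds is \<open>s2 / (s2 + n)\<close> and the product telescopes.
\<close>

lemma gain_ratio_repeated: "gain_ratio k s2 (\<lambda>_. p) n = 1 + real n / s2"
proof -
  have var: "gp_cov k s2 (\<lambda>_. p) n p p = s2 / (s2 + real n)" for n
  proof (induction n)
    case (Suc n)
    have pos: "s2 + real n > 0" using s2_pos by simp
    define c where "c = s2 / (s2 + real n)"
    have "c \<ge> 0" using pos s2_pos by (simp add: c_def)
    have "gp_cov k s2 (\<lambda>_. p) (Suc n) p p = c - c * c / (c + s2)" by (simp add: Suc c_def)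
    also have "\<dots> = (c * (c + s2) - c * c) / (c + s2)"
      using s2_pos \<open>c \<ge> 0\<close> by (simp add: diff_divide_distrib)
    also have "\<dots> = c * s2 / (c + s2)" by (simp add: distrib_left)
    also have "c + s2 = s2 * (s2 + real (Suc n)) / (s2 + real n)" using pos by (simp add: c_def field_simps)
    finally show ?case using pos s2_pos by (simp add: c_def)
  qed (use s2_pos in \<open>simp add: unit_diag\<close>)
  show ?thesis
  proof (induction n)
    case (Suc n)
    have pos: "s2 + real n > 0" using s2_pos by simp
    have "gain_ratio k s2 (\<lambda>_. p) (Suc n) = (1 + real n / s2) * (1 + 1 / (s2 + real n))"
      using Suc s2_pos by (simp add: gain_ratio_def var)
    also have "\<dots> = 1 + real (Suc n) / s2"
    proof -
      define w where "w = s2 + real n"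
      have w: "w \<noteq> 0" using pos by (simp add: w_def)
      have "1 + real n / s2 = w / s2" using s2_pos by (simp add: w_def add_divide_distrib)
      then have "(1 + real n / s2) * (1 + 1 / w) = (w + 1) / s2"
        using w by (simp add: distrib_left add_divide_distrib)
      then have "(1 + real n / s2) * (1 + 1 / (s2 + real n)) = (s2 + real n + 1) / s2"
        unfolding w_def .
      then show ?thesis using s2_pos by (simp add: add_divide_distrib add.assoc add.commute[of "real n"])
    qed
    finally show ?case .
  qed (simp add: gain_ratio_def)
qed

text \<open>
  For \<open>0 \<le> c \<le> 1\<close>, \<open>ln (1 + c / s2) \<ge> c / (s2 + c) \<ge> c / (s2
  + 1)\<close>.
\<close>

lemma sum_var_le_gain: "(\<Sum>j<n. gp_var k s2 x j) \<le> (s2 + 1) * ln (gain_ratio k s2 x n)"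
proof -
  have "gp_var k s2 x j \<le> (s2 + 1) * ln (1 + gp_var k s2 x j / s2)" for j
  proof -
    define c where "c = gp_var k s2 x j"
    have c: "0 \<le> c" "c \<le> 1" using var_nonneg var_le_1 by (auto simp: c_def)
    have pos: "1 + c / s2 > 0" using c s2_pos by (simp add: add_pos_nonneg)
    have "ln (1 / (1 + c / s2)) \<le> 1 / (1 + c / s2) - 1" using pos by (intro ln_le_minus_one) simp
    then have "1 - 1 / (1 + c / s2) \<le> ln (1 + c / s2)" using pos by (simp add: ln_div)
    moreover have "1 - 1 / (1 + c / s2) = c / (s2 + c)" using c s2_pos by (simp add: divide_simps)
    moreover have "c / (s2 + 1) \<le> c / (s2 + c)" using c s2_pos by (intro divide_left_mono) auto
    ultimately have "c / (s2 + 1) \<le> ln (1 + c / s2)" by linarith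
    then show ?thesis using s2_pos by (simp add: c_def field_simps)
  qed
  then have "(\<Sum>j<n. gp_var k s2 x j) \<le> (\<Sum>j<n. (s2 + 1) * ln (1 + gp_var k s2 x j / s2))"
    by (rule sum_mono)
  also have "\<dots> = (s2 + 1) * ln (gain_ratio k s2 x n)"
    unfolding gain_ratio_def sum_distrib_left[symmetric]
    using var_nonneg s2_pos by (subst ln_prod) (auto simp: add_nonneg_eq_0_iff)
  finally show ?thesis .
qed

end

section \<open>The likelihood ratio is a supermartingale\<close>

text \<open>
  Density at \<open>y\<close> of the predictive law \<open>N(b, v + s2)\<close> divided by that
  of \<open>N(0, s2)\<close>.
\<close>

definition likelihood_factor :: "real \<Rightarrow> real \<Rightarrow> real \<Rightarrow> real \<Rightarrow> real" where
  "likelihood_factor s2 b v y = sqrt (s2 / (s2 + v)) * exp ((y\<^sup>2 / s2 - (y - b)\<^sup>2 / (v + s2)) / 2)"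

context gp_kernel
begin

text \<open>
  Density of the data \<open>e\<close> under \<open>N(0, K + s2 I)\<close> divided by that under
  \<open>N(0, s2 I)\<close>.
\<close>

definition likelihood_ratio :: "(nat \<Rightarrow> 'a) \<Rightarrow> (nat \<Rightarrow> real) \<Rightarrow> nat \<Rightarrow> real" where
  "likelihood_ratio x e n = exp (gp_energy k s2 x e n / 2) / sqrt (gain_ratio k s2 x n)"

lemma likelihood_ratio_0: "likelihood_ratio x e 0 = 1"
  by (simp add: likelihood_ratio_def gp_energy_def gain_ratio_def)

lemma likelihood_ratio_nonneg: "0 \<le> likelihood_ratio x e n"
  using gain_ratio_ge_1[OF psd s2_pos, of x n] by (simp add: likelihood_ratio_def)

lemma likelihood_ratio_Suc:
  "likelihood_ratio x e (Suc n) = likelihood_ratio x e n * likelihood_factor s2 (gp_mean k s2 x e n (x n)) (gp_var k s2 x n) (e n)"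
proof -
  define v where "v = gp_var k s2 x n"
  have v: "v \<ge> 0" using var_nonneg by (simp add: v_def)
  have "1 + v / s2 = (s2 + v) / s2" using s2_pos by (simp add: add_divide_distrib)
  then have "inverse (sqrt (1 + v / s2)) = sqrt (s2 / (s2 + v))"
    by (simp add: real_sqrt_divide)
  moreover have "sqrt (gain_ratio k s2 x (Suc n)) = sqrt (gain_ratio k s2 x n) * sqrt (1 + v / s2)"
    by (simp add: gain_ratio_def real_sqrt_mult v_def)
  moreover have "exp (gp_energy k s2 x e (Suc n) / 2) = exp (gp_energy k s2 x e n / 2) *
      exp (((e n)\<^sup>2 / s2 - (e n - gp_mean k s2 x e n (x n))\<^sup>2 / (v + s2)) / 2)"
    unfolding exp_add[symmetric] by (simp add: gp_energy_def v_def add_divide_distrib)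
  ultimately show ?thesis
    unfolding likelihood_ratio_def likelihood_factor_def v_def[symmetric] divide_inverse[of "exp _"] inverse_mult_distrib
    by (simp only: inverse_mult_distrib mult_ac)
qed

lemma measurable_likelihood_ratio:
  assumes "\<And>j. j < n \<Longrightarrow> X j \<in> borel_measurable N" "\<And>j. j < n \<Longrightarrow> E j \<in> borel_measurable N"
  shows "(\<lambda>\<omega>. likelihood_ratio (\<lambda>j. X j \<omega>) (\<lambda>j. E j \<omega>) n) \<in> borel_measurable N"
  using assms
proof (induction n)
  case (Suc n)
  have [measurable]: "X n \<in> borel_measurable N" "E n \<in> borel_measurable N" using Suc.prems by simp_all
  have [measurable]: "(\<lambda>\<omega>. likelihood_ratio (\<lambda>j. X j \<omega>) (\<lambda>j. E j \<omega>) n) \<in> borel_measurable N" using Suc by simp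
  have [measurable]: "(\<lambda>\<omega>. gp_var k s2 (\<lambda>j. X j \<omega>) n) \<in> borel_measurable N"
    using Suc.prems by (intro measurable_gp_cov) auto
  have [measurable]: "(\<lambda>\<omega>. gp_mean k s2 (\<lambda>j. X j \<omega>) (\<lambda>j. E j \<omega>) n (X n \<omega>)) \<in> borel_measurable N"
    using Suc.prems by (intro measurable_gp_mean) auto
  show ?case unfolding likelihood_ratio_Suc likelihood_factor_def by measurable
qed (simp add: likelihood_ratio_0)

end

text \<open>
  Conditioning on the past without conditional expectations: \<open>V\<close> collects
  everything known before \<open>e\<close> is revealed, and Fubini's theorem integrates
  \<open>e\<close> out first.
\<close>

lemma (in prob_space) nn_integral_indep_le:
  assumes sub: "subalgebra M F" and V: "V \<in> measurable F N" and e: "e \<in> measurable M L"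
    and ind: "indep_set (sets F) (sets (vimage_algebra (space M) e L))"
    and w: "w \<in> borel_measurable N" and R: "(\<lambda>(v, y). R v y) \<in> borel_measurable (N \<Otimes>\<^sub>M L)"
    and le: "\<And>v. v \<in> space N \<Longrightarrow> (\<integral>\<^sup>+\<omega>. R v (e \<omega>) \<partial>M) \<le> (1::ennreal)"
  shows "(\<integral>\<^sup>+\<omega>. w (V \<omega>) * R (V \<omega>) (e \<omega>) \<partial>M) \<le> (\<integral>\<^sup>+\<omega>. w (V \<omega>) \<partial>M)"
proof -
  note [measurable] = e w R
  have V' [measurable]: "V \<in> measurable M N" using measurable_from_subalg[OF sub V] .
  have sp: "space F = space M" using sub by (simp add: subalgebra_def)
  interpret D: prob_space "distr M L e" by (rule prob_space_distr) measurable
  interpret D': prob_space "distr M N V" by (rule prob_space_distr) measurable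
  have joint: "distr M N V \<Otimes>\<^sub>M distr M L e = distr M (N \<Otimes>\<^sub>M L) (\<lambda>\<omega>. (V \<omega>, e \<omega>))"
  proof (rule pair_measure_eqI)
    fix A B assume "A \<in> sets (distr M N V)" "B \<in> sets (distr M L e)"
    then have AB [measurable]: "A \<in> sets N" "B \<in> sets L" by simp_all
    have "V -` A \<inter> space M \<in> sets F" using measurable_sets[OF V AB(1)] by (simp add: sp)
    moreover have "e -` B \<inter> space M \<in> sets (vimage_algebra (space M) e L)"
      using AB(2) by (rule in_vimage_algebra)
    ultimately have "prob ((V -` A \<inter> space M) \<inter> (e -` B \<inter> space M)) = prob (V -` A \<inter> space M) * prob (e -` B \<inter> space M)"
      using ind unfolding indep_sets2_eq by blast
    moreover have "(\<lambda>\<omega>. (V \<omega>, e \<omega>)) -` (A \<times> B) \<inter> space M = (V -` A \<inter> space M) \<inter> (e -` B \<inter> space M)" by auto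
    ultimately show "emeasure (distr M N V) A * emeasure (distr M L e) B
       = emeasure (distr M (N \<Otimes>\<^sub>M L) (\<lambda>\<omega>. (V \<omega>, e \<omega>))) (A \<times> B)"
      by (simp add: emeasure_distr emeasure_eq_measure ennreal_mult[symmetric])
  qed (unfold_locales, simp)
  have "(\<integral>\<^sup>+\<omega>. w (V \<omega>) * R (V \<omega>) (e \<omega>) \<partial>M)
     = (\<integral>\<^sup>+p. w (fst p) * R (fst p) (snd p) \<partial>distr M (N \<Otimes>\<^sub>M L) (\<lambda>\<omega>. (V \<omega>, e \<omega>)))"
    by (subst nn_integral_distr) (auto simp: case_prod_beta' intro!: borel_measurable_times)
  also have "\<dots> = (\<integral>\<^sup>+v. \<integral>\<^sup>+y. w v * R v y \<partial>distr M L e \<partial>distr M N V)"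
    unfolding joint[symmetric]
    by (subst D.nn_integral_fst[symmetric]) (auto simp: joint case_prod_beta')
  also have "\<dots> \<le> (\<integral>\<^sup>+v. w v \<partial>distr M N V)"
  proof (rule nn_integral_mono)
    fix v assume "v \<in> space (distr M N V)"
    then have v [measurable]: "v \<in> space N" by simp
    have "(\<integral>\<^sup>+y. w v * R v y \<partial>distr M L e) = w v * (\<integral>\<^sup>+\<omega>. R v (e \<omega>) \<partial>M)"
      by (simp add: nn_integral_cmult nn_integral_distr)
    also have "\<dots> \<le> w v * 1" using le[OF v] by (rule mult_left_mono) simp
    finally show "(\<integral>\<^sup>+y. w v * R v y \<partial>distr M L e) \<le> w v" by simp
  qed
  also have "\<dots> = (\<integral>\<^sup>+\<omega>. w (V \<omega>) \<partial>M)" by (simp add: nn_integral_distr)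
  finally show ?thesis .
qed

text \<open>
  Given the past, the next factor is the likelihood factor of an independent sub-Gaussian
  variable with known predictive mean and variance, whose expectation is at most
  \<open>1\<close>.
\<close>

lemma (in gp_kernel) likelihood_ratio_ville:
  fixes M :: "'w measure" and X :: "nat \<Rightarrow> 'w \<Rightarrow> 'a" and E :: "nat \<Rightarrow> 'w \<Rightarrow> real"
  assumes "prob_space M"
    and F: "\<And>n. n \<le> N \<Longrightarrow> subalgebra M (F n)" "\<And>n. n < N \<Longrightarrow> sets (F n) \<subseteq> sets (F (Suc n))"
    and X: "\<And>n. n < N \<Longrightarrow> X n \<in> borel_measurable (F n)"
    and E: "\<And>n. n < N \<Longrightarrow> E n \<in> borel_measurable (F (Suc n))"
    and ind: "\<And>n. n < N \<Longrightarrow> prob_space.indep_set M (sets (F n)) (sets (vimage_algebra (space M) (E n) borel))"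
    and mgf: "\<And>n c. n < N \<Longrightarrow> (\<integral>\<^sup>+\<omega>. exp (c * E n \<omega>) \<partial>M) \<le> ennreal (exp (c\<^sup>2 * s2 / 2))"
  shows "ennreal c * emeasure M {\<omega>\<in>space M. \<exists>n\<le>N. ennreal c \<le> ennreal (likelihood_ratio (\<lambda>j. X j \<omega>) (\<lambda>j. E j \<omega>) n)} \<le> 1"
proof -
  interpret prob_space M by fact
  have spF: "space (F n) = space M" if "n \<le> N" for n using F(1)[OF that] by (simp add: subalgebra_def)
  have mono: "sets (F i) \<subseteq> sets (F j)" if "i \<le> j" "j \<le> N" for i j
    using that
  proof (induction rule: dec_induct)
    case (step n)
    then show ?case using F(2)[of n] by auto
  qed simp
  have lift: "f \<in> borel_measurable (F j)" if "f \<in> borel_measurable (F i)" "i \<le> j" "j \<le> N" for f :: "'w \<Rightarrow> 'b::topological_space" and i j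
    using that(1) mono[OF that(2,3)] spF that(2,3) unfolding measurable_def by auto
  have XF: "X j \<in> borel_measurable (F n)" if "j \<le> n" "j < N" "n \<le> N" for j n using lift[OF X] that by blast
  have EF: "E j \<in> borel_measurable (F n)" if "j < n" "n \<le> N" for j n using lift[OF E, of j n] that by auto
  define W where "W n \<omega> = likelihood_ratio (\<lambda>j. X j \<omega>) (\<lambda>j. E j \<omega>) n" for n \<omega>
  have W: "W n \<in> borel_measurable (F n)" if "n \<le> N" for n
    unfolding W_def using that by (intro measurable_likelihood_ratio XF EF) auto
  show ?thesis
    unfolding W_def[symmetric]
  proof (rule ville_finite[where F = F])
    show "subalgebra M (F n)" if "n \<le> N" for n by (rule F(1)[OF that])
    show "sets (F n) \<subseteq> sets (F (Suc n))" if "n < N" for n by (rule F(2)[OF that])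
    show "(\<integral>\<^sup>+\<omega>. ennreal (W 0 \<omega>) \<partial>M) \<le> 1"
      by (simp add: W_def likelihood_ratio_0 emeasure_space_1)
  next
    fix n assume "n \<le> N"
    note [measurable] = W[OF this]
    show "(\<lambda>\<omega>. ennreal (W n \<omega>)) \<in> borel_measurable (F n)" by measurable
  next
    fix n A assume n: "n < N" and A: "A \<in> sets (F n)"
    have nN: "n \<le> N" using n by simp
    note [measurable] = W[OF nN] XF[OF order_refl n nN] A
    have [measurable]: "(\<lambda>\<omega>. gp_var k s2 (\<lambda>j. X j \<omega>) n) \<in> borel_measurable (F n)"
      using n by (intro measurable_gp_cov XF) auto
    have [measurable]: "(\<lambda>\<omega>. gp_mean k s2 (\<lambda>j. X j \<omega>) (\<lambda>j. E j \<omega>) n (X n \<omega>)) \<in> borel_measurable (F n)"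
      using n by (intro measurable_gp_mean XF EF) auto
    define V where "V \<omega> = (ennreal (W n \<omega>) * indicator A \<omega>, gp_mean k s2 (\<lambda>j. X j \<omega>) (\<lambda>j. E j \<omega>) n (X n \<omega>), gp_var k s2 (\<lambda>j. X j \<omega>) n)" for \<omega>
    have V: "V \<in> measurable (F n) (borel \<Otimes>\<^sub>M borel \<Otimes>\<^sub>M borel)" unfolding V_def by measurable
    have E': "E n \<in> borel_measurable M"
      using measurable_from_subalg[OF F(1) E] n by simp
    \<comment> \<open>The expectation bound is required for all values of \<open>V\<close>, also those with a negative third component;
      \<open>max 0\<close> makes it hold there and does not change actual variances.\<close>
    have "(\<integral>\<^sup>+\<omega>. fst (V \<omega>) * ennreal (likelihood_factor s2 (fst (snd (V \<omega>))) (max 0 (snd (snd (V \<omega>)))) (E n \<omega>)) \<partial>M)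
       \<le> (\<integral>\<^sup>+\<omega>. fst (V \<omega>) \<partial>M)"
    proof (rule nn_integral_indep_le[OF F(1)[OF nN] V E' ind[OF n], where w = fst and R = "\<lambda>v y. ennreal (likelihood_factor s2 (fst (snd v)) (max 0 (snd (snd v))) y)"])
      show "(\<lambda>(v, y). ennreal (likelihood_factor s2 (fst (snd v)) (max 0 (snd (snd v))) y))
        \<in> borel_measurable ((borel \<Otimes>\<^sub>M borel \<Otimes>\<^sub>M borel) \<Otimes>\<^sub>M borel)"
        unfolding likelihood_factor_def by measurable
      show "(\<integral>\<^sup>+\<omega>. ennreal (likelihood_factor s2 (fst (snd v)) (max 0 (snd (snd v))) (E n \<omega>)) \<partial>M) \<le> 1" for v :: "ennreal \<times> real \<times> real"
        unfolding likelihood_factor_def by (rule gaussian_mixture_le_1[OF s2_pos _ E' mgf[OF n]]) simp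
    qed simp
    moreover have "fst (V \<omega>) * ennreal (likelihood_factor s2 (fst (snd (V \<omega>))) (max 0 (snd (snd (V \<omega>)))) (E n \<omega>))
       = ennreal (W (Suc n) \<omega>) * indicator A \<omega>" for \<omega>
      using var_nonneg[of "\<lambda>j. X j \<omega>" n "X n \<omega>"] likelihood_ratio_nonneg[of "\<lambda>j. X j \<omega>" "\<lambda>j. E j \<omega>" n]
      by (simp add: V_def W_def likelihood_ratio_Suc ennreal_mult' max_absorb2 mult_ac)
    ultimately show "(\<integral>\<^sup>+\<omega>. ennreal (W (Suc n) \<omega>) * indicator A \<omega> \<partial>M) \<le> (\<integral>\<^sup>+\<omega>. ennreal (W n \<omega>) * indicator A \<omega> \<partial>M)"
      by (simp add: V_def)
  qed
qed

section \<open>Regret of a single round\<close>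

lemma coord_dist_eq_0_iff:
  assumes "y \<in> coord_space m" "z \<in> coord_space m"
  shows "coord_dist m y z = 0 \<longleftrightarrow> y = z"
proof -
  have "coord_dist m y z = 0 \<longleftrightarrow> (\<forall>i<m. y i = z i)"
    unfolding coord_dist_def by (simp add: sum_nonneg_eq_0_iff Ball_def)
  moreover have "y = z" if "\<forall>i<m. y i = z i"
    using that by (intro PiE_ext[OF assms[unfolded coord_space_def]]) simp
  ultimately show ?thesis by blast
qed

lemma continuous_on_of_has_gradient_within:
  assumes Y: "Y \<subseteq> coord_space m" and grad: "\<And>y. y \<in> Y \<Longrightarrow> has_gradient_within m h (G y) y Y"
  shows "continuous_on Y h"
  unfolding continuous_on_def
proof
  fix y assume "y \<in> Y"
  have coord: "((\<lambda>z. z i) \<longlongrightarrow> y i) (at y within Y)" for i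
    using continuous_on_subset[OF continuous_on_product_coordinates[of i] subset_UNIV[of Y]] \<open>y \<in> Y\<close>
    unfolding continuous_on_def by blast
  define q where "q z = (h z - h y - (\<Sum>i<m. G y i * (z i - y i))) / coord_dist m z y" for z
  have q: "(q \<longlongrightarrow> 0) (at y within Y)"
    using grad[OF \<open>y \<in> Y\<close>] unfolding has_gradient_within_def q_def .
  have d: "((\<lambda>z. coord_dist m z y) \<longlongrightarrow> 0) (at y within Y)"
    unfolding coord_dist_def by (auto intro!: tendsto_eq_intros coord)
  have lin: "((\<lambda>z. \<Sum>i<m. G y i * (z i - y i)) \<longlongrightarrow> 0) (at y within Y)"
    by (auto intro!: tendsto_eq_intros coord)
  have "((\<lambda>z. q z * coord_dist m z y + (\<Sum>i<m. G y i * (z i - y i))) \<longlongrightarrow> 0 * 0 + 0) (at y within Y)"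
    by (intro tendsto_intros q d lin)
  moreover have "\<forall>\<^sub>F z in at y within Y. q z * coord_dist m z y + (\<Sum>i<m. G y i * (z i - y i)) = h z - h y"
    unfolding eventually_at_filter
    using coord_dist_eq_0_iff[of _ m y] Y \<open>y \<in> Y\<close> by (intro always_eventually) (auto simp: q_def)
  ultimately have "((\<lambda>z. h z - h y) \<longlongrightarrow> 0) (at y within Y)"
    using tendsto_cong by force
  then show "(h \<longlongrightarrow> h y) (at y within Y)" by (simp add: LIM_zero_iff)
qed

text \<open>
  Differentiability on \<open>Y\<close> makes the lower-level objective continuous there, so
  that a minimiser exists and the choice operator selects one.
\<close>

lemma lower_sol_in:
  assumes "Y \<subseteq> coord_space m" "compact Y" "Y \<noteq> {}" "uniform_hessian_bound m \<mu> X Y g" "x \<in> X"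
  shows "lower_sol g Y x \<in> Y"
proof -
  obtain D where "has_hessian_on m (g x) D Y"
    using assms(4,5) unfolding uniform_hessian_bound_def by blast
  then obtain G where "\<And>y. y \<in> Y \<Longrightarrow> has_gradient_within m (g x) (G y) y Y"
    unfolding has_hessian_on_def by blast
  then have "continuous_on Y (g x)" by (rule continuous_on_of_has_gradient_within[OF assms(1)])
  then obtain y where "y \<in> Y" "\<forall>z\<in>Y. g x y \<le> g x z"
    using continuous_attains_inf[OF assms(2,3)] by blast
  then have "is_arg_min (g x) (\<lambda>y. y \<in> Y) y" by (auto simp: is_arg_min_linorder)
  then have "is_arg_min (g x) (\<lambda>y. y \<in> Y) (lower_sol g Y x)"
    unfolding lower_sol_def arg_min_on_def arg_min_def by (rule someI[where P = "is_arg_min (g x) (\<lambda>y. y \<in> Y)"])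
  then show ?thesis by (simp add: is_arg_min_def)
qed

lemma lipschitz_l1_on_abs:
  assumes "lipschitz_l1_on m L X Y f"
  shows "lipschitz_l1_on m \<bar>L\<bar> X Y f"
  unfolding lipschitz_l1_on_def
proof (intro ballI)
  fix x x' y y' assume in_sets: "x \<in> X" "x' \<in> X" "y \<in> Y" "y' \<in> Y"
  let ?d = "(\<Sum>b\<in>Basis. \<bar>(x - x') \<bullet> b\<bar>) + (\<Sum>i<m. \<bar>y i - y' i\<bar>)"
  have "\<bar>f x y - f x' y'\<bar> \<le> L * ?d" using assms in_sets unfolding lipschitz_l1_on_def by blast
  also have "\<dots> \<le> \<bar>L\<bar> * ?d" by (intro mult_right_mono) (auto intro!: add_nonneg_nonneg sum_nonneg)
  finally show "\<bar>f x y - f x' y'\<bar> \<le> \<bar>L\<bar> * ?d" .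
qed

text \<open>
  Coverage puts \<open>h z\<close> into the box at \<open>z\<close>, hence the optimum is below
  the acquisition value at \<open>x0\<close>; every point of the box at \<open>x0\<close> is
  within twice the half-width of \<open>h x0\<close> in each coordinate.
\<close>

lemma ucb_round_regret:
  assumes lip: "lipschitz_l1_on m L X Z f" and L: "L \<ge> 0"
    and h: "\<And>z. z \<in> X \<Longrightarrow> h z \<in> Z" and Z: "Z \<subseteq> coord_space m"
    and arg: "is_arg_max (acquisition k \<sigma> m \<delta> B Z f xs ys) (\<lambda>z. z \<in> X) x0"
    and conf: "\<And>z i. z \<in> X \<Longrightarrow> i < m \<Longrightarrow>
      \<bar>post_mean k \<sigma> xs (ys i) z - h z i\<bar> \<le> ucb_beta k \<sigma> m \<delta> B xs * post_sd k \<sigma> xs z"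
  shows "(SUP z\<in>X. f z (h z)) - f x0 (h x0) \<le> L * (2 * real m * (ucb_beta k \<sigma> m \<delta> B xs * post_sd k \<sigma> xs x0))"
proof -
  define r where "r = ucb_beta k \<sigma> m \<delta> B xs * post_sd k \<sigma> xs x0"
  have x0: "x0 \<in> X" using arg by (simp add: is_arg_max_def)
  have upper: "acquisition k \<sigma> m \<delta> B Z f xs ys x0 \<le> ereal (f x0 (h x0) + L * (2 * real m * r))"
    unfolding acquisition_def
  proof (rule SUP_least)
    fix y assume y: "y \<in> conf_box k \<sigma> m \<delta> B xs ys x0 \<inter> Z"
    have "\<bar>y i - h x0 i\<bar> \<le> 2 * r" if "i < m" for i
    proof -
      have "y i \<in> {post_mean k \<sigma> xs (ys i) x0 - r .. post_mean k \<sigma> xs (ys i) x0 + r}"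
        using PiE_mem[OF IntD1[OF y, unfolded conf_box_def], of i] that by (simp add: r_def)
      then show ?thesis using conf[OF x0 that, folded r_def] by (simp add: abs_le_iff)
    qed
    then have "(\<Sum>i<m. \<bar>y i - h x0 i\<bar>) \<le> (\<Sum>i<m. 2 * r)" by (intro sum_mono) auto
    have "\<bar>f x0 y - f x0 (h x0)\<bar> \<le> L * ((\<Sum>b\<in>Basis. \<bar>(x0 - x0) \<bullet> b\<bar>) + (\<Sum>i<m. \<bar>y i - h x0 i\<bar>))"
      using lip x0 y h[OF x0] unfolding lipschitz_l1_on_def by blast
    moreover have "L * (\<Sum>i<m. \<bar>y i - h x0 i\<bar>) \<le> L * (2 * real m * r)"
      using \<open>(\<Sum>i<m. \<bar>y i - h x0 i\<bar>) \<le> (\<Sum>i<m. 2 * r)\<close> L by (intro mult_left_mono) auto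
    ultimately have "\<bar>f x0 y - f x0 (h x0)\<bar> \<le> L * (2 * real m * r)" by simp
    then show "ereal (f x0 y) \<le> ereal (f x0 (h x0) + L * (2 * real m * r))" by simp
  qed
  have "f z (h z) \<le> f x0 (h x0) + L * (2 * real m * r)" if z: "z \<in> X" for z
  proof -
    have "h z \<in> conf_box k \<sigma> m \<delta> B xs ys z"
      unfolding conf_box_def
    proof (rule PiE_I)
      fix i assume "i \<in> {..<m}"
      then show "h z i \<in> {post_mean k \<sigma> xs (ys i) z - ucb_beta k \<sigma> m \<delta> B xs * post_sd k \<sigma> xs z ..
         post_mean k \<sigma> xs (ys i) z + ucb_beta k \<sigma> m \<delta> B xs * post_sd k \<sigma> xs z}"
        using conf[OF z, of i] by (simp add: abs_le_iff)
    next
      fix i assume "i \<notin> {..<m}"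
      then show "h z i = undefined"
        using PiE_arb[OF subsetD[OF Z h[OF z], unfolded coord_space_def]] by blast
    qed
    then have "ereal (f z (h z)) \<le> acquisition k \<sigma> m \<delta> B Z f xs ys z"
      unfolding acquisition_def using h[OF z] by (intro SUP_upper) auto
    also have "\<dots> \<le> acquisition k \<sigma> m \<delta> B Z f xs ys x0"
      using arg z unfolding is_arg_max_def by (meson not_less)
    also note upper
    finally show ?thesis by simp
  qed
  then have "(SUP z\<in>X. f z (h z)) \<le> f x0 (h x0) + L * (2 * real m * r)"
    using x0 by (intro cSUP_least) auto
  then show ?thesis by (simp add: r_def)
qed

lemma regret_le_diameter:
  assumes lip: "lipschitz_l1_on m L X Z f" and L: "L \<ge> 0"
    and h: "\<And>z. z \<in> X \<Longrightarrow> h z \<in> Z" and x: "\<And>t. t \<in> {1..T} \<Longrightarrow> x t \<in> X"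
    and D: "\<And>z z'. z \<in> X \<Longrightarrow> z' \<in> X \<Longrightarrow> (\<Sum>b\<in>Basis. \<bar>(z - z') \<bullet> b\<bar>) \<le> D"
    and osc: "\<And>z z'. z \<in> X \<Longrightarrow> z' \<in> X \<Longrightarrow> (\<Sum>i<m. \<bar>h z i - h z' i\<bar>) \<le> O'"
  shows "regret X f h T x \<le> real T * (L * (D + O'))"
proof -
  have "(SUP z\<in>X. f z (h z)) - f (x t) (h (x t)) \<le> L * (D + O')" if t: "t \<in> {1..T}" for t
  proof -
    have "f z (h z) \<le> f (x t) (h (x t)) + L * (D + O')" if z: "z \<in> X" for z
    proof -
      have "\<bar>f z (h z) - f (x t) (h (x t))\<bar> \<le> L * ((\<Sum>b\<in>Basis. \<bar>(z - x t) \<bullet> b\<bar>) + (\<Sum>i<m. \<bar>h z i - h (x t) i\<bar>))"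
        using lip z x[OF t] h unfolding lipschitz_l1_on_def by blast
      also have "\<dots> \<le> L * (D + O')"
        using L D[OF z x[OF t]] osc[OF z x[OF t]] by (intro mult_left_mono add_mono)
      finally show ?thesis by simp
    qed
    then have "(SUP z\<in>X. f z (h z)) \<le> f (x t) (h (x t)) + L * (D + O')"
      using x[OF t] by (intro cSUP_least) auto
    then show ?thesis by simp
  qed
  then have "regret X f h T x \<le> (\<Sum>t=1..T. L * (D + O'))"
    unfolding regret_def by (rule sum_mono)
  then show ?thesis by simp
qed

lemma continuous_on_objective:
  fixes X :: "'a::euclidean_space set"
  assumes lip: "lipschitz_l1_on m L X Z f" and h: "\<And>z. z \<in> X \<Longrightarrow> h z \<in> Z"
    and cont: "\<And>i. i < m \<Longrightarrow> continuous_on X (\<lambda>z. h z i)"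
  shows "continuous_on X (\<lambda>z. f z (h z))"
  unfolding continuous_on_def
proof
  fix x assume x: "x \<in> X"
  have "((\<lambda>z. L * ((\<Sum>b\<in>Basis. \<bar>(z - x) \<bullet> b\<bar>) + (\<Sum>i<m. \<bar>h z i - h x i\<bar>))) \<longlongrightarrow>
      L * ((\<Sum>b\<in>(Basis::'a set). \<bar>(x - x) \<bullet> b\<bar>) + (\<Sum>i<m. \<bar>h x i - h x i\<bar>))) (at x within X)"
  proof -
    have "((\<lambda>z. h z i) \<longlongrightarrow> h x i) (at x within X)" if "i < m" for i
      using cont[OF that] x unfolding continuous_on_def by blast
    then show ?thesis by (intro tendsto_intros) simp
  qed
  then have lim: "((\<lambda>z. L * ((\<Sum>b\<in>Basis. \<bar>(z - x) \<bullet> b\<bar>) + (\<Sum>i<m. \<bar>h z i - h x i\<bar>))) \<longlongrightarrow> 0) (at x within X)"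
    by simp
  have "((\<lambda>z. f z (h z) - f x (h x)) \<longlongrightarrow> 0) (at x within X)"
  proof (rule Lim_null_comparison[OF _ lim])
    show "\<forall>\<^sub>F z in at x within X. norm (f z (h z) - f x (h x)) \<le> L * ((\<Sum>b\<in>Basis. \<bar>(z - x) \<bullet> b\<bar>) + (\<Sum>i<m. \<bar>h z i - h x i\<bar>))"
      unfolding eventually_at_filter
    proof (intro always_eventually allI impI)
      fix z assume "z \<in> X"
      then show "norm (f z (h z) - f x (h x)) \<le> L * ((\<Sum>b\<in>Basis. \<bar>(z - x) \<bullet> b\<bar>) + (\<Sum>i<m. \<bar>h z i - h x i\<bar>))"
        using lip x h[OF x] h[OF \<open>z \<in> X\<close>] unfolding lipschitz_l1_on_def real_norm_def by blast
    qed
  qed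
  then show "((\<lambda>z. f z (h z)) \<longlongrightarrow> f x (h x)) (at x within X)" by (simp add: LIM_zero_iff)
qed

section \<open>Simultaneous confidence bands\<close>

text \<open>
  The information before round \<open>n + 1\<close>: the noise of the first \<open>n\<close>
  rounds in all coordinates.
\<close>

definition noise_past :: "'w measure \<Rightarrow> (nat \<Rightarrow> nat \<Rightarrow> 'w \<Rightarrow> real) \<Rightarrow> nat \<Rightarrow> nat \<Rightarrow> 'w measure" where
  "noise_past M \<epsilon> m n =
     vimage_algebra (space M) (\<lambda>\<omega>. \<lambda>p\<in>{1..n} \<times> {..<m}. \<epsilon> (fst p) (snd p) \<omega>) (\<Pi>\<^sub>M p\<in>{1..n} \<times> {..<m}. borel)"

lemma space_noise_past [simp]: "space (noise_past M \<epsilon> m n) = space M"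
  by (simp add: noise_past_def)

lemma sets_noise_past_le:
  assumes "\<And>t j. t \<in> {1..n} \<Longrightarrow> j < m \<Longrightarrow> \<epsilon> t j \<in> borel_measurable N" "space N = space M"
  shows "sets (noise_past M \<epsilon> m n) \<subseteq> sets N"
proof -
  have "(\<lambda>\<omega>. \<lambda>p\<in>{1..n} \<times> {..<m}. \<epsilon> (fst p) (snd p) \<omega>) \<in> measurable N (\<Pi>\<^sub>M p\<in>{1..n} \<times> {..<m}. borel)"
    by (rule measurable_restrict) (use assms(1) in auto)
  then show ?thesis unfolding noise_past_def assms(2)[symmetric] measurable_iff_sets by blast
qed

lemma measurable_noise_past:
  assumes "t \<in> {1..n}" "j < m"
  shows "\<epsilon> t j \<in> borel_measurable (noise_past M \<epsilon> m n)"
proof -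
  have "(\<lambda>\<omega>. \<lambda>p\<in>{1..n} \<times> {..<m}. \<epsilon> (fst p) (snd p) \<omega>) \<in> measurable (noise_past M \<epsilon> m n) (\<Pi>\<^sub>M p\<in>{1..n} \<times> {..<m}. borel)"
    unfolding noise_past_def by (rule measurable_vimage_algebra1) (auto simp: space_PiM)
  then have "(\<lambda>\<omega>. (\<lambda>p\<in>{1..n} \<times> {..<m}. \<epsilon> (fst p) (snd p) \<omega>) (t, j)) \<in> borel_measurable (noise_past M \<epsilon> m n)"
    by (rule measurable_compose[OF _ measurable_component_singleton]) (use assms in simp)
  then show ?thesis using assms by simp
qed

lemma measurable_noise_past_mono:
  assumes "f \<in> measurable (noise_past M \<epsilon> m i) N" "i \<le> j"
  shows "f \<in> measurable (noise_past M \<epsilon> m j) N"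
proof -
  have "sets (noise_past M \<epsilon> m i) \<subseteq> sets (noise_past M \<epsilon> m j)"
    using assms(2) by (intro sets_noise_past_le measurable_noise_past) auto
  then show ?thesis using assms(1) by (auto simp: measurable_def)
qed

lemma (in prob_space) noise_past_indep:
  assumes ind: "indep_vars (\<lambda>_. borel) (\<lambda>(t, i). \<epsilon> t i) ({1..T} \<times> {..<m})" and n: "n < T" and i: "i < m"
  shows "indep_set (sets (noise_past M \<epsilon> m n)) (sets (vimage_algebra (space M) (\<epsilon> (Suc n) i) borel))"
proof -
  let ?A = "{1..n} \<times> {..<m}" and ?B = "{(Suc n, i)}"
  have "indep_var (PiM ?A (\<lambda>_. borel)) (\<lambda>\<omega>. restrict (\<lambda>p. (\<lambda>(t, i). \<epsilon> t i) p \<omega>) ?A)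
     (PiM ?B (\<lambda>_. borel)) (\<lambda>\<omega>. restrict (\<lambda>p. (\<lambda>(t, i). \<epsilon> t i) p \<omega>) ?B)"
    by (rule indep_var_restrict[OF ind]) (use n i in auto)
  note iv = this[unfolded indep_var_eq, THEN conjunct2]
  have ind': "indep_set
      (sets (vimage_algebra (space M) (\<lambda>\<omega>. restrict (\<lambda>p. (\<lambda>(t, i). \<epsilon> t i) p \<omega>) ?A) (PiM ?A (\<lambda>_. borel))))
      (sets (vimage_algebra (space M) (\<lambda>\<omega>. restrict (\<lambda>p. (\<lambda>(t, i). \<epsilon> t i) p \<omega>) ?B) (PiM ?B (\<lambda>_. borel))))" (is "indep_set _ (sets ?VB)")
    unfolding sets_vimage_algebra by (rule iv)
  have "\<epsilon> (Suc n) i \<in> borel_measurable ?VB"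
  proof -
    have "(\<lambda>\<omega>. restrict (\<lambda>p. (\<lambda>(t, i). \<epsilon> t i) p \<omega>) ?B) \<in> measurable ?VB (PiM ?B (\<lambda>_. borel))"
      by (rule measurable_vimage_algebra1) (auto simp: space_PiM)
    then have "(\<lambda>\<omega>. restrict (\<lambda>p. (\<lambda>(t, i). \<epsilon> t i) p \<omega>) ?B (Suc n, i)) \<in> borel_measurable ?VB"
      by (rule measurable_compose[OF _ measurable_component_singleton]) simp
    then show ?thesis by simp
  qed
  then have le: "sets (vimage_algebra (space M) (\<epsilon> (Suc n) i) borel) \<subseteq> sets ?VB"
    by (simp only: measurable_iff_sets space_vimage_algebra)
  have past: "noise_past M \<epsilon> m n = vimage_algebra (space M) (\<lambda>\<omega>. restrict (\<lambda>p. (\<lambda>(t, i). \<epsilon> t i) p \<omega>) ?A) (PiM ?A (\<lambda>_. borel))"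
    by (simp add: noise_past_def case_prod_beta')
  show ?thesis
    using ind' le unfolding past indep_sets2_eq by (meson subset_iff)
qed

text \<open>
  Queries depend on past observations, which are past noise plus \<open>h\<close> at past
  queries; the recursion is unwound by induction. The functions \<open>u i\<close> are
  measurable extensions of the coordinates of \<open>h\<close> from \<open>X\<close> to the
  whole space.
\<close>

lemma query_measurable_noise_past:
  fixes x :: "nat \<Rightarrow> 'w \<Rightarrow> 'a::euclidean_space"
  assumes run: "gp_ucbl_run M k \<sigma> m \<delta> B X Z f T x (observation h \<epsilon> x)"
    and u: "\<And>i. i < m \<Longrightarrow> u i \<in> borel_measurable borel" "\<And>i z. i < m \<Longrightarrow> z \<in> X \<Longrightarrow> u i z = h z i"
    and n: "n < T"
  shows "x (Suc n) \<in> borel_measurable (noise_past M \<epsilon> m n)"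
  using n
proof (induction n rule: less_induct)
  case (less n)
  note rounds = bspec[OF run[unfolded gp_ucbl_run_def]]
  have inX: "x t \<omega> \<in> X" if "t \<in> {1..T}" "\<omega> \<in> space M" for t \<omega>
    using bspec[OF conjunct2[OF rounds[OF that(1)]] that(2)] by (simp add: is_arg_max_def)
  have "Suc n \<in> {1..T}" using less.prems by simp
  then obtain \<phi> where \<phi>: "\<phi> \<in> borel_measurable (\<Pi>\<^sub>M p\<in>{1..<Suc n} \<times> {..<m}. (borel :: real measure))"
      "\<And>\<omega>. \<omega> \<in> space M \<Longrightarrow> x (Suc n) \<omega> = \<phi> (\<lambda>(s, i)\<in>{1..<Suc n} \<times> {..<m}. observation h \<epsilon> x s i \<omega>)"
    using conjunct1[OF rounds] by blast
  have obs: "(\<lambda>\<omega>. u i (x s \<omega>) + \<epsilon> s i \<omega>) \<in> borel_measurable (noise_past M \<epsilon> m n)"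
    if s: "s \<in> {1..<Suc n}" and i: "i < m" for s i
  proof -
    obtain s' where s': "s = Suc s'" "s' < n" using s by (cases s) auto
    have "x s \<in> borel_measurable (noise_past M \<epsilon> m s')"
      unfolding s'(1) using less.IH[OF s'(2)] s'(2) less.prems by simp
    then have "x s \<in> borel_measurable (noise_past M \<epsilon> m n)"
      by (rule measurable_noise_past_mono) (use s' in simp)
    then have "(\<lambda>\<omega>. u i (x s \<omega>)) \<in> borel_measurable (noise_past M \<epsilon> m n)"
      by (rule measurable_compose[OF _ u(1)[OF i]])
    moreover have "\<epsilon> s i \<in> borel_measurable (noise_past M \<epsilon> m n)"
      by (rule measurable_noise_past) (use s i in auto)
    ultimately show ?thesis by (rule borel_measurable_add)
  qed
  have restr: "(\<lambda>\<omega>. \<lambda>p\<in>{1..<Suc n} \<times> {..<m}. u (snd p) (x (fst p) \<omega>) + \<epsilon> (fst p) (snd p) \<omega>)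
      \<in> measurable (noise_past M \<epsilon> m n) (\<Pi>\<^sub>M p\<in>{1..<Suc n} \<times> {..<m}. borel)"
  proof (rule measurable_restrict)
    fix p assume "p \<in> {1..<Suc n} \<times> {..<m}"
    then show "(\<lambda>\<omega>. u (snd p) (x (fst p) \<omega>) + \<epsilon> (fst p) (snd p) \<omega>) \<in> borel_measurable (noise_past M \<epsilon> m n)"
      by (intro obs) (simp_all add: mem_Times_iff)
  qed
  have comp: "(\<lambda>\<omega>. \<phi> (\<lambda>p\<in>{1..<Suc n} \<times> {..<m}. u (snd p) (x (fst p) \<omega>) + \<epsilon> (fst p) (snd p) \<omega>)) \<in> borel_measurable (noise_past M \<epsilon> m n)"
    by (rule measurable_compose[OF restr \<phi>(1)])
  have x_eq: "x (Suc n) \<omega> = \<phi> (\<lambda>p\<in>{1..<Suc n} \<times> {..<m}. u (snd p) (x (fst p) \<omega>) + \<epsilon> (fst p) (snd p) \<omega>)"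
    if \<omega>: "\<omega> \<in> space (noise_past M \<epsilon> m n)" for \<omega>
  proof -
    have \<omega>M: "\<omega> \<in> space M" using \<omega> by simp
    have "(\<lambda>(s, i)\<in>{1..<Suc n} \<times> {..<m}. observation h \<epsilon> x s i \<omega>)
        = (\<lambda>p\<in>{1..<Suc n} \<times> {..<m}. u (snd p) (x (fst p) \<omega>) + \<epsilon> (fst p) (snd p) \<omega>)"
    proof (rule restrict_ext)
      fix p assume "p \<in> {1..<Suc n} \<times> {..<m}"
      then obtain s i where p: "p = (s, i)" "s \<in> {1..<Suc n}" "i < m" by auto
      have "x s \<omega> \<in> X" using inX[OF _ \<omega>M, of s] p(2) less.prems by simp
      then show "(case p of (s, i) \<Rightarrow> observation h \<epsilon> x s i \<omega>) = u (snd p) (x (fst p) \<omega>) + \<epsilon> (fst p) (snd p) \<omega>"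
        using u(2)[OF p(3)] by (simp add: p(1) observation_def)
    qed
    then show ?thesis using \<phi>(2)[OF \<omega>M] by simp
  qed
  show ?case by (rule measurable_cong[THEN iffD2, OF x_eq comp])
qed

lemma (in gp_kernel) energy_le_of_likelihood_ratio_less:
  assumes "likelihood_ratio x e n < c" "c > 0"
  shows "gp_energy k s2 x e n \<le> 2 * ln (c * sqrt (gain_ratio k s2 x n))"
proof -
  have g: "gain_ratio k s2 x n > 0" using gain_ratio_ge_1[OF psd s2_pos, of x n] by simp
  then have "exp (gp_energy k s2 x e n / 2) < c * sqrt (gain_ratio k s2 x n)"
    using assms(1) by (simp add: likelihood_ratio_def divide_less_eq)
  then have "gp_energy k s2 x e n / 2 < ln (c * sqrt (gain_ratio k s2 x n))"
    using g assms(2) by (subst exp_less_cancel_iff[symmetric]) simp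
  then show ?thesis by simp
qed

text \<open>
  Union bound over the \<open>m\<close> coordinates, each failing with probability at most
  \<open>\<delta> / m\<close>.
\<close>

lemma (in gp_kernel) likelihood_ratio_event:
  fixes M :: "'w measure" and x :: "nat \<Rightarrow> 'w \<Rightarrow> 'a"
  assumes "prob_space M" and noise: "subgaussian_noise M \<sigma> m T \<epsilon>" and sigma: "s2 = \<sigma>\<^sup>2"
    and x: "\<And>n. n < T \<Longrightarrow> x (Suc n) \<in> borel_measurable (noise_past M \<epsilon> m n)"
    and m: "m \<ge> 1" and \<delta>: "0 < \<delta>"
  shows "\<exists>G\<in>sets M. 1 - \<delta> \<le> measure M G \<and>
     (\<forall>\<omega>\<in>G. \<forall>i<m. \<forall>n\<le>T. likelihood_ratio (\<lambda>j. x (Suc j) \<omega>) (\<lambda>j. \<epsilon> (Suc j) i \<omega>) n < real m / \<delta>)"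
proof -
  interpret prob_space M by fact
  define c where "c = real m / \<delta>"
  have c: "c > 0" using m \<delta> by (simp add: c_def)
  define W where "W i n \<omega> = likelihood_ratio (\<lambda>j. x (Suc j) \<omega>) (\<lambda>j. \<epsilon> (Suc j) i \<omega>) n" for i n \<omega>
  define bad where "bad i = {\<omega>\<in>space M. \<exists>n\<le>T. ennreal c \<le> ennreal (W i n \<omega>)}" for i
  have ind: "indep_vars (\<lambda>_. borel) (\<lambda>(t, i). \<epsilon> t i) ({1..T} \<times> {..<m})"
    using noise unfolding subgaussian_noise_def by blast
  have rv: "\<epsilon> t i \<in> borel_measurable M" if "t \<in> {1..T}" "i < m" for t i
    using bspec[OF conjunct1[OF ind[unfolded indep_vars_def]], of "(t, i)"] that by simp
  have sub: "subalgebra M (noise_past M \<epsilon> m n)" if "n \<le> T" for n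
    unfolding subalgebra_def using sets_noise_past_le[of n m \<epsilon> M M] rv that by auto
  have xM: "x (Suc n) \<in> borel_measurable M" if "n < T" for n
    using measurable_from_subalg[OF sub x] that by simp
  have WM [measurable]: "W i n \<in> borel_measurable M" if "i < m" "n \<le> T" for i n
    unfolding W_def using that by (intro measurable_likelihood_ratio xM rv) auto
  have badM: "bad i \<in> sets M" if "i < m" for i
  proof -
    have "bad i = (\<Union>n\<in>{..T}. {\<omega>\<in>space M. ennreal c \<le> ennreal (W i n \<omega>)})" by (auto simp: bad_def)
    moreover have "{\<omega>\<in>space M. ennreal c \<le> ennreal (W i n \<omega>)} \<in> sets M" if "n \<le> T" for n
      using WM[OF \<open>i < m\<close> that] by measurable
    ultimately show ?thesis by auto
  qed
  have prob_bad: "prob (bad i) \<le> \<delta> / real m" if i: "i < m" for i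
  proof -
    have "ennreal c * emeasure M (bad i) \<le> 1"
      unfolding bad_def W_def
    proof (rule likelihood_ratio_ville[where F = "noise_past M \<epsilon> m"])
      show "prob_space M" by fact
      show "subalgebra M (noise_past M \<epsilon> m n)" if "n \<le> T" for n by (rule sub[OF that])
      show "sets (noise_past M \<epsilon> m n) \<subseteq> sets (noise_past M \<epsilon> m (Suc n))" for n
        by (intro sets_noise_past_le measurable_noise_past) auto
      show "x (Suc n) \<in> borel_measurable (noise_past M \<epsilon> m n)" if "n < T" for n by (rule x[OF that])
      show "\<epsilon> (Suc n) i \<in> borel_measurable (noise_past M \<epsilon> m (Suc n))" if "n < T" for n
        by (rule measurable_noise_past) (use i in auto)
      show "indep_set (sets (noise_past M \<epsilon> m n)) (sets (vimage_algebra (space M) (\<epsilon> (Suc n) i) borel))" if "n < T" for n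
        by (rule noise_past_indep[OF ind that i])
      show "(\<integral>\<^sup>+\<omega>. ennreal (exp (a * \<epsilon> (Suc n) i \<omega>)) \<partial>M) \<le> ennreal (exp (a\<^sup>2 * s2 / 2))" if "n < T" for n a
      proof -
        have "Suc n \<in> {1..T}" using that by simp
        then have "integrable M (\<lambda>\<omega>. exp (a * \<epsilon> (Suc n) i \<omega>))"
          "integral\<^sup>L M (\<lambda>\<omega>. exp (a * \<epsilon> (Suc n) i \<omega>)) \<le> exp (a\<^sup>2 * s2 / 2)"
          using noise i unfolding subgaussian_noise_def sigma by blast+
        then show ?thesis by (subst nn_integral_eq_integral) (auto intro: ennreal_leI)
      qed
    qed
    then have "ennreal (c * prob (bad i)) \<le> ennreal 1"
      using c by (simp add: emeasure_eq_measure ennreal_mult')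
    then have "c * prob (bad i) \<le> 1" by (subst (asm) ennreal_le_iff) auto
    then show ?thesis using m \<delta> by (simp add: c_def field_simps)
  qed
  define G where "G = space M - (\<Union>i<m. bad i)"
  have GM: "G \<in> sets M" unfolding G_def using badM by auto
  have "prob (\<Union>i<m. bad i) \<le> (\<Sum>i<m. prob (bad i))"
    using badM by (intro finite_measure_subadditive_finite) auto
  also have "\<dots> \<le> (\<Sum>i<m. \<delta> / real m)" by (intro sum_mono prob_bad) auto
  also have "\<dots> = \<delta>" using m by simp
  finally have "prob (\<Union>i<m. bad i) \<le> \<delta>" .
  moreover have "(\<Union>i<m. bad i) \<in> sets M" using badM by auto
  ultimately have "1 - \<delta> \<le> prob G" unfolding G_def by (simp add: prob_compl)
  moreover have "W i n \<omega> < c" if "\<omega> \<in> G" "i < m" "n \<le> T" for \<omega> i n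
  proof (rule ccontr)
    assume "\<not> W i n \<omega> < c"
    then have "ennreal c \<le> ennreal (W i n \<omega>)" by (intro ennreal_leI) simp
    then have "\<omega> \<in> bad i" using that unfolding bad_def G_def by blast
    then show False using that unfolding G_def by blast
  qed
  ultimately show ?thesis using GM unfolding W_def c_def by blast
qed

lemma (in gp_kernel) confidence_of_likelihood_ratio_less:
  assumes sigma: "s2 = \<sigma>\<^sup>2" "\<sigma> > 0" and H: "is_rkhs k H ip"
    and h: "(\<lambda>z. h z i) \<in> rkhs_restr H X" "rkhs_restr_norm H ip X (\<lambda>z. h z i) \<le> B"
    and x: "\<And>j. j < n \<Longrightarrow> x (Suc j) \<in> X" and u: "u \<in> X"
    and less: "likelihood_ratio (\<lambda>j. x (Suc j)) (\<lambda>j. \<epsilon> (Suc j)) n < real m / \<delta>" "0 < real m / \<delta>"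
  shows "\<bar>post_mean k \<sigma> (map x [1..<Suc n]) (map (\<lambda>s. h (x s) i + \<epsilon> s) [1..<Suc n]) u - h u i\<bar>
     \<le> ucb_beta k \<sigma> m \<delta> B (map x [1..<Suc n]) * post_sd k \<sigma> (map x [1..<Suc n]) u"
proof -
  define x' where "x' j = x (Suc j)" for j
  define e where "e j = \<epsilon> (Suc j)" for j
  have upt: "[1..<Suc n] = map Suc [0..<n]" by (simp add: map_Suc_upt)
  have xs: "map x [1..<Suc n] = map x' [0..<n]"
    "map (\<lambda>s. h (x s) i + \<epsilon> s) [1..<Suc n] = map (\<lambda>j. h (x' j) i + e j) [0..<n]"
    unfolding upt by (simp_all add: x'_def e_def)
  have "\<bar>gp_mean k s2 x' (\<lambda>j. h (x' j) i + e j) n u - h u i\<bar>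
     \<le> (sqrt (gp_energy k s2 x' e n) + rkhs_restr_norm H ip X (\<lambda>z. h z i)) * sqrt (gp_cov k s2 x' n u u)"
    by (rule rkhs_restr_confidence[OF H s2_pos h(1) _ u]) (use x in \<open>simp add: x'_def\<close>)
  also have "\<dots> \<le> (sqrt (2 * ln (real m / \<delta> * sqrt (gain_ratio k s2 x' n))) + B) * sqrt (gp_cov k s2 x' n u u)"
  proof -
    have "gp_energy k s2 x' e n \<le> 2 * ln (real m / \<delta> * sqrt (gain_ratio k s2 x' n))"
      using energy_le_of_likelihood_ratio_less[OF less, folded x'_def e_def] .
    then have "sqrt (gp_energy k s2 x' e n) \<le> sqrt (2 * ln (real m / \<delta> * sqrt (gain_ratio k s2 x' n)))"
      by (rule real_sqrt_le_mono)
    then show ?thesis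
      using h(2) real_sqrt_ge_zero[OF var_nonneg] by (intro mult_right_mono add_mono)
  qed
  finally show ?thesis
    unfolding xs post_mean_eq_gp_mean[OF psd sigma(2)] post_sd_eq_gp_cov[OF psd sigma(2)]
      ucb_beta_eq[OF psd sigma(2)] sigma(1) .
qed

section \<open>From widths to regret\<close>

context gp_kernel
begin

lemma info_gain_lower:
  assumes sigma: "s2 = \<sigma>\<^sup>2" "\<sigma> > 0" and X: "convex X" and pq: "p \<in> X" "q \<in> X" "p \<noteq> q"
  shows "ln (1 + real T / s2) / 2 \<le> info_gain k X \<sigma> T"
  using gain_le_info_gain[OF sigma X pq, of T "\<lambda>_. p"] pq(1) by (simp add: gain_ratio_repeated)

lemma sum_sd_le:
  "(\<Sum>j<T. sqrt (gp_var k s2 x j)) \<le> sqrt (real T * ((s2 + 1) * ln (gain_ratio k s2 x T)))"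
proof (rule real_le_rsqrt)
  have "(\<Sum>j<T. sqrt (gp_var k s2 x j))\<^sup>2 \<le> (\<Sum>j<T. (sqrt (gp_var k s2 x j))\<^sup>2) * card {..<T}"
    by (rule sum_squared_le_sum_of_squares)
  also have "(\<Sum>j<T. (sqrt (gp_var k s2 x j))\<^sup>2) = (\<Sum>j<T. gp_var k s2 x j)"
    using var_nonneg by simp
  also have "\<dots> * card {..<T} \<le> ((s2 + 1) * ln (gain_ratio k s2 x T)) * card {..<T}"
    by (intro mult_right_mono sum_var_le_gain) simp
  finally show "(\<Sum>j<T. sqrt (gp_var k s2 x j))\<^sup>2 \<le> real T * ((s2 + 1) * ln (gain_ratio k s2 x T))"
    by (simp add: mult.commute)
qed

text \<open>
  The quantity \<open>2 \<gamma> + ln (1 / \<delta>) + \<gamma>\<close> bounds the logarithm in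
  \<open>\<beta>\<^sub>t\<close>. The additive constant \<open>B\<close> is absorbed because
  \<open>\<gamma>\<close> is at least the gain of a single observation.
\<close>

lemma sum_ucb_widths_le:
  assumes sigma: "s2 = \<sigma>\<^sup>2" "\<sigma> > 0" and X: "convex X" and pq: "p \<in> X" "q \<in> X" "p \<noteq> q"
    and x: "\<And>t. t \<in> {1..T} \<Longrightarrow> x t \<in> X" and T: "1 \<le> T" and m: "1 \<le> m" and \<delta>: "0 < \<delta>" "\<delta> < 1" and B: "0 \<le> B"
    and small: "ln (real m) \<le> 2 * info_gain k X \<sigma> T"
  defines "\<gamma> \<equiv> info_gain k X \<sigma> T"
  shows "(\<Sum>t=1..T. ucb_beta k \<sigma> m \<delta> B (map x [1..<t]) * post_sd k \<sigma> (map x [1..<t]) (x t))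
    \<le> (sqrt 6 + B / sqrt (ln (1 + 1 / s2) / 2)) * sqrt (2 * (s2 + 1)) * sqrt (real T * \<gamma> * (\<gamma> + ln (1 / \<delta>)))"
proof -
  define x' where "x' j = x (Suc j)" for j
  define l where "l = ln (1 / \<delta>)"
  define g1 where "g1 = ln (1 + 1 / s2) / 2"
  define K where "K = sqrt 6 + B / sqrt g1"
  have l: "l \<ge> 0" using \<delta> by (simp add: l_def)
  have g1: "g1 > 0" using s2_pos ln_gt_zero[of "1 + 1 / s2"] by (simp add: g1_def)
  have "1 / s2 \<le> real T / s2" using T s2_pos by (intro divide_right_mono) auto
  then have "g1 \<le> ln (1 + real T / s2) / 2"
    unfolding g1_def using s2_pos by (simp add: add_pos_nonneg)
  then have \<gamma>: "g1 \<le> \<gamma>" using info_gain_lower[OF sigma X pq, of T] by (simp add: \<gamma>_def)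
  have gain: "ln (gain_ratio k s2 x' T) / 2 \<le> \<gamma>"
    unfolding \<gamma>_def by (rule gain_le_info_gain[OF sigma X pq]) (use x in \<open>simp add: x'_def\<close>)
  have beta: "ucb_beta k \<sigma> m \<delta> B (map x' [0..<n]) \<le> K * sqrt (\<gamma> + l)" if n: "n < T" for n
  proof -
    have gr: "gain_ratio k s2 x' n \<ge> 1" "gain_ratio k s2 x' n \<le> gain_ratio k s2 x' T"
      using gain_ratio_ge_1[OF psd s2_pos] gain_ratio_mono[OF psd s2_pos] n by auto
    have "ln (real m / \<delta> * sqrt (gain_ratio k s2 x' n)) = ln (real m) + l + ln (gain_ratio k s2 x' n) / 2"
      using m \<delta> gr by (simp add: ln_mult ln_div ln_sqrt l_def)
    moreover have "ln (gain_ratio k s2 x' n) \<le> ln (gain_ratio k s2 x' T)" using gr by simp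
    ultimately have "2 * ln (real m / \<delta> * sqrt (gain_ratio k s2 x' n)) \<le> 6 * (\<gamma> + l)"
      using gain small l unfolding \<gamma>_def[symmetric] by simp
    then have "sqrt (2 * ln (real m / \<delta> * sqrt (gain_ratio k s2 x' n))) \<le> sqrt 6 * sqrt (\<gamma> + l)"
      unfolding real_sqrt_mult[symmetric] by (rule real_sqrt_le_mono)
    moreover have "B \<le> B / sqrt g1 * sqrt (\<gamma> + l)"
    proof -
      have "sqrt g1 \<le> sqrt (\<gamma> + l)" using \<gamma> l by simp
      then have "B * 1 \<le> B * (sqrt (\<gamma> + l) / sqrt g1)"
        using B g1 by (intro mult_left_mono) auto
      then show ?thesis by simp
    qed
    ultimately show ?thesis
      unfolding ucb_beta_eq[OF psd sigma(2)] sigma(1)[symmetric] K_def by (simp add: distrib_right)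
  qed
  have K0: "K * sqrt (\<gamma> + l) \<ge> 0" using B g1 \<gamma> l by (simp add: K_def)
  have upt: "[1..<Suc n] = map Suc [0..<n]" for n by (simp add: map_Suc_upt)
  have "(\<Sum>t=1..T. ucb_beta k \<sigma> m \<delta> B (map x [1..<t]) * post_sd k \<sigma> (map x [1..<t]) (x t))
      = (\<Sum>n<T. ucb_beta k \<sigma> m \<delta> B (map x' [0..<n]) * sqrt (gp_var k s2 x' n))"
  proof -
    have "map x [1..<Suc n] = map x' [0..<n]" for n unfolding upt by (simp add: x'_def)
    then show ?thesis
      unfolding One_nat_def sum.atLeast1_atMost_eq
      by (simp add: post_sd_eq_gp_cov[OF psd sigma(2), folded sigma(1)] x'_def)
  qed
  also have "\<dots> \<le> (\<Sum>n<T. K * sqrt (\<gamma> + l) * sqrt (gp_var k s2 x' n))"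
    using beta var_nonneg by (intro sum_mono mult_right_mono) auto
  also have "\<dots> = K * sqrt (\<gamma> + l) * (\<Sum>n<T. sqrt (gp_var k s2 x' n))" by (simp add: sum_distrib_left)
  also have "\<dots> \<le> K * sqrt (\<gamma> + l) * sqrt (real T * ((s2 + 1) * ln (gain_ratio k s2 x' T)))"
    by (intro mult_left_mono sum_sd_le K0)
  also have "\<dots> \<le> K * sqrt (\<gamma> + l) * sqrt (real T * ((s2 + 1) * (2 * \<gamma>)))"
    using gain s2_pos by (intro mult_left_mono real_sqrt_le_mono K0) auto
  also have "\<dots> = K * sqrt (2 * (s2 + 1)) * sqrt (real T * \<gamma> * (\<gamma> + l))"
  proof -
    have "real T * ((s2 + 1) * (2 * \<gamma>)) = (2 * (s2 + 1)) * (real T * \<gamma>)" by simp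
    then have "sqrt (real T * ((s2 + 1) * (2 * \<gamma>))) = sqrt (2 * (s2 + 1)) * sqrt (real T * \<gamma>)"
      by (simp only: real_sqrt_mult)
    moreover have "sqrt (real T * \<gamma> * (\<gamma> + l)) = sqrt (real T * \<gamma>) * sqrt (\<gamma> + l)"
      by (rule real_sqrt_mult)
    ultimately show ?thesis by simp
  qed
  finally show ?thesis unfolding K_def g1_def l_def .
qed

end

lemma sum_le_sqrt_card_mult:
  fixes a :: "nat \<Rightarrow> real"
  assumes "sqrt (\<Sum>i<m. (a i)\<^sup>2) \<le> B"
  shows "(\<Sum>i<m. a i) \<le> sqrt (real m) * B"
proof -
  have "(\<Sum>i<m. a i)\<^sup>2 \<le> (\<Sum>i<m. (a i)\<^sup>2) * card {..<m}" by (rule sum_squared_le_sum_of_squares)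
  then have "(\<Sum>i<m. a i) \<le> sqrt ((\<Sum>i<m. (a i)\<^sup>2) * real m)" by (intro real_le_rsqrt) simp
  also have "\<dots> = sqrt (real m) * sqrt (\<Sum>i<m. (a i)\<^sup>2)" by (simp add: real_sqrt_mult)
  also have "\<dots> \<le> sqrt (real m) * B" using assms by (rule mult_left_mono) simp
  finally show ?thesis .
qed

text \<open>
  The last bound is of order \<open>sqrt m\<close> and not \<open>m\<close>, since the squares
  of the coordinate norms sum to at most \<open>B\<^sup>2\<close>.
\<close>

lemma (in gp_kernel) rkhs_restr_norm_le_coordinates:
  assumes H: "is_rkhs k H ip" and le: "rkhs_restr_norm_le H ip X m h B"
  shows "0 \<le> B"
    and "i < m \<Longrightarrow> (\<lambda>z. h z i) \<in> rkhs_restr H X"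
    and "i < m \<Longrightarrow> rkhs_restr_norm H ip X (\<lambda>z. h z i) \<le> B"
    and "z \<in> X \<Longrightarrow> z' \<in> X \<Longrightarrow> (\<Sum>i<m. \<bar>h z i - h z' i\<bar>) \<le> 2 * B * sqrt (real m)"
proof -
  let ?N = "\<lambda>i. rkhs_restr_norm H ip X (\<lambda>z. h z i)"
  have mem: "(\<lambda>z. h z i) \<in> rkhs_restr H X" if "i < m" for i
    using le that unfolding rkhs_restr_norm_le_def by blast
  have norm: "sqrt (\<Sum>i<m. (?N i)\<^sup>2) \<le> B" using le unfolding rkhs_restr_norm_le_def by blast
  show "0 \<le> B" using norm by (rule order_trans[rotated]) (simp add: sum_nonneg)
  show "i < m \<Longrightarrow> (\<lambda>z. h z i) \<in> rkhs_restr H X" by (rule mem)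
  show "?N i \<le> B" if "i < m"
  proof -
    have "(?N i)\<^sup>2 \<le> (\<Sum>i<m. (?N i)\<^sup>2)" by (rule member_le_sum) (use that in auto)
    then have "?N i \<le> sqrt (\<Sum>i<m. (?N i)\<^sup>2)" by (rule real_le_rsqrt)
    then show ?thesis using norm by simp
  qed
  show "(\<Sum>i<m. \<bar>h z i - h z' i\<bar>) \<le> 2 * B * sqrt (real m)" if z: "z \<in> X" "z' \<in> X"
  proof -
    have "(\<Sum>i<m. \<bar>h z i - h z' i\<bar>) \<le> (\<Sum>i<m. 2 * ?N i)"
      using rkhs_restr_oscillation[OF H mem unit_diag z] by (intro sum_mono) simp
    also have "\<dots> = 2 * (\<Sum>i<m. ?N i)" by (simp add: sum_distrib_left)
    also have "\<dots> \<le> 2 * (sqrt (real m) * B)" using sum_le_sqrt_card_mult[OF norm] by simp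
    finally show ?thesis by (simp add: mult_ac)
  qed
qed

lemma sum_abs_Basis_bounded:
  fixes X :: "'a::euclidean_space set"
  assumes "bounded X"
  obtains D where "D \<ge> 0" "\<And>z z'. z \<in> X \<Longrightarrow> z' \<in> X \<Longrightarrow> (\<Sum>b\<in>Basis. \<bar>(z - z') \<bullet> b\<bar>) \<le> D"
proof
  show "0 \<le> real DIM('a) * diameter X" using diameter_ge_0[OF assms] by simp
  fix z z' assume z: "z \<in> X" "z' \<in> X"
  have "(\<Sum>b\<in>(Basis::'a set). \<bar>(z - z') \<bullet> b\<bar>) \<le> (\<Sum>b\<in>(Basis::'a set). diameter X)"
  proof (rule sum_mono)
    fix b :: 'a assume "b \<in> Basis"
    then have "\<bar>(z - z') \<bullet> b\<bar> \<le> norm (z - z')" by (rule Basis_le_norm)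
    also have "\<dots> \<le> diameter X" using diameter_bounded_bound[OF assms z] by (simp add: dist_norm)
    finally show "\<bar>(z - z') \<bullet> b\<bar> \<le> diameter X" .
  qed
  then show "(\<Sum>b\<in>Basis. \<bar>(z - z') \<bullet> b\<bar>) \<le> real DIM('a) * diameter X" by simp
qed

lemma regret_event_measurable:
  fixes x :: "nat \<Rightarrow> 'w \<Rightarrow> 'a::euclidean_space"
  assumes x: "\<And>t. t \<in> {1..T} \<Longrightarrow> x t \<in> borel_measurable M" "\<And>t \<omega>. t \<in> {1..T} \<Longrightarrow> \<omega> \<in> space M \<Longrightarrow> x t \<omega> \<in> X"
    and cont: "continuous_on X (\<lambda>z. f z (h z))"
  shows "{\<omega> \<in> space M. regret X f h T (\<lambda>t. x t \<omega>) \<le> r} \<in> sets M"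
proof -
  have [measurable]: "(\<lambda>\<omega>. f (x t \<omega>) (h (x t \<omega>))) \<in> borel_measurable M" if t: "t \<in> {1..T}" for t
  proof -
    have "x t \<in> measurable M (restrict_space borel X)"
      by (rule measurable_restrict_space2[OF _ x(1)[OF t]]) (use x(2)[OF t] in auto)
    then show ?thesis
      by (rule measurable_compose[OF _ borel_measurable_continuous_on_restrict[OF cont]])
  qed
  have "(\<lambda>\<omega>. regret X f h T (\<lambda>t. x t \<omega>)) \<in> borel_measurable M"
    unfolding regret_def by (intro borel_measurable_sum borel_measurable_diff borel_measurable_const) simp
  then show ?thesis by measurable
qed

lemma gp_kernel_matern:
  assumes "\<nu> > 0" "l > 0" "\<sigma> > 0" "is_rkhs (matern \<nu> l :: 'a::euclidean_space \<Rightarrow> 'a \<Rightarrow> real) H ip"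
  shows "gp_kernel (matern \<nu> l :: 'a \<Rightarrow> 'a \<Rightarrow> real) (\<sigma>\<^sup>2)"
proof
  show "psd (matern \<nu> l :: 'a \<Rightarrow> 'a \<Rightarrow> real)" by (rule rkhs_psd[OF assms(4)])
  show "matern \<nu> l x x = 1" for x :: 'a by (simp add: matern_def)
  show "continuous_on UNIV (\<lambda>p. matern \<nu> l (fst p) (snd p :: 'a))"
    by (rule continuous_on_matern[OF assms(1,2)]) (intro continuous_intros)+
  show "\<sigma>\<^sup>2 > 0" using assms(3) by simp
qed

section \<open>The regret bound\<close>

theorem theorem3p3:
  fixes X :: "'a::euclidean_space set" and \<nu> l \<sigma> L\<^sub>f B :: real
    and H :: "('a \<Rightarrow> real) set" and ip :: "('a \<Rightarrow> real) \<Rightarrow> ('a \<Rightarrow> real) \<Rightarrow> real"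
  assumes "convex X" and "compact X"
    and "\<nu> > 0" and "l > 0" and "\<sigma> > 0"
    and "is_rkhs (matern \<nu> l) H ip"
  shows "\<exists>C>0. \<forall>(m::nat) (Y :: (nat \<Rightarrow> real) set) Z
           (g :: 'a \<Rightarrow> (nat \<Rightarrow> real) \<Rightarrow> real) (f :: 'a \<Rightarrow> (nat \<Rightarrow> real) \<Rightarrow> real)
           (M :: 'w measure) \<epsilon> x (\<delta>::real) (T::nat).
           1 \<le> m \<and> Y \<noteq> {} \<and> Y \<subseteq> coord_space m \<and> coord_convex m Y \<and> compact Y \<and>
           (\<exists>\<mu>>0. uniform_hessian_bound m \<mu> X Y g) \<and>
           (\<lambda>(u, y). g u y) \<in> sobolev_on m (\<nu> + DIM('a) / 2 + 1) (X \<times> Y) \<and>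
           rkhs_restr_norm_le H ip X m (lower_sol g Y) B \<and>
           Y \<subseteq> Z \<and> Z \<subseteq> coord_space m \<and> lipschitz_l1_on m L\<^sub>f X Z f \<and>
           0 < \<delta> \<and> \<delta> < 1 \<and> 1 \<le> T \<and>
           prob_space M \<and> subgaussian_noise M \<sigma> m T \<epsilon> \<and>
           gp_ucbl_run M (matern \<nu> l) \<sigma> m \<delta> B X Z f T x (observation (lower_sol g Y) \<epsilon> x) \<longrightarrow>
           measure M {\<omega> \<in> space M.
             regret X f (lower_sol g Y) T (\<lambda>t. x t \<omega>)
               \<le> C * real m * sqrt (real T * info_gain (matern \<nu> l) X \<sigma> T *
                                   (info_gain (matern \<nu> l) X \<sigma> T + ln (1 / \<delta>)))} \<ge> 1 - \<delta>"
proof -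
  interpret gp_kernel "matern \<nu> l :: 'a \<Rightarrow> 'a \<Rightarrow> real" "\<sigma>\<^sup>2"
    using assms(3-6) by (rule gp_kernel_matern)
  note H = assms(6)
  note sigma = refl[of "\<sigma>\<^sup>2"] \<open>\<sigma> > 0\<close>
  obtain D where D: "D \<ge> 0" "\<And>z z'. z \<in> X \<Longrightarrow> z' \<in> X \<Longrightarrow> (\<Sum>b\<in>Basis. \<bar>(z - z') \<bullet> b\<bar>) \<le> D"
    using sum_abs_Basis_bounded[OF compact_imp_bounded[OF \<open>compact X\<close>]] by blast
  define L where "L = \<bar>L\<^sub>f\<bar>"
  define g1 where "g1 = ln (1 + 1 / \<sigma>\<^sup>2) / 2"
  \<comment> \<open>\<open>CA\<close> serves dimensions with \<open>ln m \<le> 2 \<gamma>\<close>, \<open>CB\<close> larger ones; \<open>g1\<close> is the gain of one observation.\<close>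
  define CA where "CA = L * 2 * ((sqrt 6 + \<bar>B\<bar> / sqrt g1) * sqrt (2 * (\<sigma>\<^sup>2 + 1)))"
  define CB where "CB = L * (D + 2 * \<bar>B\<bar>) * \<sigma> / g1"
  define C where "C = CA + CB + 1"
  have g1: "g1 > 0" using s2_pos ln_gt_zero[of "1 + 1 / \<sigma>\<^sup>2"] by (simp add: g1_def)
  have L: "L \<ge> 0" by (simp add: L_def)
  have CA: "CA \<ge> 0" using L g1 by (auto simp: CA_def intro!: mult_nonneg_nonneg)
  have CB: "CB \<ge> 0" using L g1 D(1) \<open>\<sigma> > 0\<close> by (auto simp: CB_def intro!: mult_nonneg_nonneg divide_nonneg_nonneg)
  have C: "C > 0" "CA \<le> C" "CB \<le> C" using CA CB by (auto simp: C_def)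
  show ?thesis
  proof (intro exI[of _ C] conjI allI impI C(1), elim conjE exE)
    fix m Y Z g f \<epsilon> x and M :: "'w measure" and \<delta> \<mu> :: real and T :: nat
    assume m: "1 \<le> m" and Y: "Y \<noteq> {}" "Y \<subseteq> coord_space m" "compact Y"
      and hess: "uniform_hessian_bound m \<mu> X Y g"
      and le: "rkhs_restr_norm_le H ip X m (lower_sol g Y) B"
      and Z: "Y \<subseteq> Z" "Z \<subseteq> coord_space m" and lip0: "lipschitz_l1_on m L\<^sub>f X Z f"
      and \<delta>: "0 < \<delta>" "\<delta> < 1" and T: "1 \<le> T" and M: "prob_space M"
      and noise: "subgaussian_noise M \<sigma> m T \<epsilon>"
      and run: "gp_ucbl_run M (matern \<nu> l) \<sigma> m \<delta> B X Z f T x (observation (lower_sol g Y) \<epsilon> x)"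
    interpret prob_space M by (rule M)
    define h where "h = lower_sol g Y"
    define \<gamma> where "\<gamma> = info_gain (matern \<nu> l) X \<sigma> T"
    define S where "S = sqrt (real T * \<gamma> * (\<gamma> + ln (1 / \<delta>)))"
    define E where "E = {\<omega> \<in> space M. regret X f h T (\<lambda>t. x t \<omega>) \<le> C * real m * S}"
    note run = run[folded h_def] and le = le[folded h_def]
    note coord = rkhs_restr_norm_le_coordinates[OF H le]
    have B: "\<bar>B\<bar> = B" "B \<ge> 0" using coord(1) by auto
    have lip: "lipschitz_l1_on m L X Z f" unfolding L_def by (rule lipschitz_l1_on_abs[OF lip0])
    have hZ: "h z \<in> Z" if "z \<in> X" for z
      using lower_sol_in[OF Y(2,3,1) hess that] Z(1) unfolding h_def by blast
    note rounds = bspec[OF run[unfolded gp_ucbl_run_def]]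
    have arg: "is_arg_max (acquisition (matern \<nu> l) \<sigma> m \<delta> B Z f (map (\<lambda>s. x s \<omega>) [1..<t])
        (\<lambda>i. map (\<lambda>s. observation h \<epsilon> x s i \<omega>) [1..<t])) (\<lambda>z. z \<in> X) (x t \<omega>)"
      if "t \<in> {1..T}" "\<omega> \<in> space M" for t \<omega>
      using bspec[OF conjunct2[OF rounds[OF that(1)]] that(2)] .
    have inX: "x t \<omega> \<in> X" if "t \<in> {1..T}" "\<omega> \<in> space M" for t \<omega>
      using arg[OF that] by (simp add: is_arg_max_def)
    have \<gamma>0: "\<gamma> \<ge> 0" unfolding \<gamma>_def by (rule info_gain_nonneg[OF sigma])
    have ln\<delta>: "ln (1 / \<delta>) \<ge> 0" using \<delta> by simp
    have S0: "S \<ge> 0" using \<gamma>0 ln\<delta> by (simp add: S_def)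
    have "1 - \<delta> \<le> prob E"
    proof (cases "\<exists>p\<in>X. \<exists>q\<in>X. p \<noteq> q")
      case False
      \<comment> \<open>With a single feasible point \<open>\<gamma> = 0\<close> for \<open>T \<ge> 2\<close>, but the only possible query is optimal.\<close>
      have "regret X f h T (\<lambda>t. x t \<omega>) = 0" if \<omega>: "\<omega> \<in> space M" for \<omega>
      proof -
        have "(SUP z\<in>X. f z (h z)) - f (x t \<omega>) (h (x t \<omega>)) = 0" if t: "t \<in> {1..T}" for t
        proof -
          have "X = {x t \<omega>}" using inX[OF t \<omega>] False by blast
          then have "(SUP z\<in>X. f z (h z)) = (SUP z\<in>{x t \<omega>}. f z (h z))" by metis
          then show ?thesis by simp
        qed
        then show ?thesis unfolding regret_def by (intro sum.neutral) blast
      qed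
      then have "E = space M" unfolding E_def using C(1) S0 by auto
      then show ?thesis using \<delta> by (simp add: prob_space)
    next
      case True
      then obtain p q where pq: "p \<in> X" "q \<in> X" "p \<noteq> q" by blast
      have lower: "ln (1 + real T / \<sigma>\<^sup>2) / 2 \<le> \<gamma>"
        unfolding \<gamma>_def by (rule info_gain_lower[OF sigma \<open>convex X\<close> pq])
      show ?thesis
      proof (cases "ln (real m) \<le> 2 * \<gamma>")
        case False
        \<comment> \<open>Here \<open>m\<close> exceeds \<open>1 + T / \<sigma>\<^sup>2\<close>, and the oscillation of the objective, of order \<open>sqrt m\<close>, suffices.\<close>
        have "g1 \<le> ln (1 + real T / \<sigma>\<^sup>2) / 2"
          unfolding g1_def using s2_pos T by (simp add: add_pos_nonneg divide_right_mono)
        then have g1\<gamma>: "g1 \<le> \<gamma>" using lower by simp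
        have "ln (1 + real T / \<sigma>\<^sup>2) < ln (real m)" using False lower by simp
        then have "1 + real T / \<sigma>\<^sup>2 < real m"
          using m s2_pos by (subst (asm) ln_less_cancel_iff) (auto intro!: add_pos_nonneg)
        then have "real T / \<sigma>\<^sup>2 \<le> real m" by simp
        then have "real T \<le> real m * \<sigma>\<^sup>2" using s2_pos by (simp add: pos_divide_le_eq)
        then have "sqrt (real T) \<le> sqrt (real m * \<sigma>\<^sup>2)" by (rule real_sqrt_le_mono)
        then have sqrtT: "sqrt (real T) \<le> sqrt (real m) * \<sigma>" using \<open>\<sigma> > 0\<close> by (simp add: real_sqrt_mult)
        have sqrtm: "1 \<le> sqrt (real m)" using m by simp
        have gS: "sqrt (real T) * g1 \<le> S"
        proof -
          have "g1 * g1 \<le> \<gamma> * (\<gamma> + ln (1 / \<delta>))" using g1\<gamma> g1 ln\<delta> by (intro mult_mono) auto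
          then have "sqrt (g1 * g1) \<le> sqrt (\<gamma> * (\<gamma> + ln (1 / \<delta>)))" by (rule real_sqrt_le_mono)
          then have "g1 \<le> sqrt (\<gamma> * (\<gamma> + ln (1 / \<delta>)))" using g1 by simp
          then have "sqrt (real T) * g1 \<le> sqrt (real T) * sqrt (\<gamma> * (\<gamma> + ln (1 / \<delta>)))"
            by (rule mult_left_mono) simp
          then show ?thesis by (simp add: S_def real_sqrt_mult mult.assoc)
        qed
        have "regret X f h T (\<lambda>t. x t \<omega>) \<le> C * real m * S" if \<omega>: "\<omega> \<in> space M" for \<omega>
        proof -
          have "regret X f h T (\<lambda>t. x t \<omega>) \<le> real T * (L * (D + 2 * B * sqrt (real m)))"
            by (rule regret_le_diameter[OF lip L hZ inX[OF _ \<omega>] D(2) coord(4)])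
          also have "\<dots> \<le> real T * (L * ((D + 2 * B) * sqrt (real m)))"
          proof -
            have "D * 1 \<le> D * sqrt (real m)" using sqrtm D(1) by (rule mult_left_mono)
            then have "D + 2 * B * sqrt (real m) \<le> (D + 2 * B) * sqrt (real m)" by (simp add: distrib_right)
            then show ?thesis using L by (intro mult_left_mono) auto
          qed
          also have "\<dots> = L * (D + 2 * B) * (sqrt (real m) * sqrt (real T)) * sqrt (real T)"
            by (simp add: mult_ac)
          also have "\<dots> \<le> L * (D + 2 * B) * (sqrt (real m) * sqrt (real T)) * (sqrt (real m) * \<sigma>)"
            using L D(1) B(2) by (intro mult_left_mono[OF sqrtT]) simp
          also have "\<dots> = L * (D + 2 * B) * \<sigma> * real m * sqrt (real T)"
            by (simp add: mult_ac)
          also have "\<dots> = CB * real m * (sqrt (real T) * g1)"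
            using g1 B(1) by (simp add: CB_def)
          also have "\<dots> \<le> CB * real m * S"
            using CB by (intro mult_left_mono gS) simp
          also have "\<dots> \<le> C * real m * S"
            using C(3) S0 by (intro mult_right_mono) auto
          finally show ?thesis .
        qed
        then have "E = space M" unfolding E_def by auto
        then show ?thesis using \<delta> by (simp add: prob_space)
      next
        case small: True
        have "\<exists>u\<in>H. \<forall>z\<in>X. u z = h z i" if "i < m" for i
          using coord(2)[OF that] unfolding rkhs_restr_def by blast
        then obtain u where u: "\<And>i. i < m \<Longrightarrow> u i \<in> H" "\<And>i z. i < m \<Longrightarrow> z \<in> X \<Longrightarrow> u i z = h z i"
          by metis
        have ucont: "continuous_on UNIV (u i)" if "i < m" for i
          by (rule rkhs_continuous_on[OF H u(1)[OF that] cont])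
        have xF: "x (Suc n) \<in> borel_measurable (noise_past M \<epsilon> m n)" if "n < T" for n
          by (rule query_measurable_noise_past[OF run _ u(2) that])
            (rule borel_measurable_continuous_onI[OF ucont])
        \<comment> \<open>The event \<open>E\<close> must be shown measurable, since only the smaller \<open>G\<close> is known to have large probability.\<close>
        obtain G where G: "G \<in> sets M" "1 - \<delta> \<le> prob G"
          "\<And>\<omega> i n. \<omega> \<in> G \<Longrightarrow> i < m \<Longrightarrow> n \<le> T \<Longrightarrow>
             likelihood_ratio (\<lambda>j. x (Suc j) \<omega>) (\<lambda>j. \<epsilon> (Suc j) i \<omega>) n < real m / \<delta>"
          using likelihood_ratio_event[OF M noise refl xF m \<delta>(1)] by blast
        have "G \<subseteq> E"
        proof
          fix \<omega> assume \<omega>G: "\<omega> \<in> G"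
          then have \<omega>: "\<omega> \<in> space M" using sets.sets_into_space[OF G(1)] by blast
          let ?xs = "\<lambda>t. map (\<lambda>s. x s \<omega>) [1..<t]"
          have conf: "\<bar>post_mean (matern \<nu> l) \<sigma> (?xs t) (map (\<lambda>s. observation h \<epsilon> x s i \<omega>) [1..<t]) z - h z i\<bar>
              \<le> ucb_beta (matern \<nu> l) \<sigma> m \<delta> B (?xs t) * post_sd (matern \<nu> l) \<sigma> (?xs t) z"
            if t: "t \<in> {1..T}" and z: "z \<in> X" and i: "i < m" for t z i
          proof -
            obtain n where n: "t = Suc n" "n < T" using t by (cases t) auto
            show ?thesis
              unfolding n(1) observation_def
            proof (rule confidence_of_likelihood_ratio_less[OF sigma H, where x = "\<lambda>s. x s \<omega>" and \<epsilon> = "\<lambda>s. \<epsilon> s i \<omega>" and h = h and i = i])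
              show "(\<lambda>z. h z i) \<in> rkhs_restr H X" "rkhs_restr_norm H ip X (\<lambda>z. h z i) \<le> B" "z \<in> X"
                by (fact coord(2)[OF i] coord(3)[OF i] z)+
              show "x (Suc j) \<omega> \<in> X" if "j < n" for j
                using inX[OF _ \<omega>, of "Suc j"] that n(2) by simp
              show "likelihood_ratio (\<lambda>j. x (Suc j) \<omega>) (\<lambda>j. \<epsilon> (Suc j) i \<omega>) n < real m / \<delta>"
                using G(3)[OF \<omega>G i, of n] n(2) by simp
              show "0 < real m / \<delta>" using m \<delta> by simp
            qed
          qed
          have "regret X f h T (\<lambda>t. x t \<omega>)
             \<le> (\<Sum>t=1..T. L * (2 * real m * (ucb_beta (matern \<nu> l) \<sigma> m \<delta> B (?xs t) * post_sd (matern \<nu> l) \<sigma> (?xs t) (x t \<omega>))))"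
            unfolding regret_def
            by (intro sum_mono ucb_round_regret[OF lip L hZ Z(2) arg conf] \<omega>)
          also have "\<dots> = L * 2 * real m * (\<Sum>t=1..T. ucb_beta (matern \<nu> l) \<sigma> m \<delta> B (?xs t) * post_sd (matern \<nu> l) \<sigma> (?xs t) (x t \<omega>))"
            by (simp add: sum_distrib_left mult.assoc)
          also have "\<dots> \<le> L * 2 * real m * ((sqrt 6 + B / sqrt g1) * sqrt (2 * (\<sigma>\<^sup>2 + 1)) * S)"
            unfolding S_def \<gamma>_def g1_def using L
            by (intro mult_left_mono sum_ucb_widths_le[OF sigma \<open>convex X\<close> pq inX[OF _ \<omega>] T m \<delta> B(2) small[unfolded \<gamma>_def]]) auto
          also have "\<dots> = CA * real m * S" unfolding CA_def B(1) by (simp add: mult_ac)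
          also have "\<dots> \<le> C * real m * S" using C(2) S0 by (intro mult_right_mono) auto
          finally show "\<omega> \<in> E" using \<omega> by (simp add: E_def)
        qed
        moreover have "E \<in> sets M"
          unfolding E_def
        proof (rule regret_event_measurable)
          show "x t \<in> borel_measurable M" if t: "t \<in> {1..T}" for t
          proof -
            obtain n where n: "t = Suc n" "n < T" using t by (cases t) auto
            have "indep_vars (\<lambda>_. borel) (\<lambda>(t, i). \<epsilon> t i) ({1..T} \<times> {..<m})"
              using noise unfolding subgaussian_noise_def by blast
            then have rv: "\<epsilon> s i \<in> borel_measurable M" if "s \<in> {1..T}" "i < m" for s i
              using that unfolding indep_vars_def by fastforce
            have "subalgebra M (noise_past M \<epsilon> m n)"
              unfolding subalgebra_def using sets_noise_past_le[of n m \<epsilon> M M] rv n by auto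
            then show ?thesis unfolding n(1) using measurable_from_subalg xF[OF n(2)] by blast
          qed
          show "x t \<omega> \<in> X" if "t \<in> {1..T}" "\<omega> \<in> space M" for t \<omega> by (rule inX[OF that])
          show "continuous_on X (\<lambda>z. f z (h z))"
          proof (rule continuous_on_objective[OF lip hZ])
            fix i assume i: "i < m"
            have "continuous_on X (u i)" using ucont[OF i] by (rule continuous_on_subset) simp
            then show "continuous_on X (\<lambda>z. h z i)" using u(2)[OF i] by (simp cong: continuous_on_cong)
          qed
        qed
        ultimately have "prob G \<le> prob E" by (intro finite_measure_mono)
        then show ?thesis using G(2) by simp
      qed
    qed
    then show "1 - \<delta> \<le> measure M {\<omega> \<in> space M.
             regret X f (lower_sol g Y) T (\<lambda>t. x t \<omega>)
               \<le> C * real m * sqrt (real T * info_gain (matern \<nu> l) X \<sigma> T *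
                                   (info_gain (matern \<nu> l) X \<sigma> T + ln (1 / \<delta>)))}"
      unfolding E_def S_def \<gamma>_def h_def .
  qed
qed

end
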